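(* Let $n$ be a positive integer, let $w\in S_\infty^{(n)}$ and let $1\le\nu\le n-1$. Then the $\mathfrak{b}$-module $\mathcal{S}_w\otimes\mathcal{S}_{s_\nu}$ has a KP filtration.
   Context: A permutation is a bijection $w:\mathbb{N}\to\mathbb{N}$ ($\mathbb{N}$ = positive integers) fixing all but finitely many points; $S_\infty$ is the group of all permutations and $s_i\in S_\infty$ is the transposition of $i$ and $i+1$. Fix a positive integer $n$ and set $S_\infty^{(n)}=\{w\in S_\infty : w(n+1)<w(n+2)<\cdots\}$. Let $K$ be a field of characteristic zero, $\mathfrak{b}=\mathfrak{b}_n$ the Lie algebra of all upper triangular $n\times n$ matrices over $K$, and $\mathcal{U}(\mathfrak{b})$ its universal enveloping algebra. Tensor products and exterior powers are over $K$, with the usual $\mathfrak{b}$-action. Kraśkiewicz–Pragacz (KP) modules: let $K^n=\bigoplus_{1\le i\le n}Ku_i$ be the vector representation of $\mathfrak{b}$. For $w\in S_\infty^{(n)}$ and $j\in\mathbb{N}$ write $\{i<j : w(i)>w(j)\}=\{i_1<\cdots<i_{l_j}\}$ (all these $i$ are automatically $\le n$, and $l_j=0$ for almost all $j$), and put $u_w^{(j)}=u_{i_1}\wedge\cdots\wedge u_{i_{l_j}}\in\bigwedge^{l_j}K^n$ (with $u_w^{(j)}=1\in\bigwedge^0K^n=K$ if $l_j=0$). Let $u_w=u_w^{(1)}\otimes u_w^{(2)}\otimes\cdots\in\bigotimes_{j\in\mathbb{N}}\bigwedge^{l_j}K^n$. The KP module is the $\mathfrak{b}$-submodule $\mathcal{S}_w=\mathcal{U}(\mathfrak{b})u_w$.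 (For example $\mathcal{S}_{s_\nu}=\bigoplus_{1\le j\le\nu}Ku_j\subset K^n$.) A $\mathfrak{b}$-module has a KP filtration if it has a finite filtration by $\mathfrak{b}$-submodules each of whose successive subquotients is isomorphic to $\mathcal{S}_x$ for some $x\in S_\infty^{(n)}$. *)

theory Defs
  imports
    "Jordan_Normal_Form.VS_Connect"
    "HOL-Algebra.AbelCoset"
    "HOL-Library.Poly_Mapping"
    "HOL-Combinatorics.Permutations"
begin

section \<open>Permutations\<close>

text \<open>
  Permutations of the positive integers are functions on \<open>nat\<close> that fix \<open>0\<close>.
  The simple transposition \<open>s\<^sub>i\<close> is \<open>Transposition.transpose i (Suc i)\<close>.
\<close>

definition S_infty :: "(nat \<Rightarrow> nat) set" where
  "S_infty = {w. w permutes {1..} \<and> finite {i. w i \<noteq> i}}"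

definition S_infty_n :: "nat \<Rightarrow> (nat \<Rightarrow> nat) set" where
  "S_infty_n n = {w \<in> S_infty. strict_mono_on {n + 1..} w}"


section \<open>Modules over the Lie algebra of upper triangular matrices\<close>

definition borel_alg :: "nat \<Rightarrow> 'k::field mat set" where
  "borel_alg n = {X \<in> carrier_mat n n. upper_triangular X}"

text \<open>
  As usual for \<^typ>\<open>('a, 'b) module\<close>, the ring fields \<open>mult\<close> and \<open>one\<close> are meaningless.
\<close>

record ('k, 'v) brep = "('k, 'v) module" +
  act :: "'k mat \<Rightarrow> 'v \<Rightarrow> 'v"

definition b_module :: "nat \<Rightarrow> ('k::field, 'v) brep \<Rightarrow> bool" where
  "b_module n M \<longleftrightarrow>
     module class_ring M \<and>
     (\<forall>X \<in> borel_alg n. act M X \<in> LinearCombinations.module_hom class_ring M M) \<and>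
     (\<forall>X \<in> borel_alg n. \<forall>Y \<in> borel_alg n. \<forall>v \<in> carrier M.
        act M (X + Y) v = act M X v \<oplus>\<^bsub>M\<^esub> act M Y v) \<and>
     (\<forall>c. \<forall>X \<in> borel_alg n. \<forall>v \<in> carrier M.
        act M (c \<cdot>\<^sub>m X) v = c \<odot>\<^bsub>M\<^esub> act M X v) \<and>
     (\<forall>X \<in> borel_alg n. \<forall>Y \<in> borel_alg n. \<forall>v \<in> carrier M.
        act M (X * Y - Y * X) v = act M X (act M Y v) \<ominus>\<^bsub>M\<^esub> act M Y (act M X v))"

definition b_submodule :: "nat \<Rightarrow> 'v set \<Rightarrow> ('k::field, 'v) brep \<Rightarrow> bool" where
  "b_submodule n N M \<longleftrightarrow>
     LinearCombinations.submodule class_ring N M \<and>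
     (\<forall>X \<in> borel_alg n. \<forall>v \<in> N. act M X v \<in> N)"

definition b_isomorphic ::
    "nat \<Rightarrow> ('k::field, 'v) brep \<Rightarrow> ('k, 'u) brep \<Rightarrow> bool" where
  "b_isomorphic n M N \<longleftrightarrow>
     (\<exists>f \<in> LinearCombinations.module_hom class_ring M N.
        bij_betw f (carrier M) (carrier N) \<and>
        (\<forall>X \<in> borel_alg n. \<forall>v \<in> carrier M. f (act M X v) = act N X (f v)))"

text \<open>
  The quotient \<open>M/N\<close>, with cosets as elements; for a stable subspace \<open>N\<close> all cosets in the unions
  below coincide, so each union is the coset of an arbitrary representative.
\<close>

definition quot_rep :: "('k, 'v) brep \<Rightarrow> 'v set \<Rightarrow> ('k, 'v set) brep" where
  "quot_rep M N =
     \<lparr> carrier = a_rcosets\<^bsub>M\<^esub> N, mult = undefined, one = undefined,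
       zero = N, add = set_add M,
       smult = (\<lambda>c C. \<Union>v\<in>C. N +>\<^bsub>M\<^esub> (c \<odot>\<^bsub>M\<^esub> v)),
       act = (\<lambda>X C. \<Union>v\<in>C. N +>\<^bsub>M\<^esub> act M X v) \<rparr>"

text \<open>
  \<open>\<U>(\<b>) u\<close>: the algebra \<open>\<U>(\<b>)\<close> is spanned by the products
  \<open>X\<^sub>1 \<dots> X\<^sub>r\<close> (\<open>r \<ge> 0\<close>) of elements of \<open>\<b>\<close>.
\<close>

definition U_orbit :: "nat \<Rightarrow> ('k::field, 'v) brep \<Rightarrow> 'v \<Rightarrow> 'v set" where
  "U_orbit n M u =
     LinearCombinations.module.span class_ring M
       {foldr (act M) Xs u | Xs. set Xs \<subseteq> borel_alg n}"


section \<open>Tensor products and exterior powers\<close>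

text \<open>
  For a finite set \<open>J\<close> and a family \<open>(M j)\<close> of modules, the free vector space on the set of families
  \<open>x\<close> with \<open>x j \<in> M j\<close> (\<open>j \<in> J\<close>). The operators \<open>act\<close> send the basis element \<open>x\<close> to the sum over
  \<open>j\<close> of the basis elements obtained from \<open>x\<close> by applying \<open>X\<close> to the entry \<open>x j\<close>; they form a
  representation only after passing to a quotient in which the basis elements are multilinear.
\<close>

definition free_rep ::
    "nat set \<Rightarrow> (nat \<Rightarrow> ('k::field, 'v) brep) \<Rightarrow> ('k, (nat \<Rightarrow> 'v) \<Rightarrow>\<^sub>0 'k) brep" where
  "free_rep J M =
     \<lparr> carrier = {f. Poly_Mapping.keys f \<subseteq> (\<Pi>\<^sub>E j\<in>J. carrier (M j))},
       mult = undefined, one = undefined, zero = 0, add = (+),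
       smult = (\<lambda>c. Poly_Mapping.map ((*) c)),
       act = (\<lambda>X f. \<Sum>x\<in>Poly_Mapping.keys f. \<Sum>j\<in>J.
                Poly_Mapping.single (x(j := act (M j) X (x j))) (Poly_Mapping.lookup f x)) \<rparr>"

definition multilinear_rels ::
    "nat set \<Rightarrow> (nat \<Rightarrow> ('k::field, 'v) brep) \<Rightarrow> ((nat \<Rightarrow> 'v) \<Rightarrow>\<^sub>0 'k) set" where
  "multilinear_rels J M =
     {Poly_Mapping.single (x(j := a \<oplus>\<^bsub>M j\<^esub> b)) 1
        - Poly_Mapping.single (x(j := a)) 1 - Poly_Mapping.single (x(j := b)) 1
      | x j a b. x \<in> (\<Pi>\<^sub>E j\<in>J. carrier (M j)) \<and> j \<in> J \<and> a \<in> carrier (M j) \<and> b \<in> carrier (M j)}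
     \<union>
     {Poly_Mapping.single (x(j := c \<odot>\<^bsub>M j\<^esub> a)) 1 - Poly_Mapping.single (x(j := a)) c
      | x j a c. x \<in> (\<Pi>\<^sub>E j\<in>J. carrier (M j)) \<and> j \<in> J \<and> a \<in> carrier (M j)}"

definition alternating_rels ::
    "nat \<Rightarrow> ('k::field, 'v) brep \<Rightarrow> ((nat \<Rightarrow> 'v) \<Rightarrow>\<^sub>0 'k) set" where
  "alternating_rels l M =
     {Poly_Mapping.single x 1
      | x. x \<in> {..<l} \<rightarrow>\<^sub>E carrier M \<and> (\<exists>i<l. \<exists>j<l. i \<noteq> j \<and> x i = x j)}"

definition tensor_ideal ::
    "nat set \<Rightarrow> (nat \<Rightarrow> ('k::field, 'v) brep) \<Rightarrow> ((nat \<Rightarrow> 'v) \<Rightarrow>\<^sub>0 'k) set" where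
  "tensor_ideal J M =
     LinearCombinations.module.span class_ring (free_rep J M) (multilinear_rels J M)"

definition Tensor ::
    "nat set \<Rightarrow> (nat \<Rightarrow> ('k::field, 'v) brep) \<Rightarrow> ('k, ((nat \<Rightarrow> 'v) \<Rightarrow>\<^sub>0 'k) set) brep" where
  "Tensor J M = quot_rep (free_rep J M) (tensor_ideal J M)"

definition pure_tensor ::
    "nat set \<Rightarrow> (nat \<Rightarrow> ('k::field, 'v) brep) \<Rightarrow> (nat \<Rightarrow> 'v) \<Rightarrow> ((nat \<Rightarrow> 'v) \<Rightarrow>\<^sub>0 'k) set" where
  "pure_tensor J M x = tensor_ideal J M +>\<^bsub>free_rep J M\<^esub> Poly_Mapping.single x 1"

definition tensor ::
    "('k::field, 'v) brep \<Rightarrow> ('k, 'v) brep \<Rightarrow> ('k, ((nat \<Rightarrow> 'v) \<Rightarrow>\<^sub>0 'k) set) brep" where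
  "tensor M N = Tensor {0, 1} (\<lambda>i. if i = 0 then M else N)"

definition exterior_ideal ::
    "nat \<Rightarrow> ('k::field, 'v) brep \<Rightarrow> ((nat \<Rightarrow> 'v) \<Rightarrow>\<^sub>0 'k) set" where
  "exterior_ideal l M =
     LinearCombinations.module.span class_ring (free_rep {..<l} (\<lambda>_. M))
       (multilinear_rels {..<l} (\<lambda>_. M) \<union> alternating_rels l M)"

definition exterior_power ::
    "nat \<Rightarrow> ('k::field, 'v) brep \<Rightarrow> ('k, ((nat \<Rightarrow> 'v) \<Rightarrow>\<^sub>0 'k) set) brep" where
  "exterior_power l M = quot_rep (free_rep {..<l} (\<lambda>_. M)) (exterior_ideal l M)"

text \<open>\<open>wedge l M x\<close> is \<open>x 0 \<and> \<dots> \<and> x (l - 1)\<close>.\<close>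

definition wedge ::
    "nat \<Rightarrow> ('k::field, 'v) brep \<Rightarrow> (nat \<Rightarrow> 'v) \<Rightarrow> ((nat \<Rightarrow> 'v) \<Rightarrow>\<^sub>0 'k) set" where
  "wedge l M x =
     exterior_ideal l M +>\<^bsub>free_rep {..<l} (\<lambda>_. M)\<^esub> Poly_Mapping.single (restrict x {..<l}) 1"


section \<open>Kraskiewicz--Pragacz modules\<close>

definition vector_rep :: "nat \<Rightarrow> ('k::field, 'k vec) brep" where
  "vector_rep n =
     \<lparr> carrier = carrier_vec n, mult = undefined, one = undefined, zero = 0\<^sub>v n,
       add = (+), smult = (\<cdot>\<^sub>v), act = (*\<^sub>v) \<rparr>"

text \<open>Vectors are indexed from \<open>0\<close>, so the basis vector \<open>u\<^sub>i\<close> (\<open>1 \<le> i \<le> n\<close>) has index \<open>i - 1\<close>.\<close>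

definition basis_vec :: "nat \<Rightarrow> nat \<Rightarrow> 'k::field vec" where
  "basis_vec n i = unit_vec n (i - 1)"

definition inv_set :: "(nat \<Rightarrow> nat) \<Rightarrow> nat \<Rightarrow> nat set" where
  "inv_set w j = {i. 1 \<le> i \<and> i < j \<and> w i > w j}"

text \<open>
  The product over all positive integers \<open>j\<close> is restricted to the finitely many \<open>j\<close> with
  \<open>l\<^sub>j > 0\<close>; the omitted factors are the exterior power \<open>K\<close> of degree \<open>0\<close>, with vector \<open>1\<close>.
\<close>

definition inv_support :: "(nat \<Rightarrow> nat) \<Rightarrow> nat set" where
  "inv_support w = {j. inv_set w j \<noteq> {}}"

type_synonym 'k ext = "((nat \<Rightarrow> 'k vec) \<Rightarrow>\<^sub>0 'k) set"
type_synonym 'k kp = "((nat \<Rightarrow> 'k ext) \<Rightarrow>\<^sub>0 'k) set"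

definition KP_factor :: "nat \<Rightarrow> (nat \<Rightarrow> nat) \<Rightarrow> nat \<Rightarrow> ('k::field, 'k ext) brep" where
  "KP_factor n w j = exterior_power (card (inv_set w j)) (vector_rep n)"

definition KP_factor_gen :: "nat \<Rightarrow> (nat \<Rightarrow> nat) \<Rightarrow> nat \<Rightarrow> 'k::field ext" where
  "KP_factor_gen n w j =
     wedge (card (inv_set w j)) (vector_rep n)
       (\<lambda>k. basis_vec n (sorted_list_of_set (inv_set w j) ! k))"

definition KP_ambient :: "nat \<Rightarrow> (nat \<Rightarrow> nat) \<Rightarrow> ('k::field, 'k kp) brep" where
  "KP_ambient n w = Tensor (inv_support w) (KP_factor n w)"

definition KP_gen :: "nat \<Rightarrow> (nat \<Rightarrow> nat) \<Rightarrow> 'k::field kp" where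
  "KP_gen n w =
     pure_tensor (inv_support w) (KP_factor n w)
       (\<lambda>j\<in>inv_support w. KP_factor_gen n w j)"

definition KP_module :: "nat \<Rightarrow> (nat \<Rightarrow> nat) \<Rightarrow> ('k::field, 'k kp) brep" where
  "KP_module n w = (KP_ambient n w)\<lparr>carrier := U_orbit n (KP_ambient n w) (KP_gen n w)\<rparr>"

definition has_KP_filtration :: "nat \<Rightarrow> ('k::field, 'v) brep \<Rightarrow> bool" where
  "has_KP_filtration n M \<longleftrightarrow>
     b_module n M \<and>
     (\<exists>r F. F 0 = {\<zero>\<^bsub>M\<^esub>} \<and> F r = carrier M \<and>
        (\<forall>i\<le>r. b_submodule n (F i) M) \<and>
        (\<forall>i<r. F i \<subseteq> F (Suc i) \<and>
           (\<exists>x \<in> S_infty_n n.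
              b_isomorphic n (quot_rep (M\<lparr>carrier := F (Suc i)\<rparr>) (F i))
                (KP_module n x :: ('k, 'k kp) brep))))"

end

theory Submission
  imports Defs "HOL-Library.Function_Algebras"
begin

text \<open>
  Realize the modules in the space of functions on sets of cells \<open>(j, i)\<close>, where column \<open>j\<close> carries
  the \<open>j\<close>-th exterior power: the module of \<open>w\<close> becomes the orbit of the delta function at the
  inversions of \<open>w\<close> under the row operators \<open>e\<^sub>a\<^sub>b = \<Sum>\<^sub>j \<psi>\<^sub>j\<^sub>a \<psi>\<^sup>*\<^sub>j\<^sub>b\<close>, and tensoring with the module of
  \<open>s\<^sub>\<nu>\<close> adds one cell in column 0. The column operators commute with the row operators. For every
  cover \<open>w t\<^sub>p\<^sub>q\<close> of \<open>w\<close> with \<open>p \<le> \<nu> < q\<close> a product of column operators maps a suitable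
  vector of the tensor product to the generator of the module of \<open>w t\<^sub>p\<^sub>q\<close> and kills the vectors of
  the preceding covers. So these dimensions sum up to at most the dimension of the tensor product, and if
  equality holds, then the vectors generate a filtration with the required subquotients.

  Equality follows from Monk's formula once the dimension of the module of \<open>w\<close> is known to be the
  number \<open>\<SS>\<^sub>w(1, 1, \<dots>)\<close>, \<open>\<SS>\<^sub>w\<close> being the Schubert polynomial. The same argument
  applied to the transition formula bounds the dimension from below, and the inequality just obtained
  bounds it from above.
\<close>

section \<open>Linear algebra\<close>

text \<open>Up to signs, row and column operators are the two commuting general linear actions of
  skew Howe duality, so homomorphisms of modules are available without being constructed case by
  case. What is known about such a homomorphism is one vector that it does not kill and several that
  it does, never its whole kernel; each argument of this kind therefore bounds a dimension from
  below only. Only the values of Schubert polynomials at (1, 1, ...) enter, no characters. Taking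
  Macdonald's recursion over left descents as their definition turns Monk's formula into a
  commutator identity between going down on the left and going up on the right. Characteristic zero
  is used for the factorials that appear in powers of sums of commuting moves. A single cut-off
  \<open>L\<close> bounds rows and columns; it has to exceed N + 1 because the covers of a
  permutation of {1..N} can involve position N + 1.\<close>

locale lin_space = vector_space scale
  for scale :: "'a::field \<Rightarrow> 'b::ab_group_add \<Rightarrow> 'b"
begin

definition lin :: "('b \<Rightarrow> 'b) \<Rightarrow> bool" where
  "lin f \<longleftrightarrow> (\<forall>x y. f (x + y) = f x + f y) \<and> (\<forall>c x. f (scale c x) = scale c (f x))"

lemma lin_add:  "lin f \<Longrightarrow> f (x + y) = f x + f y"
  and lin_scale: "lin f \<Longrightarrow> f (scale c x) = scale c (f x)"
  by (auto simp: lin_def)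

lemma lin_0: "lin f \<Longrightarrow> f 0 = 0"
  by (metis lin_scale scale_zero_left)

section \<open>Images, preimages and dimensions of subspaces\<close>

lemma lin_subspace_image:
  assumes "lin f" "subspace S" shows "subspace (f ` S)"
proof (rule subspaceI)
  show "0 \<in> f ` S" using lin_0[OF assms(1)] subspace_0[OF assms(2)] by force
  show "x + y \<in> f ` S" if "x \<in> f ` S" "y \<in> f ` S" for x y
    using that subspace_add[OF assms(2)] by (auto simp: lin_add[OF assms(1), symmetric])
  show "scale c x \<in> f ` S" if "x \<in> f ` S" for c x
    using that subspace_scale[OF assms(2)] by (auto simp: lin_scale[OF assms(1), symmetric])
qed

lemma lin_subspace_vimage:
  assumes "lin f" "subspace S" shows "subspace {x. f x \<in> S}"
  using assms by (auto intro!: subspaceI simp: lin_0 lin_add lin_scale subspace_0 subspace_add subspace_scale)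

lemma lin_span_image:
  assumes "lin f" shows "f ` span S = span (f ` S)"
proof
  have "span S \<subseteq> {x. f x \<in> span (f ` S)}"
    by (intro span_minimal lin_subspace_vimage assms subspace_span) (auto intro: span_base)
  then show "f ` span S \<subseteq> span (f ` S)" by auto
  show "span (f ` S) \<subseteq> f ` span S"
    by (intro span_minimal lin_subspace_image assms subspace_span image_mono span_superset)
qed

text \<open>The Fock space is infinite-dimensional; the finite set \<open>B\<close> confines each
  dimension count to a finite-dimensional piece. With nested bases the dimensions of
  \<open>N\<close> and \<open>M\<close> become cardinalities of finite sets.\<close>

lemma finite_basis_extend:
  assumes "subspace N" "subspace M" "N \<subseteq> M" "M \<subseteq> span B" "finite B"
  obtains BN BM where "BN \<subseteq> BM" "finite BM" "independent BM" "span BN = N" "span BM = M"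
proof -
  obtain BN where BN: "BN \<subseteq> N" "independent BN" "N \<subseteq> span BN"
    using maximal_independent_subset by blast
  obtain BM where BM: "BN \<subseteq> BM" "BM \<subseteq> M" "independent BM" "M \<subseteq> span BM"
    using maximal_independent_subset_extend[of BN M] BN assms(3) by (metis subset_trans)
  have "finite BM"
    using independent_span_bound[OF assms(5) BM(3)] BM(2) assms(4) by blast
  moreover have "span BN = N" using BN assms(1) by (simp add: antisym span_minimal)
  moreover have "span BM = M" using BM assms(2) by (simp add: antisym span_minimal)
  ultimately show ?thesis using that BM by blast
qed

lemma dim_mono_subspace:
  assumes "subspace N" "subspace M" "N \<subseteq> M" "M \<subseteq> span B" "finite B"
  shows "dim N \<le> dim M"
proof -
  obtain BN BM where B: "BN \<subseteq> BM" "finite BM" "independent BM" "span BN = N" "span BM = M"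
    using finite_basis_extend[OF assms] .
  have "independent BN" using B independent_mono by blast
  then have "dim N = card BN" "dim M = card BM"
    using B dim_span dim_eq_card_independent by metis+
  then show ?thesis using B by (simp add: card_mono)
qed

lemma subspace_eq_of_dim:
  assumes "subspace N" "subspace M" "N \<subseteq> M" "M \<subseteq> span B" "finite B" "dim M \<le> dim N"
  shows "N = M"
proof -
  obtain BN BM where B: "BN \<subseteq> BM" "finite BM" "independent BM" "span BN = N" "span BM = M"
    using finite_basis_extend[OF assms(1-5)] .
  have "independent BN" using B independent_mono by blast
  then have "dim N = card BN" "dim M = card BM"
    using B dim_span dim_eq_card_independent by metis+
  then show ?thesis using B assms(6) by (metis card_seteq)
qed

text \<open>Half of rank-nullity: in a basis of \<open>M\<close> extending one of \<open>N\<close>,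
  the images of the added vectors already span the image of \<open>M\<close>. Usually only part of
  the kernel is known, hence an arbitrary \<open>N\<close> inside it.\<close>

lemma dim_kernel_image_le:
  assumes "subspace N" "subspace M" "N \<subseteq> M" "M \<subseteq> span B" "finite B"
    and f: "lin f" and ker: "\<And>x. x \<in> N \<Longrightarrow> f x = 0"
  shows "dim N + dim (f ` M) \<le> dim M"
proof -
  obtain BN BM where B: "BN \<subseteq> BM" "finite BM" "independent BM" "span BN = N" "span BM = M"
    using finite_basis_extend[OF assms(1-5)] .
  have "independent BN" using B independent_mono by blast
  then have d: "dim N = card BN" "dim M = card BM"
    using B dim_span dim_eq_card_independent by metis+
  have "f x = 0" if "x \<in> BN" for x using ker B(4) span_base that by blast
  then have "f ` BM \<subseteq> insert 0 (f ` (BM - BN))" by auto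
  then have "f ` M \<subseteq> span (f ` (BM - BN))"
    unfolding B(5)[symmetric] lin_span_image[OF f]
    by (metis span_insert_0 span_mono)
  then have "dim (f ` M) \<le> card (f ` (BM - BN))" using B by (intro dim_le_card) auto
  also have "\<dots> \<le> card (BM - BN)" using B by (intro card_image_le) auto
  also have "\<dots> = card BM - card BN" using B by (meson card_Diff_subset finite_subset)
  finally show ?thesis using d card_mono[OF B(2,1)] by linarith
qed

text \<open>The preceding inequality, applied to the full kernel, bounds its dimension by that of
  \<open>N\<close> and leaves it no room to be larger.\<close>

lemma kernel_eq_of_dim:
  assumes "subspace N" "subspace M" "N \<subseteq> M" "M \<subseteq> span B" "finite B"
    and f: "lin f" and ker: "\<And>x. x \<in> N \<Longrightarrow> f x = 0"
    and "dim M \<le> dim N + dim (f ` M)"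
  shows "{x \<in> M. f x = 0} = N"
proof -
  let ?K = "{x \<in> M. f x = 0}"
  have K: "subspace ?K" using assms(2) f
    by (auto intro!: subspaceI simp: lin_0 lin_add lin_scale subspace_0 subspace_add subspace_scale)
  have "dim ?K + dim (f ` M) \<le> dim M"
    using K assms by (intro dim_kernel_image_le) auto
  then have "dim ?K \<le> dim N" using assms(8) by linarith
  then have "N = ?K"
    using K assms by (intro subspace_eq_of_dim[of N ?K B]) auto
  then show ?thesis by simp
qed

section \<open>Cyclic modules over a set of operators\<close>

definition orbit :: "('b \<Rightarrow> 'b) set \<Rightarrow> 'b \<Rightarrow> 'b set" where
  "orbit A v = \<Inter> {W. subspace W \<and> v \<in> W \<and> (\<forall>e\<in>A. \<forall>x\<in>W. e x \<in> W)}"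

lemma orbit_subset:
  "subspace W \<Longrightarrow> v \<in> W \<Longrightarrow> (\<And>e x. e \<in> A \<Longrightarrow> x \<in> W \<Longrightarrow> e x \<in> W) \<Longrightarrow> orbit A v \<subseteq> W"
  by (auto simp: orbit_def)

lemma subspace_orbit: "subspace (orbit A v)"
  unfolding orbit_def by (intro subspace_Inter) auto

lemma orbit_base: "v \<in> orbit A v"
  by (auto simp: orbit_def)

lemma orbit_closed: "e \<in> A \<Longrightarrow> x \<in> orbit A v \<Longrightarrow> e x \<in> orbit A v"
  by (auto simp: orbit_def)

lemma orbit_closed_funpow: "e \<in> A \<Longrightarrow> x \<in> orbit A v \<Longrightarrow> (e ^^ m) x \<in> orbit A v"
  by (induction m) (auto intro: orbit_closed)

lemma orbit_scale:
  assumes "c \<noteq> 0" shows "orbit A (scale c v) = orbit A v"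
proof -
  have 1: "orbit A (scale c v) \<subseteq> orbit A v" for c v
    by (intro orbit_subset subspace_orbit) (auto intro: subspace_scale[OF subspace_orbit] orbit_base orbit_closed)
  show ?thesis using 1[of c v] 1[of "inverse c" "scale c v"] assms by simp
qed

lemma span_Union_closed:
  assumes "\<And>x. x \<in> S \<Longrightarrow> f x \<in> span S" "lin f" "x \<in> span S" shows "f x \<in> span S"
  using span_minimal[of S "{x. f x \<in> span S}"] lin_subspace_vimage[OF assms(2) subspace_span] assms
  by auto

text \<open>Commuting with \<open>e\<close> up to a multiple of \<open>f x\<close> suffices, since a
  subspace containing \<open>f x\<close> absorbs the multiple. Such a defect appears when
  \<open>f\<close> shifts weights, as the annihilator in \<open>last_proj\<close> does. The relation
  is required on the stable subspace \<open>M\<close> only, because the defect can be controlled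
  only there.\<close>

lemma orbit_image:
  assumes f: "lin f" and M: "subspace M" "v \<in> M" "\<And>e x. e \<in> A \<Longrightarrow> x \<in> M \<Longrightarrow> e x \<in> M"
    and tw: "\<And>e x. e \<in> A \<Longrightarrow> x \<in> M \<Longrightarrow> \<exists>c. f (e x) = e (f x) + scale c (f x)"
  shows "f ` orbit A v = orbit A (f v)"
proof
  have OM: "orbit A v \<subseteq> M" using M by (intro orbit_subset)
  have "orbit A v \<subseteq> M \<inter> {x. f x \<in> orbit A (f v)}"
  proof (rule orbit_subset)
    show "subspace (M \<inter> {x. f x \<in> orbit A (f v)})"
      by (intro subspace_inter M lin_subspace_vimage f subspace_orbit)
    fix e x assume "e \<in> A" "x \<in> M \<inter> {x. f x \<in> orbit A (f v)}"
    then show "e x \<in> M \<inter> {x. f x \<in> orbit A (f v)}"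
      using M(3) tw[of e x] orbit_closed[of e A "f x" "f v"] subspace_add[OF subspace_orbit[of A "f v"]]
        subspace_scale[OF subspace_orbit[of A "f v"]] by force
  qed (use M orbit_base in auto)
  then show "f ` orbit A v \<subseteq> orbit A (f v)" by auto
  show "orbit A (f v) \<subseteq> f ` orbit A v"
  proof (rule orbit_subset)
    show "subspace (f ` orbit A v)" by (intro lin_subspace_image f subspace_orbit)
    show "f v \<in> f ` orbit A v" using orbit_base by blast
    fix e y assume e: "e \<in> A" and "y \<in> f ` orbit A v"
    then obtain x where x: "x \<in> orbit A v" "y = f x" by blast
    then obtain c where c: "f (e x) = e y + scale c y" using tw[OF e] OM by blast
    \<comment> \<open>The defect is subtracted before applying \<open>f\<close>, inside the orbit of
      \<open>v\<close>.\<close>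
    have "e y = f (e x) + scale (-c) (f x)" using c x by simp
    also have "\<dots> = f (e x + scale (-c) x)" using f by (simp only: lin_add lin_scale)
    also have "\<dots> \<in> f ` orbit A v"
      using x orbit_closed[OF e x(1)] subspace_orbit by (intro imageI subspace_add subspace_scale)
    finally show "e y \<in> f ` orbit A v" .
  qed
qed

text \<open>Triangularity: \<open>f i\<close> kills the generators before \<open>v i\<close>, hence
  their orbits, and maps the orbit of \<open>v i\<close> onto that of \<open>f i (v i)\<close>. So
  each step of the chain \<open>F\<close> gains at least the dimension of the latter. If these gains
  already exhaust \<open>M\<close>, no step gains more, and \<open>F (Suc i)\<close> modulo
  \<open>F i\<close> is exactly that orbit.\<close>

lemma orbit_chain:
  fixes v :: "nat \<Rightarrow> 'b" and f :: "nat \<Rightarrow> 'b \<Rightarrow> 'b" and k :: nat and A :: "('b \<Rightarrow> 'b) set"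
  defines "F \<equiv> \<lambda>i. span (\<Union>j<i. orbit A (v j))"
  assumes fin: "M \<subseteq> span B" "finite B" and M: "subspace M" "\<And>e x. e \<in> A \<Longrightarrow> x \<in> M \<Longrightarrow> e x \<in> M"
    and A: "\<And>e. e \<in> A \<Longrightarrow> lin e" and v: "\<And>i. i < k \<Longrightarrow> v i \<in> M"
    and f: "\<And>i. i < k \<Longrightarrow> lin (f i)"
    and tw: "\<And>i e x. i < k \<Longrightarrow> e \<in> A \<Longrightarrow> x \<in> M \<Longrightarrow> \<exists>c. f i (e x) = e (f i x) + scale c (f i x)"
    and kill: "\<And>i j. j < i \<Longrightarrow> i < k \<Longrightarrow> f i (v j) = 0"
  shows "(\<Sum>i<k. dim (orbit A (f i (v i)))) \<le> dim M"
    and "dim M \<le> (\<Sum>i<k. dim (orbit A (f i (v i)))) \<Longrightarrow>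
           F k = M \<and> (\<forall>i<k. {x \<in> F (Suc i). f i x = 0} = F i \<and> f i ` F (Suc i) = orbit A (f i (v i)))"
proof -
  have OM: "orbit A (v i) \<subseteq> M" if "i < k" for i
    using M v[OF that] by (intro orbit_subset)
  have FM: "F i \<subseteq> M" if "i \<le> k" for i
    unfolding F_def using OM that M(1) by (intro span_minimal) (auto dest: less_le_trans)
  have Fs: "subspace (F i)" for i unfolding F_def by (rule subspace_span)
  have F0: "F 0 = {0}" by (simp add: F_def)
  have FS: "F i \<subseteq> F (Suc i)" for i unfolding F_def by (intro span_mono UN_mono) auto
  have img: "f i ` orbit A (v j) = orbit A (f i (v j))" if "i < k" "j < k" for i j
    using that M v f tw by (intro orbit_image[of _ M]) auto
  have z: "orbit A 0 = {0}"
    using orbit_subset[of "{0}" 0 A] A lin_0 orbit_base subspace_single_0 by fastforce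
  have ker: "f i x = 0" if "i < k" "x \<in> F i" for i x
  proof -
    have "subspace {x. f i x = 0}"
      using lin_subspace_vimage[OF f[OF that(1)] subspace_single_0] by simp
    moreover have "f i x = 0" if x: "x \<in> (\<Union>j<i. orbit A (v j))" for x
    proof -
      obtain j where j: "j < i" "x \<in> orbit A (v j)" using x by blast
      then have "f i x \<in> f i ` orbit A (v j)" by blast
      then show ?thesis using img[of i j] kill[of j i] z j \<open>i < k\<close> by auto
    qed
    ultimately have "F i \<subseteq> {x. f i x = 0}" unfolding F_def by (intro span_minimal) auto
    then show ?thesis using that by auto
  qed
  have imF: "f i ` F (Suc i) = orbit A (f i (v i))" if "i < k" for i
  proof
    have "f i ` (\<Union>j<Suc i. orbit A (v j)) \<subseteq> orbit A (f i (v i))"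
    proof safe
      fix j x assume j: "j < Suc i" "x \<in> orbit A (v j)"
      show "f i x \<in> orbit A (f i (v i))"
      proof (cases "j = i")
        case True then show ?thesis using img[OF that that] j by auto
      next
        case False
        then have "x \<in> (\<Union>j<i. orbit A (v j))" using j by auto
        then have "x \<in> F i" unfolding F_def by (rule span_base)
        then show ?thesis using ker[OF that] subspace_0[OF subspace_orbit] by simp
      qed
    qed
    then show "f i ` F (Suc i) \<subseteq> orbit A (f i (v i))"
      unfolding F_def lin_span_image[OF f[OF that]] by (intro span_minimal subspace_orbit) auto
    have "orbit A (v i) \<subseteq> (\<Union>j<Suc i. orbit A (v j))" by blast
    then have "orbit A (v i) \<subseteq> F (Suc i)" unfolding F_def using span_superset by blast
    then show "orbit A (f i (v i)) \<subseteq> f i ` F (Suc i)"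
      using img[OF that that] by blast
  qed
  have step: "dim (F i) + dim (orbit A (f i (v i))) \<le> dim (F (Suc i))" if "i < k" for i
    unfolding imF[OF that, symmetric]
    using Fs FS FM[of "Suc i"] that fin f ker
    by (intro dim_kernel_image_le[of _ _ B]) auto
  \<comment> \<open>The gain between two arbitrary stages, since the equality case needs the part
    below \<open>i\<close> and the part above \<open>Suc i\<close> separately. The bound of the last
    sum is the outer \<open>i\<close>.\<close>
  have sum: "(\<Sum>i<j. dim (orbit A (f i (v i)))) + dim (F i) \<le> dim (F j) + (\<Sum>i<i. dim (orbit A (f i (v i))))"
    if "i \<le> j" "j \<le> k" for i j
    using that
  proof (induction j)
    case (Suc j)
    show ?case
    proof (cases "i = Suc j")
      case False
      then show ?thesis using Suc step[of j] by simp
    qed simp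
  qed simp
  have FkM: "dim (F k) \<le> dim M" using Fs M FM fin by (intro dim_mono_subspace[of _ _ B]) auto
  have d0: "dim (F 0) = 0"
    using dim_eq_card_independent[OF independent_empty] dim_span[of "{}"] by (simp add: F0)
  show "(\<Sum>i<k. dim (orbit A (f i (v i)))) \<le> dim M"
    using sum[of 0 k] FkM d0 by simp
  assume eq: "dim M \<le> (\<Sum>i<k. dim (orbit A (f i (v i))))"
  have "F k = M"
    using eq sum[of 0 k] d0 Fs M FM fin by (intro subspace_eq_of_dim[of _ _ B]) auto
  moreover have "{x \<in> F (Suc i). f i x = 0} = F i" if "i < k" for i
  proof -
    \<comment> \<open>The gains up to \<open>i\<close> and those from \<open>Suc i\<close> on,
      compared with the assumed total, squeeze this single step.\<close>
    have "dim (F (Suc i)) \<le> dim (F i) + dim (orbit A (f i (v i)))"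
      using sum[of "Suc i" k] sum[of 0 i] d0 that eq FkM by simp
    then show ?thesis
      using imF[OF that] Fs FS FM[of "Suc i"] that fin f ker
      by (intro kernel_eq_of_dim[of _ _ B]) auto
  qed
  ultimately show "F k = M \<and> (\<forall>i<k. {x \<in> F (Suc i). f i x = 0} = F i \<and> f i ` F (Suc i) = orbit A (f i (v i)))"
    using imF by blast
qed

end

definition fscale :: "'k::field \<Rightarrow> ('a \<Rightarrow> 'k) \<Rightarrow> 'a \<Rightarrow> 'k" where
  "fscale c f = (\<lambda>x. c * f x)"

global_interpretation fs: lin_space fscale
  by unfold_locales (auto simp: fscale_def plus_fun_def algebra_simps)

section \<open>Bruhat covers and Schubert numbers\<close>

definition cover :: "(nat \<Rightarrow> nat) \<Rightarrow> nat \<Rightarrow> nat \<Rightarrow> bool" where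
  "cover w p q \<longleftrightarrow> 1 \<le> p \<and> p < q \<and> w p < w q \<and> (\<forall>i. p < i \<and> i < q \<longrightarrow> \<not> (w p < w i \<and> w i < w q))"

lemma cover_less: "cover w p q \<Longrightarrow> 1 \<le> p \<and> p < q"
  by (simp add: cover_def)

definition covers :: "nat \<Rightarrow> (nat \<Rightarrow> nat) \<Rightarrow> (nat \<times> nat) set" where
  "covers \<nu> w = {(p, q). p \<le> \<nu> \<and> \<nu> < q \<and> cover w p q}"

definition cells :: "(nat \<Rightarrow> nat) \<Rightarrow> (nat \<times> nat) set" where
  "cells w = {(j, i). i \<in> inv_set w j}"

abbreviation pos :: "(nat \<Rightarrow> nat) \<Rightarrow> nat \<Rightarrow> nat" where
  "pos w \<equiv> inv_into UNIV w"

definition left_descents :: "(nat \<Rightarrow> nat) \<Rightarrow> nat set" where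
  "left_descents w = {k. pos w (Suc k) < pos w k}"

text \<open>Moves the cells \<open>g i\<close> to \<open>f i\<close> for \<open>i\<close> in
  \<open>J\<close>. This is the effect of the highest nonvanishing power of a sum of such moves, see
  \<open>delta_sum_funpow\<close>.\<close>

definition relocate :: "('i \<Rightarrow> 'c) \<Rightarrow> ('i \<Rightarrow> 'c) \<Rightarrow> 'i set \<Rightarrow> 'c set \<Rightarrow> 'c set" where
  "relocate f g J S = (S - g ` J) \<union> f ` J"

lemma card_relocate:
  assumes "finite S" "inj_on f J" "inj_on g J" "g ` J \<subseteq> S" "f ` J \<inter> S = {}"
  shows "card (relocate f g J S) = card S"
proof -
  have "finite J" using assms finite_imageD finite_subset by metis
  then have "card (relocate f g J S) = card (S - g ` J) + card (f ` J)"
    unfolding relocate_def using assms by (intro card_Un_disjoint) auto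
  also have "\<dots> = card S"
    using assms card_mono[OF assms(1,4)] by (simp add: card_Diff_subset card_image \<open>finite J\<close>)
  finally show ?thesis .
qed

lemma mem_cells: "(j, i) \<in> cells w \<longleftrightarrow> 1 \<le> i \<and> i < j \<and> w j < w i"
  by (auto simp: cells_def inv_set_def)

text \<open>The inversion test for \<open>w t\<^sub>p\<^sub>q\<close>, with
  \<open>a, b, P, Q\<close> in place of the values of \<open>w\<close> at \<open>i, j, p, q\<close>.
  Injectivity at \<open>p\<close> and \<open>q\<close> and the cover condition are all that is used
  of \<open>w\<close>, which leaves a statement of linear arithmetic.\<close>

lemma cover_arith:
  fixes p q :: nat assumes
     "1 \<le> p"
     "p < q"
     "P < (Q::nat)"
     "\<lbrakk>p < i; i < q\<rbrakk> \<Longrightarrow> a < P \<or> Q < a"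
     "\<lbrakk>p < j; j < q\<rbrakk> \<Longrightarrow> b < P \<or> Q < b"
     "(a = P) = (i = p)"
     "(a = Q) = (i = q)"
     "(b = P) = (j = p)"
     "(b = Q) = (j = q)"
 shows "(1 \<le> i \<and>
      i < j \<and>
      (if j = p then Q else if j = q then P else b)
      < (if i = p then Q else if i = q then P else a)) =
     (j = q \<and> i = p \<or>
      j = q \<and> 1 \<le> i \<and> i < p \<and> P < a \<and> a < Q \<or>
      \<not> (j = p \<and> 1 \<le> i \<and> i < p \<and> P < a \<and> a < Q) \<and>
      (i = p \<and> q < j \<and> P < b \<and> b < Q \<or>
       \<not> (i = q \<and> q < j \<and> P < b \<and> b < Q) \<and>
       1 \<le> i \<and> i < j \<and> b < a))"
   using assms
  by presburger

section \<open>Inversion sets of a permutation of {1..N} and how they change\<close>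

context
  fixes w :: "nat \<Rightarrow> nat" and N :: nat
  assumes perm: "w permutes {1..N}"
begin

lemma perm_0: "w 0 = 0"
  using perm by (simp add: permutes_def)

lemma perm_large: "i > N \<Longrightarrow> w i = i"
  using perm by (simp add: permutes_def)

lemma perm_eq_iff: "w i = w j \<longleftrightarrow> i = j"
  using permutes_inj[OF perm] by (auto dest: injD)

lemma perm_le: "i \<le> N \<Longrightarrow> w i \<le> N"
  using permutes_in_image[OF perm, of i] perm_0 by (cases "i = 0") auto

lemma perm_pos: "1 \<le> i \<Longrightarrow> 1 \<le> w i"
  by (metis perm_0 perm_eq_iff less_one not_le)

lemma inv_perm: "w (pos w i) = i" "pos w (w i) = i"
  using permutes_inverses[OF perm] by auto

lemma cells_subset: "cells w \<subseteq> {1..N} \<times> {1..N}"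
proof
  fix x assume "x \<in> cells w"
  then obtain j i where x: "x = (j, i)" "1 \<le> i" "i < j" "w j < w i" by (cases x) (auto simp: mem_cells)
  have "j \<le> N"
  proof (rule ccontr)
    assume "\<not> j \<le> N"
    then have "j < w i" using perm_large[of j] x by simp
    then show False using perm_large[of i] perm_le[of i] x \<open>\<not> j \<le> N\<close> by (cases "i \<le> N") auto
  qed
  then show "x \<in> {1..N} \<times> {1..N}" using x by auto
qed

lemma finite_cells: "finite (cells w)"
  using cells_subset by (rule finite_subset) auto

lemma left_descents_bound: "k \<in> left_descents w \<Longrightarrow> 1 \<le> k \<and> Suc k \<le> N"
proof -
  assume k: "k \<in> left_descents w"
  then have "k \<noteq> 0" using inv_perm(2)[of 0] perm_0 by (metis left_descents_def mem_Collect_eq not_less_zero)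
  moreover have "Suc k \<le> N"
  proof (rule ccontr)
    assume "\<not> Suc k \<le> N"
    then have a: "N < Suc k" by simp
    then have "pos w (Suc k) = Suc k" using inv_perm(2)[of "Suc k"] perm_large[of "Suc k"] by simp
    then have "Suc k < pos w k" using k by (simp add: left_descents_def)
    then show False using inv_perm(1)[of k] perm_large[of "pos w k"] a by simp
  qed
  ultimately show ?thesis by simp
qed

lemma finite_left_descents: "finite (left_descents w)"
proof (rule finite_subset)
  show "left_descents w \<subseteq> {..N}"
  proof
    fix k assume "k \<in> left_descents w"
    from left_descents_bound[OF this] show "k \<in> {..N}" by simp
  qed
qed simp

text \<open>Further to the right, q - 1 would be a fixed point between \<open>p\<close> and
  \<open>q\<close> whose value lies between \<open>w p\<close> and \<open>w q = q\<close>, which a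
  cover forbids.\<close>

lemma covers_bound: "(p, q) \<in> covers \<nu> w \<Longrightarrow> q \<le> Suc (max N \<nu>)"
proof (rule ccontr)
  assume c: "(p, q) \<in> covers \<nu> w" and "\<not> q \<le> Suc (max N \<nu>)"
  then have q: "q > Suc N" "q > Suc \<nu>" by auto
  have p: "p \<le> \<nu>" "cover w p q" using c by (auto simp: covers_def)
  have "w (q - 1) = q - 1" "w q = q" by (rule perm_large, use q in simp)+
  moreover have "w p < q - 1"
    using perm_le[of p] perm_large[of p] p q by (cases "p \<le> N") auto
  moreover have "p < q - 1" "q - 1 < q" using p q by auto
  ultimately show False using p(2) unfolding cover_def by metis
qed

lemma finite_covers: "finite (covers \<nu> w)"
proof (rule finite_subset)
  show "covers \<nu> w \<subseteq> {..\<nu>} \<times> {..Suc (max N \<nu>)}"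
    using covers_bound by (auto simp: covers_def)
qed auto

text \<open>Left multiplication by \<open>s\<^sub>k\<close> exchanges the adjacent values k and k +
  1, so no comparison changes except the one between their two positions.\<close>

lemma cells_left_descent:
  assumes "k \<in> left_descents w"
  shows "(pos w k, pos w (Suc k)) \<in> cells w"
    and "cells (Transposition.transpose k (Suc k) \<circ> w) = cells w - {(pos w k, pos w (Suc k))}"
proof -
  have "pos w (Suc k) \<noteq> 0" using inv_perm(1)[of "Suc k"] perm_0 by (metis nat.distinct(1))
  then show 1: "(pos w k, pos w (Suc k)) \<in> cells w"
    using assms by (auto simp: mem_cells left_descents_def inv_perm)
  have "(j, i) \<in> cells (Transposition.transpose k (Suc k) \<circ> w) \<longleftrightarrow> (j, i) \<in> cells w \<and> (j, i) \<noteq> (pos w k, pos w (Suc k))"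
    for i j
  proof -
    have "w i = Suc k \<longleftrightarrow> i = pos w (Suc k)" "w j = Suc k \<longleftrightarrow> j = pos w (Suc k)"
      "w i = k \<longleftrightarrow> i = pos w k" "w j = k \<longleftrightarrow> j = pos w k" using inv_perm by metis+
    then show ?thesis using assms unfolding mem_cells left_descents_def Transposition.transpose_def comp_def
      by auto
  qed
  then show "cells (Transposition.transpose k (Suc k) \<circ> w) = cells w - {(pos w k, pos w (Suc k))}"
    by auto
qed

lemma card_cells_left_descent:
  assumes "k \<in> left_descents w"
  shows "card (cells w) = Suc (card (cells (Transposition.transpose k (Suc k) \<circ> w)))"
  using card_Suc_Diff1[OF finite_cells cells_left_descent(1)[OF assms]] cells_left_descent(2)[OF assms]
  by simp

text \<open>Exchanging the entries at \<open>p\<close> and \<open>q\<close> creates one inversion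
  and otherwise transports inversions: a later entry with value between \<open>w p\<close> and
  \<open>w q\<close> was inverted with position \<open>q\<close> and is now inverted with
  \<open>p\<close>; an earlier one was inverted with \<open>p\<close> and is now inverted with
  \<open>q\<close>. These constituents are later produced by a row operator, a column operator and
  the transfer of the cell of column 0.\<close>

lemma cells_cover:
  assumes c: "cover w p q"
  shows "cells (w \<circ> Transposition.transpose p q) =
    insert (q, p) (relocate (Pair q) (Pair p) {i. 1 \<le> i \<and> i < p \<and> w p < w i \<and> w i < w q}
      (relocate (\<lambda>j. (j, p)) (\<lambda>j. (j, q)) {j. q < j \<and> w p < w j \<and> w j < w q} (cells w)))" (is "?l = ?r")
proof -
  have pq: "1 \<le> p" "p < q" "w p < w q" and
    btw: "\<And>i. p < i \<Longrightarrow> i < q \<Longrightarrow> w i \<le> w p \<or> w q \<le> w i"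
    using c unfolding cover_def by (auto simp: not_less)
  have btw': "w i < w p \<or> w q < w i" if "p < i" "i < q" for i
    using btw[OF that] perm_eq_iff[of i p] perm_eq_iff[of i q] that by auto
  have L: "(j, i) \<in> ?l \<longleftrightarrow> 1 \<le> i \<and> i < j \<and> (if j = p then w q else if j = q then w p else w j) < (if i = p then w q else if i = q then w p else w i)"
    for i j unfolding mem_cells Transposition.transpose_def by (simp add: comp_def)
  have R: "(j, i) \<in> ?r \<longleftrightarrow> (j = q \<and> i = p) \<or>
      (j = q \<and> 1 \<le> i \<and> i < p \<and> w p < w i \<and> w i < w q) \<or>
     \<not> (j = p \<and> 1 \<le> i \<and> i < p \<and> w p < w i \<and> w i < w q) \<and>
     (i = p \<and> q < j \<and> w p < w j \<and> w j < w q \<or>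
      \<not> (i = q \<and> q < j \<and> w p < w j \<and> w j < w q) \<and> 1 \<le> i \<and> i < j \<and> w j < w i)" for i j
    unfolding relocate_def mem_cells[symmetric] by auto
  have E: "w i = w p \<longleftrightarrow> i = p" "w i = w q \<longleftrightarrow> i = q" for i by (simp_all add: perm_eq_iff)
  have "(j, i) \<in> ?l \<longleftrightarrow> (j, i) \<in> ?r" for i j
    unfolding L R by (rule cover_arith[OF pq btw' btw' E E])
  then show ?thesis by auto
qed

lemma card_cells_cover:
  assumes c: "cover w p q"
  shows "card (cells (w \<circ> Transposition.transpose p q)) = Suc (card (cells w))"
proof -
  have pq: "1 \<le> p" "p < q" "w p < w q"
    using c unfolding cover_def by auto
  let ?J = "{j. q < j \<and> w p < w j \<and> w j < w q}" and ?B = "{i. 1 \<le> i \<and> i < p \<and> w p < w i \<and> w i < w q}"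
  let ?T = "relocate (\<lambda>j. (j, p)) (\<lambda>j. (j, q)) ?J (cells w)"
  have T: "card ?T = card (cells w)"
    using pq finite_cells by (intro card_relocate) (auto simp: mem_cells inj_on_def)
  have "?J \<subseteq> fst ` cells w"
  proof
    fix j assume "j \<in> ?J"
    then have "(j, q) \<in> cells w" using pq by (simp add: mem_cells)
    then show "j \<in> fst ` cells w" by (rule image_eqI[rotated]) simp
  qed
  then have fT: "finite ?T" unfolding relocate_def using finite_cells finite_subset by blast
  have "card (relocate (Pair q) (Pair p) ?B ?T) = card ?T"
    using pq fT by (intro card_relocate) (auto simp: relocate_def mem_cells inj_on_def)
  moreover have "(q, p) \<notin> relocate (Pair q) (Pair p) ?B ?T"
    using pq by (auto simp: relocate_def mem_cells)
  moreover have "finite (relocate (Pair q) (Pair p) ?B ?T)" using fT by (simp add: relocate_def)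
  ultimately show ?thesis using T by (simp add: cells_cover[OF c])
qed

end

section \<open>Schubert numbers, Monk's formula and the transition formula\<close>

lemma permutes_transpose_left:
  "w permutes {1..N} \<Longrightarrow> k \<in> left_descents w \<Longrightarrow> Transposition.transpose k (Suc k) \<circ> w permutes {1..N}"
  using left_descents_bound[of w N k] by (intro permutes_compose permutes_swap_id) auto

lemma permutes_transpose_right:
  fixes w :: "nat \<Rightarrow> nat"
  shows "w permutes {1..N} \<Longrightarrow> 1 \<le> p \<Longrightarrow> p \<le> M \<Longrightarrow> 1 \<le> q \<Longrightarrow> q \<le> M \<Longrightarrow> N \<le> M \<Longrightarrow>
   w \<circ> Transposition.transpose p q permutes {1..M}"
  by (rule permutes_compose[OF permutes_swap_id permutes_subset[of w "{1..N}"]]) auto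

text \<open>The first argument is meant to be the length and makes the recursion primitive. A left
  descent k is a possible first letter of a reduced word; the successive divisions build up the
  factor 1/l! in front of the sum over reduced words.\<close>

fun schub_aux :: "nat \<Rightarrow> (nat \<Rightarrow> nat) \<Rightarrow> real" where
  "schub_aux 0 w = 1"
| "schub_aux (Suc l) w =
     (\<Sum>k\<in>left_descents w. real k * schub_aux l (Transposition.transpose k (Suc k) \<circ> w)) / real (Suc l)"

text \<open>By Macdonald's identity this is the value at \<open>(1, 1, \<dots>)\<close> of the Schubert polynomial of \<open>w\<close>.\<close>

definition schub :: "(nat \<Rightarrow> nat) \<Rightarrow> real" where
  "schub w = schub_aux (card (cells w)) w"

lemma schub_rec:
  assumes w: "w permutes {1..N}"
  shows "real (card (cells w)) * schub w =
    (\<Sum>k\<in>left_descents w. real k * schub (Transposition.transpose k (Suc k) \<circ> w))"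
proof (cases "card (cells w)")
  case 0
  then have "cells w = {}" using finite_cells[OF w] by simp
  then have "left_descents w = {}" using cells_left_descent(1)[OF w] by auto
  then show ?thesis using 0 by simp
next
  case (Suc l)
  have "schub (Transposition.transpose k (Suc k) \<circ> w) = schub_aux l (Transposition.transpose k (Suc k) \<circ> w)"
    if "k \<in> left_descents w" for k
    using card_cells_left_descent[OF w that] Suc by (simp add: schub_def)
  then show ?thesis by (simp add: schub_def Suc)
qed

text \<open>The two multiplications can interfere only through the values k and k + 1. Unless these
  are the values at \<open>p\<close> and \<open>q\<close>, the cover condition on either side
  forbids the exchange of \<open>p\<close> and \<open>q\<close> to reverse the order of their
  positions.\<close>

lemma left_descents_cover_iff:
  assumes w: "w permutes {1..N}" and pq: "1 \<le> p" "p < q" and nadj: "{w p, w q} \<noteq> {k, Suc k}"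
  shows "cover w p q \<and> k \<in> left_descents (w \<circ> Transposition.transpose p q) \<longleftrightarrow>
         k \<in> left_descents w \<and> cover (Transposition.transpose k (Suc k) \<circ> w) p q"
proof -
  define x y where "x = pos w k" and "y = pos w (Suc k)"
  have xy: "w x = k" "w y = Suc k" by (simp_all add: x_def y_def inv_perm[OF w])
  have X: "w i = k \<longleftrightarrow> i = x" and Y: "w i = Suc k \<longleftrightarrow> i = y" for i
    using xy perm_eq_iff[OF w] by metis+
  let ?t = "Transposition.transpose p q" and ?s = "Transposition.transpose k (Suc k)"
  have inv_wt: "pos (w \<circ> ?t) = ?t \<circ> pos w"
    by (simp add: o_inv_distrib[OF permutes_bij[OF w]])
  have D: "k \<in> left_descents (w \<circ> ?t) \<longleftrightarrow> ?t y < ?t x" "k \<in> left_descents w \<longleftrightarrow> y < x"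
    unfolding left_descents_def inv_wt by (simp_all add: x_def y_def)
  have s: "?s a < ?s b \<longleftrightarrow> (a = Suc k \<and> b = k \<or> a < b \<and> \<not> (a = k \<and> b = Suc k))" for a b
    by (auto simp: Transposition.transpose_def)
  have neq: "x \<noteq> y" "\<not> (x = p \<and> y = q)" "\<not> (x = q \<and> y = p)" using xy nadj by auto
  have t: "?t y = (if y = p then q else if y = q then p else y)"
    "?t x = (if x = p then q else if x = q then p else x)"
    by (auto simp: Transposition.transpose_def)
  have CS: "cover (?s \<circ> w) p q \<longleftrightarrow> w p < w q \<and> (\<forall>i. p < i \<and> i < q \<longrightarrow>
     \<not> ((w p = Suc k \<and> w i = k \<or> w p < w i \<and> \<not> (w p = k \<and> w i = Suc k)) \<and>
        (w i = Suc k \<and> w q = k \<or> w i < w q \<and> \<not> (w i = k \<and> w q = Suc k))))"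
    unfolding cover_def comp_def s using pq nadj by auto
  have CW: "cover w p q \<longleftrightarrow> w p < w q \<and> (\<forall>i. p < i \<and> i < q \<longrightarrow> \<not> (w p < w i \<and> w i < w q))"
    using pq by (simp add: cover_def)
  show ?thesis
  proof
    assume "cover w p q \<and> k \<in> left_descents (w \<circ> ?t)"
    then have a: "?t y < ?t x" "w p < w q" "\<And>i. p < i \<Longrightarrow> i < q \<Longrightarrow> \<not> (w p < w i \<and> w i < w q)"
      unfolding D CW by auto
    have "y < x"
    proof (rule ccontr)
      assume "\<not> y < x"
      then have "x < y" using neq by simp
      \<comment> \<open>Only an entry carried across the other can turn the order around; the entry
        jumped over then has a value strictly between \<open>w p\<close> and
        \<open>w q\<close>.\<close>
      then consider "x = p" "y < q" | "y = q" "p < x" using a(1) neq pq t by (auto split: if_splits)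
      then show False
      proof cases
        case 1
        then show False using a(2) a(3)[of y] \<open>x < y\<close> xy nadj by auto
      next
        case 2
        then show False using a(2) a(3)[of x] \<open>x < y\<close> xy nadj by auto
      qed
    qed
    moreover have False if i: "p < i" "i < q" "w p = Suc k \<and> w i = k \<or> w i = Suc k \<and> w q = k" for i
    proof -
      have "y = p \<and> x = i \<or> y = i \<and> x = q" using i(3) X Y by auto
      then show False using a(1) i(1,2) pq t by (auto split: if_splits)
    qed
    ultimately show "k \<in> left_descents w \<and> cover (?s \<circ> w) p q"
      unfolding D CS using a(2,3) by blast
  next
    assume "k \<in> left_descents w \<and> cover (?s \<circ> w) p q"
    then have a: "y < x" "w p < w q" and a3: "\<And>i. p < i \<Longrightarrow> i < q \<Longrightarrow>
     \<not> ((w p = Suc k \<and> w i = k \<or> w p < w i \<and> \<not> (w p = k \<and> w i = Suc k)) \<and>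
        (w i = Suc k \<and> w q = k \<or> w i < w q \<and> \<not> (w i = k \<and> w q = Suc k)))"
      unfolding D CS by auto
    have "?t y < ?t x"
    proof (rule ccontr)
      assume n: "\<not> ?t y < ?t x"
      then consider "y = p" "x < q" | "x = q" "p < y" using a(1) neq pq t by (auto split: if_splits)
      then show False
      proof cases
        case 1
        then show False using a a3[of x] xy nadj by auto
      next
        case 2
        then show False using a a3[of y] xy nadj by auto
      qed
    qed
    moreover have "\<not> (w p < w i \<and> w i < w q)" if i: "p < i" "i < q" for i
    proof
      assume "w p < w i \<and> w i < w q"
      then have "w p = k \<and> w i = Suc k \<or> w i = k \<and> w q = Suc k" using a3[OF i] by blast
      then have "x = p \<and> y = i \<or> x = i \<and> y = q" using X Y by auto
      then show False using a(1) i by auto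
    qed
    ultimately show "cover w p q \<and> k \<in> left_descents (w \<circ> ?t)"
      unfolding D CW using a(2) by blast
  qed
qed

text \<open>Abel summation of k (a(k) - a(k + 1)), where a(k) tells whether the value k stands at a
  position up to \<nu>: the result counts these values, and there are \<nu> of them. The two sums
  are the positive and the negative part.\<close>

lemma sum_crossings:
  assumes w: "w permutes {1..N}" and M: "N \<le> M" "\<nu> \<le> M"
  shows "(\<Sum>k | 1 \<le> k \<and> pos w k \<le> \<nu> \<and> \<nu> < pos w (Suc k). real k) =
         real \<nu> + (\<Sum>k | 1 \<le> k \<and> pos w (Suc k) \<le> \<nu> \<and> \<nu> < pos w k. real k)"
proof -
  let ?a = "\<lambda>k. of_bool (pos w k \<le> \<nu>) :: real"
  have iw: "pos w permutes {1..N}" using w by (rule permutes_inv)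
  have big: "pos w k > \<nu>" if "k > M" for k using perm_large[OF iw, of k] that M by simp
  have big': "k \<le> M" if "pos w k \<le> \<nu>" for k using big[of k] that by (meson not_le)
  have S1: "(\<Sum>k | 1 \<le> k \<and> pos w k \<le> \<nu> \<and> \<nu> < pos w (Suc k). real k) = (\<Sum>k\<in>{1..M}. real k * of_bool (pos w k \<le> \<nu> \<and> \<nu> < pos w (Suc k)))"
    using big' by (intro sum.mono_neutral_cong_left) auto
  have S2: "(\<Sum>k | 1 \<le> k \<and> pos w (Suc k) \<le> \<nu> \<and> \<nu> < pos w k. real k) = (\<Sum>k\<in>{1..M}. real k * of_bool (pos w (Suc k) \<le> \<nu> \<and> \<nu> < pos w k))"
    by (intro sum.mono_neutral_cong_left) (auto dest!: big')
  have A: "(\<Sum>k\<in>{1..m}. real k * (?a k - ?a (Suc k))) = (\<Sum>k\<in>{1..m}. ?a k) - real m * ?a (Suc m)" for m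
    by (induction m) (auto simp: algebra_simps)
  have "(\<Sum>k\<in>{1..M}. ?a k) = real (card {k \<in> {1..M}. pos w k \<le> \<nu>})"
    by (simp add: sum.If_cases of_bool_def Int_def)
  also have "{k \<in> {1..M}. pos w k \<le> \<nu>} = w ` {1..\<nu>}"
  proof
    show "{k \<in> {1..M}. pos w k \<le> \<nu>} \<subseteq> w ` {1..\<nu>}"
    proof
      fix k assume "k \<in> {k \<in> {1..M}. pos w k \<le> \<nu>}"
      then show "k \<in> w ` {1..\<nu>}"
        using perm_pos[OF iw, of k] inv_perm(1)[OF w, of k] by (intro image_eqI[of _ _ "pos w k"]) auto
    qed
    show "w ` {1..\<nu>} \<subseteq> {k \<in> {1..M}. pos w k \<le> \<nu>}"
    proof
      fix k assume "k \<in> w ` {1..\<nu>}"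
      then obtain i where i: "k = w i" "1 \<le> i" "i \<le> \<nu>" by auto
      have "w i \<le> M" using perm_le[OF w, of i] perm_large[OF w, of i] i M by (cases "i \<le> N") auto
      then show "k \<in> {k \<in> {1..M}. pos w k \<le> \<nu>}"
        using i perm_pos[OF w, of i] by (auto simp: inv_perm[OF w])
    qed
  qed
  also have "card (w ` {1..\<nu>}) = \<nu>"
    using card_image[OF inj_on_subset[OF permutes_inj[OF w]], of "{1..\<nu>}"] by simp
  finally have "(\<Sum>k\<in>{1..M}. real k * (?a k - ?a (Suc k))) = real \<nu>"
    using A[of M] big[of "Suc M"] by simp
  moreover have "(\<Sum>k\<in>{1..M}. real k * (?a k - ?a (Suc k))) =
     (\<Sum>k\<in>{1..M}. real k * of_bool (pos w k \<le> \<nu> \<and> \<nu> < pos w (Suc k))) - (\<Sum>k\<in>{1..M}. real k * of_bool (pos w (Suc k) \<le> \<nu> \<and> \<nu> < pos w k))"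
    unfolding sum_subtractf[symmetric] by (intro sum.cong) (auto simp: not_le[symmetric])
  ultimately show ?thesis unfolding S1 S2 by simp
qed

text \<open>The operator sending \<open>w\<close> to the sum over its left descents \<open>k\<close> of \<open>k (s\<^sub>k w)\<close> and the one
  sending \<open>w\<close> to the sum of its covers have commutator \<open>\<nu>\<close>.\<close>

lemma left_descents_covers_commute:
  fixes g :: "(nat \<Rightarrow> nat) \<Rightarrow> real"
  assumes w: "w permutes {1..N}"
  shows "(\<Sum>(p, q)\<in>covers \<nu> w. \<Sum>k\<in>left_descents (w \<circ> Transposition.transpose p q).
            real k * g (Transposition.transpose k (Suc k) \<circ> (w \<circ> Transposition.transpose p q))) =
         (\<Sum>k\<in>left_descents w. \<Sum>(p, q)\<in>covers \<nu> (Transposition.transpose k (Suc k) \<circ> w).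
            real k * g (Transposition.transpose k (Suc k) \<circ> w \<circ> Transposition.transpose p q)) +
         real \<nu> * g w"
proof -
  let ?s = "\<lambda>k. Transposition.transpose k (Suc k)" and ?t = "\<lambda>p q. Transposition.transpose p q :: nat \<Rightarrow> nat"
  let ?h = "\<lambda>(k, p, q). real k * g (?s k \<circ> w \<circ> ?t p q)"
  \<comment> \<open>Triples for which \<open>s\<^sub>k\<close> undoes
    \<open>t\<^sub>p\<^sub>q\<close>; they contribute multiples of \<open>g w\<close>.\<close>
  define adj where "adj = {(k, p, q). {w p, w q} = {k, Suc k}}"
  define A where "A = {(k, p, q). (p, q) \<in> covers \<nu> w \<and> k \<in> left_descents (w \<circ> ?t p q)}"
  define B where "B = Sigma (left_descents w) (\<lambda>k. covers \<nu> (?s k \<circ> w))"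
  have perm_t: "\<exists>M. w \<circ> ?t p q permutes {1..M}" if "(p, q) \<in> covers \<nu> w" for p q
    using that permutes_transpose_right[OF w, of p "max N q" q] by (auto simp: covers_def cover_def)
  have fin_t: "finite (left_descents (w \<circ> ?t p q))" if "(p, q) \<in> covers \<nu> w" for p q
    using perm_t[OF that] finite_left_descents by blast
  have finB: "finite B" unfolding B_def
    using finite_left_descents[OF w] finite_covers[OF permutes_transpose_left[OF w]] by blast
  have A': "A = (\<lambda>((p, q), k). (k, p, q)) ` Sigma (covers \<nu> w) (\<lambda>(p, q). left_descents (w \<circ> ?t p q))"
    unfolding A_def by force
  have finA: "finite A" unfolding A' using finite_covers[OF w] fin_t by (intro finite_imageI finite_SigmaI) auto
  have SA: "(\<Sum>(p, q)\<in>covers \<nu> w. \<Sum>k\<in>left_descents (w \<circ> ?t p q). real k * g (?s k \<circ> (w \<circ> ?t p q))) = sum ?h A"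
  proof -
    have "(\<Sum>(p, q)\<in>covers \<nu> w. \<Sum>k\<in>left_descents (w \<circ> ?t p q). real k * g (?s k \<circ> (w \<circ> ?t p q))) =
       (\<Sum>x\<in>covers \<nu> w. \<Sum>k\<in>(case x of (p, q) \<Rightarrow> left_descents (w \<circ> ?t p q)). ?h (k, x))"
      by (intro sum.cong) (auto simp: comp_assoc)
    also have "\<dots> = (\<Sum>(x, k)\<in>Sigma (covers \<nu> w) (\<lambda>(p, q). left_descents (w \<circ> ?t p q)). ?h (k, x))"
      using finite_covers[OF w] fin_t by (intro sum.Sigma) auto
    also have "\<dots> = sum ?h A" unfolding A'
      by (subst sum.reindex) (auto simp: inj_on_def intro!: sum.cong)
    finally show ?thesis .
  qed
  have SB: "(\<Sum>k\<in>left_descents w. \<Sum>(p, q)\<in>covers \<nu> (?s k \<circ> w). real k * g (?s k \<circ> w \<circ> ?t p q)) = sum ?h B"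
  proof -
    have "(\<Sum>k\<in>left_descents w. \<Sum>(p, q)\<in>covers \<nu> (?s k \<circ> w). real k * g (?s k \<circ> w \<circ> ?t p q)) =
      (\<Sum>k\<in>left_descents w. \<Sum>x\<in>covers \<nu> (?s k \<circ> w). ?h (k, x))"
      by (intro sum.cong) auto
    also have "\<dots> = (\<Sum>(k, x)\<in>B. ?h (k, x))" unfolding B_def
      using finite_left_descents[OF w] finite_covers[OF permutes_transpose_left[OF w]]
      by (intro sum.Sigma) auto
    finally show ?thesis by (simp add: case_prod_unfold)
  qed
  \<comment> \<open>Elsewhere both orders of multiplication admit the same indices, so the
    commutator comes from \<open>adj\<close> alone.\<close>
  have eq: "A - adj = B - adj"
  proof -
    have "(k, p, q) \<in> A - adj \<longleftrightarrow> (k, p, q) \<in> B - adj" for k p q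
      using left_descents_cover_iff[OF w, of p q k] cover_less[of w p q] cover_less[of "?s k \<circ> w" p q]
      by (auto simp: A_def B_def adj_def covers_def)
    then show ?thesis by auto
  qed
  define K1 where "K1 = {k. 1 \<le> k \<and> pos w k \<le> \<nu> \<and> \<nu> < pos w (Suc k)}"
  define K2 where "K2 = {k. 1 \<le> k \<and> pos w (Suc k) \<le> \<nu> \<and> \<nu> < pos w k}"
  have pos: "pos w k = 0 \<longleftrightarrow> k = 0" for k using perm_0[OF w] inv_perm[OF w] by metis
  have inv_eq: "pos w k = i \<longleftrightarrow> w i = k" for i k using inv_perm[OF w] by metis
  have inv_wt: "pos (w \<circ> ?t p q) = ?t p q \<circ> pos w" for p q
    by (simp add: o_inv_distrib[OF permutes_bij[OF w]])
  have swt: "?s k \<circ> w \<circ> ?t p q = w" if "w p = k \<and> w q = Suc k \<or> w p = Suc k \<and> w q = k" for k p q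
  proof
    fix i show "(?s k \<circ> w \<circ> ?t p q) i = w i"
      using that perm_eq_iff[OF w, of i p] perm_eq_iff[OF w, of i q] by (auto simp: Transposition.transpose_def)
  qed
  \<comment> \<open>Going up first, the exchange has to create the descent, so k stands at
    \<open>p\<close> and k + 1 at \<open>q\<close>. Going down first, they stand the other way
    round.\<close>
  have A1: "A \<inter> adj = (\<lambda>k. (k, pos w k, pos w (Suc k))) ` K1"
  proof (rule subset_antisym; rule subsetI)
    fix x assume "x \<in> A \<inter> adj"
    then obtain k p q where x: "x = (k, p, q)" "p \<le> \<nu>" "\<nu> < q" "cover w p q" "{w p, w q} = {k, Suc k}"
      unfolding A_def adj_def covers_def by auto
    then have "w p = k" "w q = Suc k" unfolding cover_def by (auto simp: doubleton_eq_iff)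
    then have "pos w k = p" "pos w (Suc k) = q" by (simp_all add: inv_eq)
    then show "x \<in> (\<lambda>k. (k, pos w k, pos w (Suc k))) ` K1"
      using x pos[of k] unfolding K1_def cover_def by (intro image_eqI[of _ _ k]) auto
  next
    fix x assume "x \<in> (\<lambda>k. (k, pos w k, pos w (Suc k))) ` K1"
    then obtain k where x: "x = (k, pos w k, pos w (Suc k))" "1 \<le> k" "pos w k \<le> \<nu>" "\<nu> < pos w (Suc k)"
      unfolding K1_def by auto
    then show "x \<in> A \<inter> adj" using pos[of k]
      unfolding A_def adj_def covers_def left_descents_def inv_wt cover_def by (simp add: inv_perm[OF w] less_Suc_eq_le)
  qed
  have B1: "B \<inter> adj = (\<lambda>k. (k, pos w (Suc k), pos w k)) ` K2"
  proof (rule subset_antisym; rule subsetI)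
    fix x assume "x \<in> B \<inter> adj"
    then obtain k p q where x: "x = (k, p, q)" "p \<le> \<nu>" "\<nu> < q" "cover (?s k \<circ> w) p q" "{w p, w q} = {k, Suc k}"
      "k \<in> left_descents w"
      unfolding B_def adj_def covers_def by auto
    then have "w p = Suc k" "w q = k" unfolding cover_def by (auto simp: doubleton_eq_iff)
    then have "pos w k = q" "pos w (Suc k) = p" by (simp_all add: inv_eq)
    then show "x \<in> (\<lambda>k. (k, pos w (Suc k), pos w k)) ` K2"
      using x left_descents_bound[OF w x(6)] unfolding K2_def cover_def by (intro image_eqI[of _ _ k]) auto
  next
    fix x assume "x \<in> (\<lambda>k. (k, pos w (Suc k), pos w k)) ` K2"
    then obtain k where x: "x = (k, pos w (Suc k), pos w k)" "1 \<le> k" "pos w (Suc k) \<le> \<nu>" "\<nu> < pos w k"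
      unfolding K2_def by auto
    have "\<not> (k < ?s k (w i) \<and> ?s k (w i) < Suc k)" for i by simp
    then show "x \<in> B \<inter> adj" using x pos[of "Suc k"]
      unfolding B_def adj_def covers_def left_descents_def cover_def
      by (auto simp add: inv_perm[OF w])
  qed
  have "sum ?h (A \<inter> adj) = (\<Sum>k\<in>K1. real k * g w)"
    unfolding A1 by (subst sum.reindex) (auto simp: inj_on_def swt inv_perm[OF w] intro!: sum.cong)
  moreover have "sum ?h (B \<inter> adj) = (\<Sum>k\<in>K2. real k * g w)"
    unfolding B1 by (subst sum.reindex) (auto simp: inj_on_def swt inv_perm[OF w] intro!: sum.cong)
  moreover have "(\<Sum>k\<in>K1. real k) = real \<nu> + (\<Sum>k\<in>K2. real k)"
    unfolding K1_def K2_def by (rule sum_crossings[OF w, of "max N \<nu>"]) auto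
  ultimately have "sum ?h (A \<inter> adj) = sum ?h (B \<inter> adj) + real \<nu> * g w"
    by (simp add: sum_distrib_right[symmetric] algebra_simps)
  moreover have "sum ?h A = sum ?h (A \<inter> adj) + sum ?h (A - adj)" "sum ?h B = sum ?h (B \<inter> adj) + sum ?h (B - adj)"
    using sum.Int_Diff[OF finA, of ?h adj] sum.Int_Diff[OF finB, of ?h adj] by auto
  ultimately show ?thesis unfolding SA SB eq by simp
qed

text \<open>Induction on the length l. Covers have length l + 1, so the recursion of
  \<open>schub\<close> applies to (l + 1) times the left side. After the commutation, the induction
  hypothesis for the permutations \<open>s\<^sub>k w\<close> yields \<nu> l \<open>schub w\<close>,
  and the commutator adds the missing \<nu> \<open>schub w\<close>.\<close>

lemma schub_monk:
  assumes "w permutes {1..N}"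
  shows "(\<Sum>(p, q)\<in>covers \<nu> w. schub (w \<circ> Transposition.transpose p q)) = real \<nu> * schub w"
  using assms
proof (induction "card (cells w)" arbitrary: w rule: less_induct)
  case less
  note w = less.prems
  let ?l = "real (card (cells w))"
  have perm_t: "\<exists>M. w \<circ> Transposition.transpose p q permutes {1..M}" if "(p, q) \<in> covers \<nu> w" for p q
    using that permutes_transpose_right[OF w, of p "max N q" q] by (auto simp: covers_def cover_def)
  have "(?l + 1) * (\<Sum>(p, q)\<in>covers \<nu> w. schub (w \<circ> Transposition.transpose p q)) =
    (\<Sum>(p, q)\<in>covers \<nu> w. real (card (cells (w \<circ> Transposition.transpose p q))) * schub (w \<circ> Transposition.transpose p q))"
    unfolding sum_distrib_left using card_cells_cover[OF w]
    by (intro sum.cong) (auto simp: covers_def)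
  also have "\<dots> = (\<Sum>(p, q)\<in>covers \<nu> w. \<Sum>k\<in>left_descents (w \<circ> Transposition.transpose p q).
            real k * schub (Transposition.transpose k (Suc k) \<circ> (w \<circ> Transposition.transpose p q)))"
    using perm_t schub_rec by (intro sum.cong) auto
  also have "\<dots> = (\<Sum>k\<in>left_descents w. \<Sum>(p, q)\<in>covers \<nu> (Transposition.transpose k (Suc k) \<circ> w).
            real k * schub (Transposition.transpose k (Suc k) \<circ> w \<circ> Transposition.transpose p q)) +
         real \<nu> * schub w"
    by (rule left_descents_covers_commute[OF w])
  also have "(\<Sum>k\<in>left_descents w. \<Sum>(p, q)\<in>covers \<nu> (Transposition.transpose k (Suc k) \<circ> w).
            real k * schub (Transposition.transpose k (Suc k) \<circ> w \<circ> Transposition.transpose p q)) =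
     (\<Sum>k\<in>left_descents w. real k * (real \<nu> * schub (Transposition.transpose k (Suc k) \<circ> w)))"
  proof (intro sum.cong refl)
    fix k assume k: "k \<in> left_descents w"
    have "(\<Sum>(p, q)\<in>covers \<nu> (Transposition.transpose k (Suc k) \<circ> w).
            real k * schub (Transposition.transpose k (Suc k) \<circ> w \<circ> Transposition.transpose p q)) =
      real k * (\<Sum>(p, q)\<in>covers \<nu> (Transposition.transpose k (Suc k) \<circ> w).
            schub (Transposition.transpose k (Suc k) \<circ> w \<circ> Transposition.transpose p q))"
      by (simp add: sum_distrib_left case_prod_unfold)
    also have "\<dots> = real k * (real \<nu> * schub (Transposition.transpose k (Suc k) \<circ> w))"
      using less.hyps[OF _ permutes_transpose_left[OF w k]] card_cells_left_descent[OF w k] by simp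
    finally show "(\<Sum>(p, q)\<in>covers \<nu> (Transposition.transpose k (Suc k) \<circ> w).
            real k * schub (Transposition.transpose k (Suc k) \<circ> w \<circ> Transposition.transpose p q)) =
      real k * (real \<nu> * schub (Transposition.transpose k (Suc k) \<circ> w))" .
  qed
  also have "\<dots> = real \<nu> * (\<Sum>k\<in>left_descents w. real k * schub (Transposition.transpose k (Suc k) \<circ> w))"
    by (simp add: sum_distrib_left mult_ac)
  also have "\<dots> = real \<nu> * (?l * schub w)"
    using schub_rec[OF w] by simp
  also have "real \<nu> * (?l * schub w) + real \<nu> * schub w = (?l + 1) * (real \<nu> * schub w)"
    by (simp add: algebra_simps)
  finally have "(?l + 1) * (\<Sum>(p, q)\<in>covers \<nu> w. schub (w \<circ> Transposition.transpose p q)) = (?l + 1) * (real \<nu> * schub w)" .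
  moreover have "?l + 1 \<noteq> 0" using of_nat_0_le_iff[of "card (cells w)", where 'a = real] by linarith
  ultimately show ?case using mult_left_cancel by blast
qed

text \<open>Monk's formula for r minus that for r - 1: a cover at p < q counts in both unless p = r
  or q = r, and by hypothesis only one cover has p = r.\<close>

lemma schub_transition:
  assumes u: "u permutes {1..N}" and r: "1 \<le> r" and q: "\<And>q'. cover u r q' \<longleftrightarrow> q' = q"
  shows "schub (u \<circ> Transposition.transpose r q) =
    schub u + (\<Sum>p | cover u p r. schub (u \<circ> Transposition.transpose p r))"
proof -
  let ?f = "\<lambda>(p, q). schub (u \<circ> Transposition.transpose p q)"
  let ?C = "covers r u \<inter> covers (r - 1) u"
  have rq: "r < q" using q[of q] by (simp add: cover_def)
  have fin: "finite (covers r u)" "finite (covers (r - 1) u)" using finite_covers[OF u] by auto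
  have "(a, b) \<in> covers r u - covers (r - 1) u \<longleftrightarrow> (a, b) = (r, q)" for a b
    using q[of b] rq r cover_less[of u a b] unfolding covers_def by (cases "a = r") auto
  then have d1: "covers r u - covers (r - 1) u = {(r, q)}" by auto
  have "(a, b) \<in> covers (r - 1) u - covers r u \<longleftrightarrow> b = r \<and> cover u a r" for a b
    using r cover_less[of u a b] unfolding covers_def by (cases "b = r") auto
  then have d2: "covers (r - 1) u - covers r u = (\<lambda>p. (p, r)) ` {p. cover u p r}" by auto
  have "sum ?f (covers r u) = sum ?f ?C + sum ?f (covers r u - covers (r - 1) u)"
    by (rule sum.Int_Diff[OF fin(1)])
  moreover have "sum ?f (covers (r - 1) u) = sum ?f ?C + sum ?f (covers (r - 1) u - covers r u)"
    using sum.Int_Diff[OF fin(2), of ?f "covers r u"] by (simp add: Int_commute)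
  moreover have "sum ?f (covers (r - 1) u - covers r u) = (\<Sum>p | cover u p r. schub (u \<circ> Transposition.transpose p r))"
    unfolding d2 by (subst sum.reindex) (auto simp: inj_on_def)
  ultimately show ?thesis
    using schub_monk[OF u, of r] schub_monk[OF u, of "r - 1"] r unfolding d1
    by (simp add: of_nat_diff algebra_simps)
qed

section \<open>Creation and annihilation operators\<close>

text \<open>The Fock space consists of functions on sets of cells \<open>(j, i)\<close>, \<open>j\<close> being the column and
  \<open>i\<close> the row. The sign only counts cells of the same column, so that operators of different
  columns commute while those of one column satisfy the anticommutation relations.\<close>

type_synonym 'k fock = "(nat \<times> nat) set \<Rightarrow> 'k"

definition csign :: "nat \<times> nat \<Rightarrow> (nat \<times> nat) set \<Rightarrow> 'k::field" where
  "csign c S = (- 1) ^ card {i. i < snd c \<and> (fst c, i) \<in> S}"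

text \<open>The sign by which \<open>csign c\<close> changes when the cell \<open>d\<close> is added
  or removed.\<close>

definition flip :: "nat \<times> nat \<Rightarrow> nat \<times> nat \<Rightarrow> 'k::field" where
  "flip c d = (if fst d = fst c \<and> snd d < snd c then - 1 else 1)"

text \<open>On delta functions this is exterior multiplication by the cell \<open>c\<close>, and
  \<open>ann c\<close> is contraction. As operators on functions, both evaluate \<open>f\<close> at
  the set before the move.\<close>

definition cre :: "nat \<times> nat \<Rightarrow> 'k::field fock \<Rightarrow> 'k fock" where
  "cre c f = (\<lambda>S. if c \<in> S then csign c S * f (S - {c}) else 0)"

definition ann :: "nat \<times> nat \<Rightarrow> 'k::field fock \<Rightarrow> 'k fock" where
  "ann c f = (\<lambda>S. if c \<in> S then 0 else csign c S * f (insert c S))"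

definition delta :: "(nat \<times> nat) set \<Rightarrow> 'k::field fock" where
  "delta T = (\<lambda>S. if S = T then 1 else 0)"

section \<open>Signs and anticommutation relations\<close>

lemma csign_sq: "csign c S * csign c S = 1"
  by (simp add: csign_def power_add[symmetric] mult_2[symmetric])

lemma csign_neq_0: "csign c S \<noteq> 0"
  using csign_sq[of c S, where 'a = 'a] by auto

lemma flip_sq: "flip c d * flip c d = 1"
  by (simp add: flip_def)

lemma csign_insert: "d \<notin> S \<Longrightarrow> csign c (insert d S) = flip c d * csign c S"
proof (cases "fst d = fst c \<and> snd d < snd c")
  case True
  assume d: "d \<notin> S"
  have "{i. i < snd c \<and> (fst c, i) \<in> insert d S} = insert (snd d) {i. i < snd c \<and> (fst c, i) \<in> S}"
    using True by (cases d) auto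
  moreover have "snd d \<notin> {i. i < snd c \<and> (fst c, i) \<in> S}" using True d by (cases d) auto
  ultimately show ?thesis using True by (simp add: csign_def flip_def)
next
  case False
  then have "{i. i < snd c \<and> (fst c, i) \<in> insert d S} = {i. i < snd c \<and> (fst c, i) \<in> S}"
    by (cases d) auto
  then show ?thesis using False by (auto simp: csign_def flip_def)
qed

lemma csign_remove: "d \<in> S \<Longrightarrow> csign c (S - {d}) = flip c d * csign c S"
  using csign_insert[of d "S - {d}" c, where 'a = 'a] flip_sq[of c d, where 'a = 'a]
  by (simp add: insert_absorb mult.assoc[symmetric])

lemma flip_self: "flip c c = 1"
  by (simp add: flip_def)

lemma flip_other_column: "fst c \<noteq> fst d \<Longrightarrow> flip c d = 1"
  by (simp add: flip_def)

lemma flip_same_column: "fst c = fst d \<Longrightarrow> c \<noteq> d \<Longrightarrow> flip c d = - flip d c"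
  by (cases c; cases d) (auto simp: flip_def)

lemma lin_cre: "fs.lin (cre c)" and lin_ann: "fs.lin (ann c)"
  by (auto simp: fs.lin_def cre_def ann_def fscale_def fun_eq_iff algebra_simps)

lemma cre_0 [simp]: "cre c 0 = 0" and ann_0 [simp]: "ann c 0 = 0"
  by (auto intro: fs.lin_0 lin_cre lin_ann)

lemma cre_cre_same: "fst c = fst d \<Longrightarrow> cre c (cre d f) = - cre d (cre c f)"
proof (cases "c = d")
  case True then show ?thesis by (auto simp: cre_def fun_eq_iff)
next
  case False
  assume "fst c = fst d"
  from flip_same_column[where 'a = 'a, OF this False] False show ?thesis
    by (auto simp: cre_def fun_eq_iff csign_remove Diff_insert[symmetric] insert_commute mult_ac)
qed

lemma cre_cre_self: "cre c (cre c f) = 0"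
  by (auto simp: cre_def fun_eq_iff)

lemma ann_ann_same: "fst c = fst d \<Longrightarrow> ann c (ann d f) = - ann d (ann c f)"
proof (cases "c = d")
  case True then show ?thesis by (auto simp: ann_def fun_eq_iff)
next
  case False
  assume "fst c = fst d"
  from flip_same_column[where 'a = 'a, OF this False] False show ?thesis
    by (auto simp: ann_def fun_eq_iff csign_insert insert_commute mult_ac)
qed

lemma ann_cre_same:
  "fst c = fst d \<Longrightarrow> ann c (cre d f) = (if c = d then f else 0) - cre d (ann c f)"
proof (cases "c = d")
  case True
  have "(ann c (cre c f)) S = (f - cre c (ann c f)) S" for S
    using csign_sq[of c S, where 'a = 'a]
    by (simp add: ann_def cre_def csign_insert csign_remove flip_self mult.assoc[symmetric] insert_absorb)
  then show ?thesis using True by (simp add: fun_eq_iff)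
next
  case False
  assume "fst c = fst d"
  from flip_same_column[where 'a = 'a, OF this False] False show ?thesis
    by (auto simp: ann_def cre_def fun_eq_iff csign_insert csign_remove insert_Diff_if mult_ac)
qed

lemma cre_cre_other: "fst c \<noteq> fst d \<Longrightarrow> cre c (cre d f) = cre d (cre c f)"
  by (auto simp: cre_def fun_eq_iff csign_remove flip_other_column Diff_insert[symmetric] insert_commute mult_ac)

lemma ann_ann_other: "fst c \<noteq> fst d \<Longrightarrow> ann c (ann d f) = ann d (ann c f)"
  by (auto simp: ann_def fun_eq_iff csign_insert flip_other_column insert_commute mult_ac)

lemma ann_cre_other: "fst c \<noteq> fst d \<Longrightarrow> ann c (cre d f) = cre d (ann c f)"
  by (auto simp: ann_def cre_def fun_eq_iff csign_insert csign_remove flip_other_column insert_Diff_if mult_ac)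

lemma ann_delta: "ann c (delta T) = (if c \<in> T then fscale (csign c T) (delta (T - {c})) else 0)"
  by (auto simp: ann_def delta_def fscale_def fun_eq_iff csign_remove flip_self csign_insert)

lemma cre_delta: "cre c (delta T) = (if c \<in> T then 0 else fscale (csign c T) (delta (insert c T)))"
  by (auto simp: cre_def delta_def fscale_def fun_eq_iff csign_insert flip_self)

lemma cre_ann_delta:
  assumes "c \<noteq> d"
  shows "\<not> (d \<in> T \<and> c \<notin> T) \<Longrightarrow> cre c (ann d (delta T)) = 0"
    and "d \<in> T \<Longrightarrow> c \<notin> T \<Longrightarrow> \<exists>a. a \<noteq> 0 \<and> cre c (ann d (delta T)) = fscale a (delta (insert c (T - {d})))"
proof -
  show "\<not> (d \<in> T \<and> c \<notin> T) \<Longrightarrow> cre c (ann d (delta T)) = 0"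
    using assms by (auto simp: ann_delta fs.lin_scale[OF lin_cre] cre_delta)
  show "\<exists>a. a \<noteq> 0 \<and> cre c (ann d (delta T)) = fscale a (delta (insert c (T - {d})))" if "d \<in> T" "c \<notin> T"
    using that by (intro exI[of _ "csign d T * csign c (T - {d})"])
      (simp add: ann_delta fs.lin_scale[OF lin_cre] cre_delta csign_neq_0)
qed

subsection \<open>Row and column operators\<close>

text \<open>The action of a matrix unit on the rows; \<open>Eop\<close> is its counterpart on the
  columns. The same \<open>L\<close> cuts off the columns here and the rows there.\<close>

definition eop :: "nat \<Rightarrow> nat \<Rightarrow> nat \<Rightarrow> 'k::field fock \<Rightarrow> 'k fock" where
  "eop L a b f = (\<Sum>j<L. cre (j, a) (ann (j, b) f))"

definition Eop :: "nat \<Rightarrow> nat \<Rightarrow> nat \<Rightarrow> 'k::field fock \<Rightarrow> 'k fock" where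
  "Eop L j k f = (\<Sum>i<L. cre (j, i) (ann (k, i) f))"

context lin_space
begin

lemma lin_comp: "lin f \<Longrightarrow> lin g \<Longrightarrow> lin (\<lambda>x. f (g x))"
  by (simp add: lin_def)

lemma lin_sum: "(\<And>i. i \<in> X \<Longrightarrow> lin (h i)) \<Longrightarrow> lin (\<lambda>x. \<Sum>i\<in>X. h i x)"
  by (auto simp: lin_def sum.distrib scale_sum_right)

lemma lin_funpow: "lin f \<Longrightarrow> lin (f ^^ n)"
  by (induction n) (auto simp: lin_def)

lemma lin_map_sum: "lin f \<Longrightarrow> f (sum g X) = (\<Sum>i\<in>X. f (g i))"
  by (induction X rule: infinite_finite_induct) (auto simp: lin_0 lin_add)

lemma lin_minus: "lin f \<Longrightarrow> f (- x) = - f x"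
  by (metis lin_scale scale_minus_left scale_one)

lemma lin_diff: "lin f \<Longrightarrow> f (x - y) = f x - f y"
  by (metis lin_add lin_minus diff_conv_add_uminus)

end

section \<open>Commutation of row and column operators\<close>

lemma lin_eop: "fs.lin (eop L a b)" and lin_Eop: "fs.lin (Eop L j k)"
  unfolding eop_def[abs_def] Eop_def[abs_def]
  by (intro fs.lin_sum fs.lin_comp[OF lin_cre lin_ann])+

text \<open>A move within a column acts as a derivation: the two signs from passing a pair of
  operators of that column cancel.\<close>

lemma hop_cre:
  "cre (j, a) (ann (j, b) (cre (k, c) f)) =
   cre (k, c) (cre (j, a) (ann (j, b) f)) + (if j = k \<and> b = c then cre (j, a) f else 0)"
proof (cases "j = k")
  case True
  then show ?thesis
    using cre_cre_same[of "(j, a)" "(j, c)" "ann (j, b) f"]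
    by (simp add: ann_cre_same fs.lin_diff[OF lin_cre] fs.lin_minus[OF lin_cre])
next
  case False
  then show ?thesis by (simp add: ann_cre_other cre_cre_other)
qed

lemma hop_ann:
  "cre (j, a) (ann (j, b) (ann (k, c) f)) =
   ann (k, c) (cre (j, a) (ann (j, b) f)) - (if j = k \<and> a = c then ann (j, b) f else 0)"
proof (cases "j = k")
  case True
  then show ?thesis
    using ann_ann_same[of "(j, b)" "(j, c)" f] ann_cre_same[of "(j, c)" "(j, a)" "ann (j, b) f"]
    by (simp add: fs.lin_minus[OF lin_cre])
next
  case False
  then show ?thesis
    using ann_cre_other[of "(k, c)" "(j, a)" "ann (j, b) f"] ann_ann_other[of "(j, b)" "(k, c)" f] by simp
qed

lemma eop_cre:
  assumes "k < L"
  shows "eop L a b (cre (k, c) f) = cre (k, c) (eop L a b f) + (if b = c then cre (k, a) f else 0)"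
  using assms unfolding eop_def
  by (cases "b = c") (simp_all add: hop_cre sum.distrib fs.lin_map_sum[OF lin_cre])

lemma eop_ann:
  assumes "k < L"
  shows "eop L a b (ann (k, c) f) = ann (k, c) (eop L a b f) - (if a = c then ann (k, b) f else 0)"
  using assms unfolding eop_def
  by (cases "a = c") (simp_all add: hop_ann sum_subtractf fs.lin_map_sum[OF lin_ann])

text \<open>In the sum over rows only i = a and i = b leave corrections. Both consist of the
  creation in row \<open>a\<close> of column \<open>j\<close> and the annihilation in row
  \<open>b\<close> of column \<open>k\<close>, with opposite signs. Since \<open>a\<close> and
  \<open>b\<close> lie below the cut-off, both occur.\<close>

lemma eop_Eop:
  assumes "j < L" "k < L" "a < L" "b < L"
  shows "eop L a b (Eop L j k f) = Eop L j k (eop L a b f)"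
proof -
  have "eop L a b (Eop L j k f) = (\<Sum>i<L. cre (j, i) (ann (k, i) (eop L a b f))
     - (if i = a then cre (j, i) (ann (k, b) f) else 0) + (if i = b then cre (j, a) (ann (k, i) f) else 0))"
    unfolding Eop_def fs.lin_map_sum[OF lin_eop]
    using assms by (intro sum.cong) (auto simp: eop_cre eop_ann fs.lin_diff[OF lin_cre])
  also have "\<dots> = Eop L j k (eop L a b f)"
    using assms by (simp add: sum.distrib sum_subtractf Eop_def)
  finally show ?thesis .
qed

lemma eop_eop:
  shows "eop L a b (eop L c d f) = eop L c d (eop L a b f) + (if b = c then eop L a d f else 0)
     - (if a = d then eop L c b f else 0)"
proof -
  have "eop L a b (eop L c d f) = (\<Sum>j<L. cre (j, c) (ann (j, d) (eop L a b f))
     + (if b = c then cre (j, a) (ann (j, d) f) else 0) - (if a = d then cre (j, c) (ann (j, b) f) else 0))"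
    unfolding eop_def[of L c d f] fs.lin_map_sum[OF lin_eop]
    by (intro sum.cong) (auto simp: eop_cre eop_ann fs.lin_diff[OF lin_cre])
  also have "\<dots> = eop L c d (eop L a b f) + (if b = c then eop L a d f else 0)
     - (if a = d then eop L c b f else 0)"
    by (simp add: sum.distrib sum_subtractf eop_def)
  finally show ?thesis .
qed

subsection \<open>Top powers of sums of commuting nilpotent operators\<close>

text \<open>As \<open>h\<close> squares to zero, the binomial expansion stops after the term linear
  in \<open>h\<close>.\<close>

lemma (in lin_space) funpow_add_nilpotent:
  assumes h: "lin h" and Q: "lin Q" and com: "\<And>x. h (Q x) = Q (h x)" and nil: "\<And>x. h (h x) = 0"
  shows "((\<lambda>x. h x + Q x) ^^ Suc n) y = (Q ^^ Suc n) y + scale (of_nat (Suc n)) (h ((Q ^^ n) y))"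
proof (induction n)
  case (Suc n)
  have "((\<lambda>x. h x + Q x) ^^ Suc (Suc n)) y =
     h ((Q ^^ Suc n) y + scale (of_nat (Suc n)) (h ((Q ^^ n) y))) +
     Q ((Q ^^ Suc n) y + scale (of_nat (Suc n)) (h ((Q ^^ n) y)))"
    by (subst funpow.simps(2)) (simp only: comp_apply Suc)
  also have "\<dots> = (Q ^^ Suc (Suc n)) y + (h ((Q ^^ Suc n) y) + scale (of_nat (Suc n)) (h ((Q ^^ Suc n) y)))"
    by (simp only: lin_add[OF h] lin_add[OF Q] lin_scale[OF h] lin_scale[OF Q] nil com[symmetric]
        scale_zero_right funpow.simps comp_apply add_0_left add_0_right ac_simps)
  also have "h ((Q ^^ Suc n) y) + scale (of_nat (Suc n)) (h ((Q ^^ Suc n) y)) = scale (of_nat (Suc (Suc n))) (h ((Q ^^ Suc n) y))"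
    by (simp only: of_nat_Suc scale_left_distrib scale_one add.commute)
  finally show ?case .
qed simp

lemma (in lin_space) funpow_commute:
  assumes com: "\<And>x. h (Q x) = Q (h x)"
  shows "h ((Q ^^ n) y) = (Q ^^ n) (h y)"
  using com by (induction n) auto

text \<open>A move is active on \<open>T\<close> if its source \<open>g i\<close> is occupied and
  its target \<open>f i\<close> is free. Sources and targets are all distinct, so a move neither
  enables nor blocks another. With the number of active moves as exponent, each is performed once,
  in every order; a higher power has to repeat a square-zero move. The coefficient contains the
  factorial of that number, nonzero in characteristic zero.\<close>

lemma delta_sum_funpow:
  fixes h :: "'i \<Rightarrow> 'k::field_char_0 fock \<Rightarrow> 'k fock"
  assumes X: "finite X" and h: "\<And>i. i \<in> X \<Longrightarrow> fs.lin (h i)"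
    and com: "\<And>i j x. i \<in> X \<Longrightarrow> j \<in> X \<Longrightarrow> i \<noteq> j \<Longrightarrow> h i (h j x) = h j (h i x)"
    and nil: "\<And>i x. i \<in> X \<Longrightarrow> h i (h i x) = 0"
    and inj: "inj_on f X" "inj_on g X" "f ` X \<inter> g ` X = {}"
    and h0: "\<And>i T. i \<in> X \<Longrightarrow> \<not> (g i \<in> T \<and> f i \<notin> T) \<Longrightarrow> h i (delta T) = 0"
    and h1: "\<And>i T. i \<in> X \<Longrightarrow> g i \<in> T \<Longrightarrow> f i \<notin> T \<Longrightarrow>
               \<exists>c. c \<noteq> 0 \<and> h i (delta T) = fscale c (delta (insert (f i) (T - {g i})))"
  shows "(\<forall>k>card {i\<in>X. g i \<in> T \<and> f i \<notin> T}. ((\<lambda>x. \<Sum>i\<in>X. h i x) ^^ k) (delta T) = 0) \<and>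
     (\<exists>c. c \<noteq> 0 \<and> ((\<lambda>x. \<Sum>i\<in>X. h i x) ^^ card {i\<in>X. g i \<in> T \<and> f i \<notin> T}) (delta T) =
        fscale c (delta (relocate f g {i\<in>X. g i \<in> T \<and> f i \<notin> T} T)))"
  using assms
proof (induction X rule: finite_induct)
  case empty
  have "((\<lambda>x::'k fock. 0::'k fock) ^^ k) y = 0" if "k > 0" for k y
    using that funpow.simps(2)[of "k - 1" "\<lambda>x::'k fock. 0::'k fock"] by (simp only: Suc_diff_1 comp_apply)
  moreover have "\<exists>c. c \<noteq> 0 \<and> delta T = fscale c (delta T :: 'k fock)"
    by (intro exI[of _ 1]) (simp add: fscale_def)
  moreover have "{i \<in> {}. g i \<in> T \<and> f i \<notin> T} = {}" "relocate f g {} T = T"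
    by (auto simp: relocate_def)
  ultimately show ?case by (simp only: sum.empty card.empty funpow.simps id_apply) blast
next
  case (insert x X)
  let ?Q = "\<lambda>y. \<Sum>i\<in>X. h i y" and ?J = "{i\<in>X. g i \<in> T \<and> f i \<notin> T}"
  let ?P = "\<lambda>y. \<Sum>i\<in>insert x X. h i y"
  let ?J' = "{i\<in>insert x X. g i \<in> T \<and> f i \<notin> T}"
  have IHc: "(\<forall>k>card ?J. (?Q ^^ k) (delta T) = 0) \<and>
     (\<exists>c. c \<noteq> 0 \<and> (?Q ^^ card ?J) (delta T) = fscale c (delta (relocate f g ?J T)))"
  proof (rule insert.IH)
    show "inj_on f X" "inj_on g X"
      using insert.prems(4,5) by (meson inj_on_subset subset_insertI)+
    show "f ` X \<inter> g ` X = {}" using insert.prems(6) by blast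
    show "fs.lin (h i)" if "i \<in> X" for i by (rule insert.prems(1)) (simp add: that)
    show "h i (h j y) = h j (h i y)" if "i \<in> X" "j \<in> X" "i \<noteq> j" for i j y
      by (rule insert.prems(2)) (simp_all add: that)
    show "h i (h i y) = 0" if "i \<in> X" for i y by (rule insert.prems(3)) (simp add: that)
    show "h i (delta S) = 0" if "i \<in> X" "\<not> (g i \<in> S \<and> f i \<notin> S)" for i S
      by (rule insert.prems(7)) (use that in auto)
    show "\<exists>c. c \<noteq> 0 \<and> h i (delta S) = fscale c (delta (insert (f i) (S - {g i})))"
      if "i \<in> X" "g i \<in> S" "f i \<notin> S" for i S
      by (rule insert.prems(8)) (use that in auto)
  qed
  then have IH: "\<And>k. k > card ?J \<Longrightarrow> (?Q ^^ k) (delta T) = 0"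
     "\<exists>c. c \<noteq> 0 \<and> (?Q ^^ card ?J) (delta T) = fscale c (delta (relocate f g ?J T))"
    by blast+
  have P: "?P = (\<lambda>y. h x y + ?Q y)" using insert.hyps by simp
  have lQ: "fs.lin ?Q" using insert.prems(1) by (intro fs.lin_sum) auto
  have lh: "fs.lin (h x)" using insert.prems(1) by auto
  have cm: "h x (?Q y) = ?Q (h x y)" for y
    unfolding fs.lin_map_sum[OF lh] using insert.prems(2) insert.hyps by (intro sum.cong) auto
  have exp: "(?P ^^ Suc n) y = (?Q ^^ Suc n) y + fscale (of_nat (Suc n)) (h x ((?Q ^^ n) y))" for n y
    unfolding P using insert.prems(3) by (intro fs.funpow_add_nilpotent lh lQ cm) auto
  have cmn: "h x ((?Q ^^ n) y) = (?Q ^^ n) (h x y)" for n y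
    using fs.funpow_commute[of "h x" ?Q n y] cm by blast
  have z: "(?Q ^^ n) 0 = 0" for n by (rule fs.lin_0[OF fs.lin_funpow[OF lQ]])
  show ?case
  proof (cases "g x \<in> T \<and> f x \<notin> T")
    case False
    \<comment> \<open>An inactive move commutes past the others and kills
      \<open>delta T\<close>.\<close>
    have "(?P ^^ n) (delta T) = (?Q ^^ n) (delta T)" for n
    proof (cases n)
      case (Suc m)
      have "h x (delta T) = 0" using insert.prems(7)[of x T] False by auto
      then show ?thesis unfolding Suc exp cmn z by (simp add: z)
    qed simp
    moreover have "?J' = ?J" using False by auto
    ultimately show ?thesis using IH by simp
  next
    case True
    then have J': "?J' = insert x ?J" by auto
    have fin: "finite ?J" "x \<notin> ?J" using insert.hyps by auto
    have card: "card ?J' = Suc (card ?J)" unfolding J' using fin by simp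
    obtain c where c: "c \<noteq> 0" "(?Q ^^ card ?J) (delta T) = fscale c (delta (relocate f g ?J T))"
      using IH(2) by blast
    have gx: "g x \<notin> g ` ?J" "f x \<notin> f ` ?J" "g x \<notin> f ` ?J"
      using insert.prems(4-6) insert.hyps by (auto simp: inj_on_def)
    then have "g x \<in> relocate f g ?J T" "f x \<notin> relocate f g ?J T"
      using True by (auto simp: relocate_def)
    then obtain c' where c': "c' \<noteq> 0"
      "h x (delta (relocate f g ?J T)) = fscale c' (delta (insert (f x) (relocate f g ?J T - {g x})))"
      using insert.prems(8)[of x] by blast
    have "insert (f x) (relocate f g ?J T - {g x}) = relocate f g ?J' T"
      unfolding J' relocate_def image_insert using gx insert.prems(6) by blast
    then have "(?P ^^ card ?J') (delta T) = fscale (of_nat (Suc (card ?J)) * c * c') (delta (relocate f g ?J' T))"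
      unfolding card exp using IH(1)[of "Suc (card ?J)"] c c'
      by (simp add: fs.lin_scale[OF lh])
    moreover have "of_nat (Suc (card ?J)) * c * c' \<noteq> 0" using c c' by (simp del: of_nat_Suc)
    ultimately have ex: "\<exists>c. c \<noteq> 0 \<and> (?P ^^ card ?J') (delta T) = fscale c (delta (relocate f g ?J' T))"
      by blast
    moreover have "(?P ^^ k) (delta T) = 0" if "k > card ?J'" for k
    proof -
      have "\<exists>n. k = Suc n \<and> card ?J < n" using that unfolding card by (simp only: Suc_less_eq2)
      then obtain n where n: "k = Suc n" "n > card ?J" by blast
      then show ?thesis unfolding n(1) exp using IH(1)[of n] IH(1)[of "Suc n"] fs.lin_0[OF lh]
        by simp
    qed
    ultimately show ?thesis by blast
  qed
qed

lemma eop_funpow: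
  fixes T :: "(nat \<times> nat) set"
  assumes "a \<noteq> b" and J: "J = {j. j < L \<and> (j, b) \<in> T \<and> (j, a) \<notin> T}"
  shows "\<exists>c::'k::field_char_0. c \<noteq> 0 \<and>
    (eop L a b ^^ card J) (delta T) = fscale c (delta (relocate (\<lambda>j. (j, a)) (\<lambda>j. (j, b)) J T))"
proof -
  let ?h = "\<lambda>j. \<lambda>f::'k fock. cre (j, a) (ann (j, b) f)"
  have "\<exists>c. c \<noteq> 0 \<and> ((\<lambda>x. \<Sum>j\<in>{..<L}. ?h j x) ^^ card {j\<in>{..<L}. (j, b) \<in> T \<and> (j, a) \<notin> T}) (delta T) =
        fscale c (delta (relocate (\<lambda>j. (j, a)) (\<lambda>j. (j, b)) {j\<in>{..<L}. (j, b) \<in> T \<and> (j, a) \<notin> T} T))"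
  proof (rule delta_sum_funpow[THEN conjunct2])
    show "?h i (?h j x) = ?h j (?h i x)" if "i \<noteq> j" for i j x
      using that by (simp add: ann_cre_other cre_cre_other[of "(i, a)"] ann_ann_other[of "(i, b)"])
    show "?h i (?h i x) = 0" for i x
      using assms by (simp add: ann_cre_same cre_cre_self fs.lin_minus[OF lin_cre])
    show "\<exists>c. c \<noteq> 0 \<and> ?h i (delta S) = fscale c (delta (insert (i, a) (S - {(i, b)})))"
      if "(i, b) \<in> S" "(i, a) \<notin> S" for i S
      using cre_ann_delta(2)[of "(i, a)" "(i, b)" S] that assms by auto
    show "?h i (delta S) = 0" if "\<not> ((i, b) \<in> S \<and> (i, a) \<notin> S)" for i S
      using cre_ann_delta(1)[of "(i, a)" "(i, b)" S] that assms by auto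
  qed (use assms in \<open>auto simp: inj_on_def intro: fs.lin_comp[OF lin_cre lin_ann]\<close>)
  moreover have "{j\<in>{..<L}. (j, b) \<in> T \<and> (j, a) \<notin> T} = J" unfolding J by auto
  ultimately show ?thesis unfolding eop_def[abs_def] by simp
qed

lemma Eop_funpow:
  fixes T :: "(nat \<times> nat) set"
  assumes "j \<noteq> k" and I: "I = {i. i < L \<and> (k, i) \<in> T \<and> (j, i) \<notin> T}"
  shows "\<exists>c::'k::field_char_0. c \<noteq> 0 \<and>
    (Eop L j k ^^ card I) (delta T) = fscale c (delta (relocate (Pair j) (Pair k) I T))"
    and "card I < m \<Longrightarrow> (Eop L j k ^^ m) (delta T) = (0 :: 'k fock)"
proof -
  let ?h = "\<lambda>i. \<lambda>f::'k fock. cre (j, i) (ann (k, i) f)"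
  have "(\<forall>m>card {i\<in>{..<L}. (k, i) \<in> T \<and> (j, i) \<notin> T}. ((\<lambda>x. \<Sum>i\<in>{..<L}. ?h i x) ^^ m) (delta T) = 0) \<and>
     (\<exists>c. c \<noteq> 0 \<and> ((\<lambda>x. \<Sum>i\<in>{..<L}. ?h i x) ^^ card {i\<in>{..<L}. (k, i) \<in> T \<and> (j, i) \<notin> T}) (delta T) =
        fscale c (delta (relocate (Pair j) (Pair k) {i\<in>{..<L}. (k, i) \<in> T \<and> (j, i) \<notin> T} T)))"
  proof (rule delta_sum_funpow)
    \<comment> \<open>Exchanging the creators gives one sign and exchanging the annihilators
      another.\<close>
    show "?h i (?h i' x) = ?h i' (?h i x)" if "i \<noteq> i'" for i i' x
    proof -
      have "?h i (?h i' x) = cre (j, i) (cre (j, i') (ann (k, i) (ann (k, i') x)))"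
        using assms by (simp add: ann_cre_other)
      also have "\<dots> = cre (j, i') (cre (j, i) (ann (k, i') (ann (k, i) x)))"
        using cre_cre_same[of "(j, i)" "(j, i')" "ann (k, i) (ann (k, i') x)"] ann_ann_same[of "(k, i)" "(k, i')" x]
        by (simp add: fs.lin_minus[OF lin_cre])
      also have "\<dots> = ?h i' (?h i x)" using assms by (simp add: ann_cre_other)
      finally show ?thesis .
    qed
    show "?h i (?h i x) = 0" for i x
    proof -
      have "?h i (?h i x) = cre (j, i) (cre (j, i) (ann (k, i) (ann (k, i) x)))"
        using assms by (simp add: ann_cre_other)
      also have "\<dots> = 0" by (rule cre_cre_self)
      finally show ?thesis .
    qed
    show "\<exists>c. c \<noteq> 0 \<and> ?h i (delta S) = fscale c (delta (insert (j, i) (S - {(k, i)})))"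
      if "(k, i) \<in> S" "(j, i) \<notin> S" for i S
      using cre_ann_delta(2)[of "(j, i)" "(k, i)" S] that assms by auto
    show "?h i (delta S) = 0" if "\<not> ((k, i) \<in> S \<and> (j, i) \<notin> S)" for i S
      using cre_ann_delta(1)[of "(j, i)" "(k, i)" S] that assms by auto
  qed (use assms in \<open>auto simp: inj_on_def intro: fs.lin_comp[OF lin_cre lin_ann]\<close>)
  moreover have "{i\<in>{..<L}. (k, i) \<in> T \<and> (j, i) \<notin> T} = I" unfolding I by auto
  ultimately have *: "(\<forall>m>card I. (Eop L j k ^^ m) (delta T) = (0::'k fock)) \<and>
     (\<exists>c::'k. c \<noteq> 0 \<and> (Eop L j k ^^ card I) (delta T) = fscale c (delta (relocate (Pair j) (Pair k) I T)))"
    unfolding Eop_def[abs_def] by simp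
  from * show "\<exists>c::'k::field_char_0. c \<noteq> 0 \<and>
    (Eop L j k ^^ card I) (delta T) = fscale c (delta (relocate (Pair j) (Pair k) I T))" by blast
  from * show "card I < m \<Longrightarrow> (Eop L j k ^^ m) (delta T) = (0 :: 'k fock)" by blast
qed

section \<open>The orbit of a permutation\<close>

text \<open>The range goes up to \<open>L\<close> rather than to the size of the matrices. Operators
  that reach into empty rows act by zero, so the orbits do not change, see
  \<open>rho_orbit\<close>.\<close>

definition row_ops :: "nat \<Rightarrow> ('k::field fock \<Rightarrow> 'k fock) set" where
  "row_ops L = {eop L a b | a b. 1 \<le> a \<and> a \<le> b \<and> b < L}"

definition gen_orbit :: "nat \<Rightarrow> (nat \<Rightarrow> nat) \<Rightarrow> 'k::field_char_0 fock set" where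
  "gen_orbit L w = fs.orbit (row_ops L) (delta (cells w))"

definition supported :: "((nat \<times> nat) set \<Rightarrow> bool) \<Rightarrow> 'k::field fock set" where
  "supported P = {f. \<forall>S. f S \<noteq> 0 \<longrightarrow> P S}"

abbreviation box :: "nat \<Rightarrow> (nat \<times> nat) set" where
  "box L \<equiv> {..<L} \<times> {..<L}"

section \<open>Support conditions preserved by row operators\<close>

lemma subspace_supported: "fs.subspace (supported P)"
proof (rule fs.subspaceI)
  show "x + y \<in> supported P" if "x \<in> supported P" "y \<in> supported P" for x y
    using that unfolding supported_def by (auto simp: plus_fun_def) (metis add_0)
qed (auto simp: supported_def fscale_def)

lemma delta_supported: "P T \<Longrightarrow> delta T \<in> supported P"
  by (auto simp: supported_def delta_def)

text \<open>The hypothesis runs backwards, because the value at \<open>S\<close> is read off at the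
  set with the move undone.\<close>

lemma eop_supported:
  assumes "\<And>j S. j < L \<Longrightarrow> (j, a) \<in> S \<Longrightarrow> P (insert (j, b) (S - {(j, a)})) \<Longrightarrow> P S"
    and "f \<in> supported P"
  shows "eop L a b f \<in> supported P"
  unfolding eop_def
proof (rule fs.subspace_sum[OF subspace_supported])
  fix j assume "j \<in> {..<L}"
  then show "cre (j, a) (ann (j, b) f) \<in> supported P"
    using assms unfolding supported_def cre_def ann_def by auto
qed

lemma sum_eval: "(\<Sum>i\<in>X. f i) x = (\<Sum>i\<in>X. f i x)"
  by (induction X rule: infinite_finite_induct) auto

lemma supported_subset_span:
  assumes "finite C" shows "supported (\<lambda>S. S \<subseteq> C) \<subseteq> fs.span (delta ` Pow C)"
proof
  fix f :: "'k::field fock" assume f: "f \<in> supported (\<lambda>S. S \<subseteq> C)"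
  have "f = (\<Sum>T\<in>Pow C. fscale (f T) (delta T))"
  proof
    fix S
    have "(\<Sum>T\<in>Pow C. fscale (f T) (delta T)) S = (\<Sum>T\<in>Pow C. if T = S then f S else 0)"
      by (auto simp: sum_eval fscale_def delta_def intro!: sum.cong)
    also have "\<dots> = f S" using f assms by (auto simp: supported_def)
    finally show "f S = (\<Sum>T\<in>Pow C. fscale (f T) (delta T)) S" ..
  qed
  also have "\<dots> \<in> fs.span (delta ` Pow C)"
    by (intro fs.span_sum fs.span_scale fs.span_base) auto
  finally show "f \<in> fs.span (delta ` Pow C)" .
qed

lemma lin_row_ops: "e \<in> row_ops L \<Longrightarrow> fs.lin e"
  by (auto simp: row_ops_def lin_eop)

lemma gen_orbit_supported:
  assumes "cells w \<subseteq> box L" shows "gen_orbit L w \<subseteq> supported (\<lambda>S. S \<subseteq> box L)"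
  unfolding gen_orbit_def
proof (rule fs.orbit_subset[OF subspace_supported])
  show "delta (cells w) \<in> supported (\<lambda>S. S \<subseteq> box L)" using assms by (intro delta_supported)
  fix e :: "'a fock \<Rightarrow> 'a fock" and x :: "'a fock" assume e: "e \<in> row_ops L" and x: "x \<in> supported (\<lambda>S. S \<subseteq> box L)"
  then obtain a b where ab: "e = eop L a b" "a \<le> b" "b < L" by (auto simp: row_ops_def)
  show "e x \<in> supported (\<lambda>S. S \<subseteq> box L)"
    unfolding ab(1) by (rule eop_supported[OF _ x]) (use ab in auto)
qed

lemma gen_orbit_rows:
  assumes "\<And>j i. (j, i) \<in> cells w \<Longrightarrow> i \<le> r"
  shows "gen_orbit L w \<subseteq> supported (\<lambda>S. \<forall>(j, i)\<in>S. i \<le> r)"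
  unfolding gen_orbit_def
proof (rule fs.orbit_subset[OF subspace_supported])
  show "delta (cells w) \<in> supported (\<lambda>S. \<forall>(j, i)\<in>S. i \<le> r)"
    using assms by (intro delta_supported) auto
  fix e :: "'a fock \<Rightarrow> 'a fock" and x :: "'a fock" assume e: "e \<in> row_ops L" and x: "x \<in> supported (\<lambda>S. \<forall>(j, i)\<in>S. i \<le> r)"
  then obtain a b where ab: "e = eop L a b" "a \<le> b" "b < L" by (auto simp: row_ops_def)
  show "e x \<in> supported (\<lambda>S. \<forall>(j, i)\<in>S. i \<le> r)"
    unfolding ab(1) by (rule eop_supported[OF _ x]) (use ab in fastforce)
qed

lemma gen_orbit_finite_span:
  assumes "cells w \<subseteq> box L"
  shows "\<exists>B. finite B \<and> gen_orbit L w \<subseteq> fs.span B"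
proof (intro exI conjI)
  show "finite (delta ` Pow (box L))" by simp
  show "gen_orbit L w \<subseteq> fs.span (delta ` Pow (box L))"
    using gen_orbit_supported[OF assms] supported_subset_span[of "box L"] by blast
qed

lemma cells_subset_box: "w permutes {1..N} \<Longrightarrow> N < L \<Longrightarrow> cells w \<subseteq> box L"
  using cells_subset[of w N] by auto

lemma relocate_insert: "c \<notin> g ` J \<Longrightarrow> relocate f g J (insert c T) = insert c (relocate f g J T)"
  by (auto simp: relocate_def)

subsection \<open>Tensoring with a vector of column 0\<close>

text \<open>The exponents below are the largest for which the powers do not vanish, so that all vectors
  that occur are multiples of delta functions.\<close>

definition jump_cols :: "(nat \<Rightarrow> nat) \<Rightarrow> nat \<times> nat \<Rightarrow> nat set" where
  "jump_cols w = (\<lambda>(p, q). {j. q < j \<and> w p < w j \<and> w j < w q})"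

definition jump_rows :: "(nat \<Rightarrow> nat) \<Rightarrow> nat \<times> nat \<Rightarrow> nat set" where
  "jump_rows w = (\<lambda>(p, q). {i. 1 \<le> i \<and> i < p \<and> w p < w i \<and> w i < w q})"

text \<open>The tensor of \<open>u\<^sub>p\<close> with the highest nonzero power of
  \<open>e\<^sub>p\<^sub>q\<close> on the generator of \<open>w\<close>. Its cells occupy each row
  as often as those of \<open>w t\<^sub>p\<^sub>q\<close>; only the columns remain to be
  corrected.\<close>

definition tvec :: "nat \<Rightarrow> (nat \<Rightarrow> nat) \<Rightarrow> nat \<times> nat \<Rightarrow> 'k::field_char_0 fock" where
  "tvec L w = (\<lambda>(p, q). cre (0, p) ((eop L p q ^^ card (jump_cols w (p, q))) (delta (cells w))))"

text \<open>The cell of column 0 enters column \<open>q\<close>, and then column \<open>q\<close>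
  takes over the rows that the exchange of \<open>p\<close> and \<open>q\<close> takes away from
  column \<open>p\<close>, compare \<open>cells_cover\<close>.\<close>

definition tmap :: "nat \<Rightarrow> (nat \<Rightarrow> nat) \<Rightarrow> nat \<times> nat \<Rightarrow> 'k::field_char_0 fock \<Rightarrow> 'k fock" where
  "tmap L w = (\<lambda>(p, q) f. (Eop L q p ^^ card (jump_rows w (p, q))) (Eop L q 0 f))"

text \<open>Inversions occupy columns from 2 on, so column 0 is free for the second factor, which is
  spanned by the first \<nu> basis vectors.\<close>

definition tensor_space :: "nat \<Rightarrow> nat \<Rightarrow> (nat \<Rightarrow> nat) \<Rightarrow> 'k::field_char_0 fock set" where
  "tensor_space L \<nu> w = fs.span (\<Union>i\<in>{1..\<nu>}. cre (0, i) ` gen_orbit L w)"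

lemma lin_tmap: "fs.lin (tmap L w x)"
  unfolding tmap_def by (cases x) (auto intro!: fs.lin_comp[OF fs.lin_funpow[OF lin_Eop] lin_Eop])

text \<open>Column 0 holds a single cell, so at most one move is active.\<close>

lemma Eop_0_delta:
  fixes T :: "(nat \<times> nat) set"
  assumes T: "\<And>i. (0, i) \<notin> T" and "0 < q" "p < L"
  shows "(q, p) \<in> T \<Longrightarrow> Eop L q 0 (delta (insert (0, p) T)) = (0 :: 'k::field_char_0 fock)"
    and "(q, p) \<notin> T \<Longrightarrow> \<exists>c::'k. c \<noteq> 0 \<and> Eop L q 0 (delta (insert (0, p) T)) = fscale c (delta (insert (q, p) T))"
proof -
  let ?T = "insert (0, p) T"
  show "Eop L q 0 (delta ?T) = (0 :: 'k fock)" if "(q, p) \<in> T"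
  proof -
    have "{i. i < L \<and> (0, i) \<in> ?T \<and> (q, i) \<notin> ?T} = {}" using that T by auto
    then show ?thesis using Eop_funpow(2)[of q 0 "{}" L ?T 1] assms by simp
  qed
  show "\<exists>c::'k. c \<noteq> 0 \<and> Eop L q 0 (delta ?T) = fscale c (delta (insert (q, p) T))" if "(q, p) \<notin> T"
  proof -
    have "{p} = {i. i < L \<and> (0, i) \<in> ?T \<and> (q, i) \<notin> ?T}" using that T assms by auto
    then have "\<exists>c::'k. c \<noteq> 0 \<and> (Eop L q 0 ^^ card {p}) (delta ?T) = fscale c (delta (relocate (Pair q) (Pair 0) {p} ?T))"
      by (rule Eop_funpow(1)[rotated]) (use assms in simp)
    moreover have "relocate (Pair q) (Pair 0) {p} ?T = insert (q, p) T" using T by (auto simp: relocate_def)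
    ultimately show ?thesis by simp
  qed
qed

section \<open>The covers of \<open>w\<close> inside the tensor product\<close>

context
  fixes w :: "nat \<Rightarrow> nat" and N L \<nu> :: nat
  assumes w: "w permutes {1..N}" and L: "Suc N < L" and \<nu>: "\<nu> \<le> N"
begin

lemma covers_less: "(p, q) \<in> covers \<nu> w \<Longrightarrow> q < L"
  using covers_bound[OF w, of p q \<nu>] L \<nu> by simp

lemma tvec_eq:
  assumes pq: "(p, q) \<in> covers \<nu> w"
  shows "\<exists>c::'k::field_char_0. c \<noteq> 0 \<and> tvec L w (p, q) = fscale c (delta (insert (0, p)
    (relocate (\<lambda>j. (j, p)) (\<lambda>j. (j, q)) (jump_cols w (p, q)) (cells w))))"
proof -
  have c: "1 \<le> p" "p < q" "w p < w q" using pq by (auto simp: covers_def cover_def)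
  let ?J = "jump_cols w (p, q)"
  let ?T = "relocate (\<lambda>j. (j, p)) (\<lambda>j. (j, q)) ?J (cells w)"
  have J: "?J = {j. j < L \<and> (j, q) \<in> cells w \<and> (j, p) \<notin> cells w}"
  proof -
    have "j < L" if "(j, q) \<in> cells w" for j using cells_subset[OF w] that L by auto
    moreover have "w j \<noteq> w p" if "q < j" for j using perm_eq_iff[OF w, of j p] that c by simp
    ultimately have "w p \<le> w j \<longleftrightarrow> w p < w j" if "q < j" for j using that by (metis le_less)
    then show ?thesis using c \<open>\<And>j. (j, q) \<in> cells w \<Longrightarrow> j < L\<close> unfolding jump_cols_def
      by (auto simp: mem_cells not_less)
  qed
  obtain a :: 'k where a: "a \<noteq> 0" "(eop L p q ^^ card ?J) (delta (cells w)) = fscale a (delta ?T)"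
    using eop_funpow[OF _ J, where 'k = 'k] c by blast
  have "(0, p) \<notin> ?T" by (auto simp: relocate_def mem_cells jump_cols_def)
  then have "tvec L w (p, q) = fscale (a * csign (0, p) ?T) (delta (insert (0, p) ?T))"
    unfolding tvec_def by (simp add: a fs.lin_scale[OF lin_cre] cre_delta)
  then show ?thesis using a(1) csign_neq_0 by (metis mult_eq_0_iff)
qed

lemma tmap_tvec:
  assumes pq: "(p, q) \<in> covers \<nu> w"
  shows "\<exists>c::'k::field_char_0. c \<noteq> 0 \<and>
    tmap L w (p, q) (tvec L w (p, q)) = fscale c (delta (cells (w \<circ> Transposition.transpose p q)))"
proof -
  have cov: "cover w p q" using pq by (simp add: covers_def)
  have c: "1 \<le> p" "p < q" "w p < w q" using cov by (auto simp: cover_def)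
  let ?J = "jump_cols w (p, q)" and ?I = "jump_rows w (p, q)"
  let ?T = "relocate (\<lambda>j. (j, p)) (\<lambda>j. (j, q)) ?J (cells w)"
  have qL: "q < L" by (rule covers_less[OF pq])
  obtain a1 :: 'k where a1: "a1 \<noteq> 0" "tvec L w (p, q) = fscale a1 (delta (insert (0, p) ?T))"
    using tvec_eq[OF pq] by blast
  have T0: "(0, i) \<notin> ?T" for i by (auto simp: relocate_def mem_cells jump_cols_def)
  \<comment> \<open>The row operator has changed columns beyond \<open>q\<close> only.\<close>
  have Tq: "(q, i) \<in> ?T \<longleftrightarrow> (q, i) \<in> cells w" and Tp: "(p, i) \<in> ?T \<longleftrightarrow> (p, i) \<in> cells w" for i
    using c by (auto simp: relocate_def jump_cols_def)
  have "(q, p) \<notin> ?T" using c by (simp add: Tq mem_cells)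
  then obtain a2 :: 'k where a2: "a2 \<noteq> 0"
    "Eop L q 0 (delta (insert (0, p) ?T)) = fscale a2 (delta (insert (q, p) ?T))"
    using Eop_0_delta(2)[OF T0, of q p L, where 'k = 'k] c qL by auto
  have I: "?I = {i. i < L \<and> (p, i) \<in> insert (q, p) ?T \<and> (q, i) \<notin> insert (q, p) ?T}"
  proof -
    have "w i \<le> w q \<longleftrightarrow> w i < w q" if "i < p" for i
        using perm_eq_iff[OF w, of i q] that c by (simp add: le_less)
    then show ?thesis using c qL unfolding jump_rows_def insert_iff Tp Tq
      by (auto simp: mem_cells not_less)
  qed
  obtain a3 :: 'k where a3: "a3 \<noteq> 0" "(Eop L q p ^^ card ?I) (delta (insert (q, p) ?T)) =
      fscale a3 (delta (relocate (Pair q) (Pair p) ?I (insert (q, p) ?T)))"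
    using Eop_funpow(1)[OF _ I, where 'k = 'k] c by blast
  have "relocate (Pair q) (Pair p) ?I (insert (q, p) ?T) = cells (w \<circ> Transposition.transpose p q)"
    unfolding cells_cover[OF w cov] using c by (subst relocate_insert) (auto simp: jump_rows_def jump_cols_def)
  then have "tmap L w (p, q) (tvec L w (p, q)) = fscale (a1 * a2 * a3) (delta (cells (w \<circ> Transposition.transpose p q)))"
    unfolding tmap_def
    by (simp add: a1 a2 a3 fs.lin_scale[OF lin_Eop] fs.lin_scale[OF fs.lin_funpow[OF lin_Eop]])
  then show ?thesis using a1(1) a2(1) a3(1) by (metis mult_eq_0_iff)
qed

text \<open>There are two ways to vanish. If row \<open>p'\<close> of column \<open>q\<close> is
  occupied, the cell of column 0 cannot enter. Otherwise the cover conditions force w p < w p' < w q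
  and p' < p, so \<open>p'\<close> is one of the rows to be moved from column \<open>p\<close> to
  column \<open>q\<close>; but its target has just been filled, and the exponent exceeds the number
  of active moves.\<close>

lemma tmap_tvec_eq_0:
  assumes pq: "(p, q) \<in> covers \<nu> w" and pq': "(p', q') \<in> covers \<nu> w"
    and less: "w p < w p' \<or> p' = p \<and> q' < q"
  shows "tmap L w (p, q) (tvec L w (p', q')) = (0 :: 'k::field_char_0 fock)"
proof -
  have cov: "cover w p q" "cover w p' q'" using pq pq' by (simp_all add: covers_def)
  have c: "1 \<le> p" "p < q" "w p < w q" "1 \<le> p'" "p' < q'" "w p' < w q'" "p' < q"
    using cov pq pq' by (auto simp: cover_def covers_def)
  let ?J = "jump_cols w (p', q')" and ?I = "jump_rows w (p, q)"
  let ?T = "relocate (\<lambda>j. (j, p')) (\<lambda>j. (j, q')) ?J (cells w)"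
  have qL: "q < L" by (rule covers_less[OF pq])
  obtain a1 :: 'k where a1: "a1 \<noteq> 0" "tvec L w (p', q') = fscale a1 (delta (insert (0, p') ?T))"
    using tvec_eq[OF pq'] by blast
  have T0: "(0, i) \<notin> ?T" for i by (auto simp: relocate_def mem_cells jump_cols_def)
  have "(Eop L q p ^^ card ?I) (Eop L q 0 (delta (insert (0, p') ?T))) = (0 :: 'k fock)"
  proof (cases "(q, p') \<in> ?T")
    case True
    then show ?thesis using Eop_0_delta(1)[OF T0, of q p' L, where 'k = 'k] c qL
      by (simp add: fs.lin_0[OF fs.lin_funpow[OF lin_Eop]])
  next
    case False
    then obtain a2 :: 'k where a2: "a2 \<noteq> 0"
      "Eop L q 0 (delta (insert (0, p') ?T)) = fscale a2 (delta (insert (q, p') ?T))"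
      using Eop_0_delta(2)[OF T0, of q p' L, where 'k = 'k] c qL by auto
    have qJ: "q \<notin> ?J" using False by (auto simp: relocate_def)
    have wq: "w p < w p'"
    proof (rule ccontr)
      assume "\<not> w p < w p'"
      then have eq: "p' = p" "q' < q" using less by auto
      \<comment> \<open>Here \<open>q'\<close> lies between \<open>p\<close> and \<open>q\<close>
        and has a value above \<open>w p\<close>, so the cover at \<open>p\<close>, \<open>q\<close>
        excludes a value below \<open>w q\<close>. This puts \<open>q\<close> among the columns in
        which \<open>tvec\<close> fills row \<open>p'\<close>.\<close>
      then have "\<not> w q' < w q" using cov(1) c unfolding cover_def by auto
      moreover have "w q' \<noteq> w q" using eq perm_eq_iff[OF w, of q' q] by simp
      ultimately show False using qJ eq c by (simp add: jump_cols_def)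
    qed
    then have pJ: "p \<notin> ?J" by (simp add: jump_cols_def)
    have Tq: "(q, i) \<in> ?T \<longleftrightarrow> (q, i) \<in> cells w" and Tp: "(p, i) \<in> ?T \<longleftrightarrow> (p, i) \<in> cells w" for i
      using qJ pJ by (auto simp: relocate_def)
    have "(q, p') \<notin> cells w" using False Tq by simp
    then have "w p' < w q" using c perm_eq_iff[OF w, of p' q] by (simp add: mem_cells)
    then have p': "p' \<in> ?I"
      using wq c cov(1) unfolding cover_def jump_rows_def by (cases "p' < p") (auto simp: not_less le_less)
    let ?I' = "{i. i < L \<and> (p, i) \<in> insert (q, p') ?T \<and> (q, i) \<notin> insert (q, p') ?T}"
    have "?I' \<subseteq> ?I - {p'}"
    proof -
      have "w i \<le> w q \<longleftrightarrow> w i < w q" if "i < p" for i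
        using perm_eq_iff[OF w, of i q] that c by (simp add: le_less)
      then show ?thesis using c unfolding jump_rows_def insert_iff Tp Tq
        by (auto simp: mem_cells not_less)
    qed
    moreover have "finite ?I" unfolding jump_rows_def by auto
    ultimately have "card ?I' < card ?I" using p' by (meson card_Diff1_less card_mono finite_Diff le_less_trans)
    then show ?thesis
      using Eop_funpow(2)[of q p ?I' L "insert (q, p') ?T" "card ?I", where 'k = 'k] c
      by (simp add: a2 fs.lin_scale[OF fs.lin_funpow[OF lin_Eop]])
  qed
  then show ?thesis unfolding tmap_def
    by (simp add: a1 fs.lin_scale[OF lin_Eop] fs.lin_scale[OF fs.lin_funpow[OF lin_Eop]])
qed

lemma covers_enumeration:
  "\<exists>xs. distinct xs \<and> set xs = covers \<nu> w \<and>
    (\<forall>i<length xs. \<forall>j<i. tmap L w (xs ! i) (tvec L w (xs ! j)) = (0 :: 'k::field_char_0 fock))"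
proof -
  obtain ys where ys: "set ys = covers \<nu> w" "distinct ys"
    using finite_distinct_list[OF finite_covers[OF w]] by blast
  define key where "key = (\<lambda>(p, q). (L - w p) * L + q)" \<comment> \<open>\<open>w p\<close> decreasing, then \<open>q\<close> increasing\<close>
  define xs where "xs = sort_key key ys"
  have xs: "distinct xs" "set xs = covers \<nu> w" "sorted (map key xs)"
    using ys by (simp_all add: xs_def)
  have "tmap L w (xs ! i) (tvec L w (xs ! j)) = (0 :: 'k fock)" if ij: "i < length xs" "j < i" for i j
  proof -
    obtain p q p' q' where e: "xs ! i = (p, q)" "xs ! j = (p', q')" by fastforce
    have m: "(p, q) \<in> covers \<nu> w" "(p', q') \<in> covers \<nu> w"
      using xs(2) nth_mem[of i xs] nth_mem[of j xs] ij e by auto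
    have ne: "(p, q) \<noteq> (p', q')" using nth_eq_iff_index_eq[OF xs(1), of i j] ij e by auto
    have le: "(L - w p') * L + q' \<le> (L - w p) * L + q"
      using sorted_nth_mono[OF xs(3), of j i] ij e by (simp add: key_def)
    have qL: "q < L" "q' < L" using covers_less m by auto
    have pN: "p \<le> N" "p' \<le> N" using m \<nu> by (auto simp: covers_def)
    then have wL: "w p < L" "w p' < L" using perm_le[OF w, of p] perm_le[OF w, of p'] L by auto
    \<comment> \<open>Both \<open>q\<close> and \<open>q'\<close> are below \<open>L\<close>, so
      keys compare lexicographically.\<close>
    have "L - w p' \<le> L - w p"
    proof (rule ccontr)
      assume "\<not> L - w p' \<le> L - w p"
      then have "Suc (L - w p) * L \<le> (L - w p') * L" by (intro mult_right_mono) auto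
      then show False using le qL by simp
    qed
    then have "w p \<le> w p'" using wL by simp
    moreover have "q' < q" if "p = p'" using that le ne by auto
    ultimately have "w p < w p' \<or> p' = p \<and> q' < q"
      using perm_eq_iff[OF w, of p p'] by (auto simp: le_less)
    then show ?thesis unfolding e by (rule tmap_tvec_eq_0[OF m])
  qed
  then show ?thesis using xs by blast
qed

lemma tmap_commute:
  assumes "(p, q) \<in> covers \<nu> w" "e \<in> row_ops L"
  shows "tmap L w (p, q) (e x) = e (tmap L w (p, q) x)"
proof -
  obtain a b where e: "e = eop L a b" "a \<le> b" "b < L" using assms(2) by (auto simp: row_ops_def)
  have "q < L" "p < L" "0 < L" using covers_less[OF assms(1)] assms(1) by (auto simp: covers_def)
  then have com: "eop L a b (Eop L q k y) = Eop L q k (eop L a b y)" if "k < L" for k and y :: "'a fock"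
    using that e by (intro eop_Eop) auto
  have "eop L a b ((Eop L q p ^^ n) y) = (Eop L q p ^^ n) (eop L a b y)" for n and y :: "'a fock"
    by (rule fs.funpow_commute) (rule com[OF \<open>p < L\<close>])
  then show ?thesis using com[OF \<open>0 < L\<close>] unfolding tmap_def e(1) by simp
qed

lemma subspace_tensor_space: "fs.subspace (tensor_space L \<nu> w)"
  unfolding tensor_space_def by (rule fs.subspace_span)

lemma tensor_space_closed:
  assumes e: "e \<in> row_ops L" and "x \<in> tensor_space L \<nu> w"
  shows "e x \<in> tensor_space L \<nu> w"
proof -
  obtain a b where ab: "e = eop L a b" "1 \<le> a" "a \<le> b" "b < L" using e by (auto simp: row_ops_def)
  have "e y \<in> tensor_space L \<nu> w" if hy: "y \<in> (\<Union>i\<in>{1..\<nu>}. cre (0, i) ` gen_orbit L w)" for y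
  proof -
    obtain i where i: "i \<in> {1..\<nu>}" "y \<in> cre (0, i) ` gen_orbit L w" using hy by blast
    then obtain z where "y = cre (0, i) z" "z \<in> gen_orbit L w" by blast
    then have y: "y = cre (0, i) z" "1 \<le> i" "i \<le> \<nu>" "z \<in> gen_orbit L w" using i by auto
    have "e z \<in> gen_orbit L w" using y(4) fs.orbit_closed[OF e] unfolding gen_orbit_def by blast
    then have "cre (0, i) (e z) \<in> tensor_space L \<nu> w" unfolding tensor_space_def
      using y by (intro fs.span_base UN_I[of i]) auto
    \<comment> \<open>Here a \<le> b = i \<le> \<nu>, so the new vector of column 0 is again one of
      the first \<nu>.\<close>
    moreover have "cre (0, a) z \<in> tensor_space L \<nu> w" if "b = i" unfolding tensor_space_def
      using y that ab by (intro fs.span_base UN_I[of a]) auto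
    ultimately show ?thesis using fs.subspace_add[OF subspace_tensor_space] L
      unfolding y ab(1) by (cases "b = i") (simp_all add: eop_cre)
  qed
  then show ?thesis using assms(2) fs.span_Union_closed[OF _ lin_row_ops[OF e]] unfolding tensor_space_def
    by blast
qed

lemma tvec_tensor_space:
  assumes "(p, q) \<in> covers \<nu> w" shows "tvec L w (p, q) \<in> tensor_space L \<nu> w"
proof -
  have "1 \<le> p" "p \<le> \<nu>" "p < q" using assms by (auto simp: covers_def cover_def)
  moreover have "eop L p q \<in> row_ops L"
    using \<open>1 \<le> p\<close> \<open>p < q\<close> covers_less[OF assms] by (auto simp: row_ops_def intro: less_imp_le)
  ultimately have "(eop L p q ^^ card (jump_cols w (p, q))) (delta (cells w)) \<in> gen_orbit L w"
    unfolding gen_orbit_def by (intro fs.orbit_closed_funpow fs.orbit_base)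
  then show ?thesis unfolding tensor_space_def tvec_def
    using \<open>1 \<le> p\<close> \<open>p \<le> \<nu>\<close> by (intro fs.span_base UN_I[of p]) auto
qed

lemma tensor_space_finite_span:
  "\<exists>B. finite B \<and> (tensor_space L \<nu> w :: 'k fock set) \<subseteq> fs.span B \<and> card B \<le> \<nu> * fs.dim (gen_orbit L w :: 'k::field_char_0 fock set)"
proof -
  have sub: "fs.subspace (gen_orbit L w :: 'k fock set)" unfolding gen_orbit_def by (rule fs.subspace_orbit)
  obtain B' where B': "finite B'" "(gen_orbit L w :: 'k fock set) \<subseteq> fs.span B'"
    using gen_orbit_finite_span[OF cells_subset_box[OF w]] L by (metis Suc_lessD)
  obtain B where B: "B \<subseteq> B" "finite B" "fs.independent B" "fs.span B = (gen_orbit L w :: 'k fock set)"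
    by (rule fs.finite_basis_extend[OF sub sub subset_refl B'(2,1)]) blast
  have d: "card B = fs.dim (gen_orbit L w :: 'k fock set)"
    using fs.dim_eq_card_independent[OF B(3)] B(4) by (metis fs.dim_span)
  let ?C = "\<Union>i\<in>{1..\<nu>}. cre (0, i) ` B"
  have im: "cre (0, i) ` gen_orbit L w \<subseteq> fs.span ?C" if "i \<in> {1..\<nu>}" for i
    unfolding B(4)[symmetric] fs.lin_span_image[OF lin_cre] using that by (intro fs.span_mono) auto
  have "tensor_space L \<nu> w \<subseteq> fs.span ?C" unfolding tensor_space_def
    by (rule fs.span_minimal[OF UN_least[OF im] fs.subspace_span])
  moreover have "card ?C \<le> (\<Sum>i\<in>{1..\<nu>}. card (cre (0, i) ` B))" by (intro card_UN_le) auto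
  moreover have "(\<Sum>i\<in>{1..\<nu>}. card (cre (0, i) ` B)) \<le> (\<Sum>i\<in>{1..\<nu>}. card B)"
    by (intro sum_mono card_image_le B)
  ultimately show ?thesis using d B(2) by (intro exI[of _ ?C]) simp
qed

lemma orbit_tmap_tvec:
  assumes "(p, q) \<in> covers \<nu> w"
  shows "fs.orbit (row_ops L) (tmap L w (p, q) (tvec L w (p, q))) = gen_orbit L (w \<circ> Transposition.transpose p q)"
  using tmap_tvec[OF assms, where 'k = 'a] by (auto simp: gen_orbit_def fs.orbit_scale)

text \<open>The count of \<open>orbit_chain\<close> in the tensor product: Monk's formula for
  dimensions, as an inequality. It will serve as an upper bound for the dimension of each single
  cover.\<close>

lemma sum_dim_covers_le:
  "(\<Sum>(p, q)\<in>covers \<nu> w. fs.dim (gen_orbit L (w \<circ> Transposition.transpose p q) :: 'k::field_char_0 fock set)) \<le>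
   \<nu> * fs.dim (gen_orbit L w :: 'k fock set)"
proof -
  obtain xs where xs: "distinct xs" "set xs = covers \<nu> w"
    "\<And>i j. i < length xs \<Longrightarrow> j < i \<Longrightarrow> tmap L w (xs ! i) (tvec L w (xs ! j)) = (0 :: 'k fock)"
    using covers_enumeration[where 'k = 'k] by blast
  obtain B where B: "finite B" "(tensor_space L \<nu> w :: 'k fock set) \<subseteq> fs.span B" "card B \<le> \<nu> * fs.dim (gen_orbit L w :: 'k fock set)"
    using tensor_space_finite_span by blast
  have mem: "xs ! i \<in> covers \<nu> w" if "i < length xs" for i using nth_mem[OF that] xs by simp
  let ?d = "\<lambda>x. fs.dim (fs.orbit (row_ops L) (tmap L w x (tvec L w x :: 'k fock)))"
  have "(\<Sum>i<length xs. ?d (xs ! i)) \<le> fs.dim (tensor_space L \<nu> w :: 'k fock set)"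
  proof (rule fs.orbit_chain(1)[where k = "length xs" and A = "row_ops L" and M = "tensor_space L \<nu> w" and B = B and v = "\<lambda>i. tvec L w (xs ! i)" and f = "\<lambda>i. tmap L w (xs ! i)"])
    show "tensor_space L \<nu> w \<subseteq> fs.span B" "finite B" "fs.subspace (tensor_space L \<nu> w :: 'k fock set)"
      by (rule B subspace_tensor_space)+
    show "fs.lin e" if "e \<in> row_ops L" for e :: "'k fock \<Rightarrow> 'k fock" by (rule lin_row_ops[OF that])
    show "e x \<in> tensor_space L \<nu> w" if "e \<in> row_ops L" "x \<in> tensor_space L \<nu> w" for e and x :: "'k fock"
      by (rule tensor_space_closed[OF that])
  next
    fix i assume i: "i < length xs"
    obtain p q where pq: "xs ! i = (p, q)" by fastforce
    show "(tvec L w (xs ! i) :: 'k fock) \<in> tensor_space L \<nu> w" using mem[OF i] tvec_tensor_space by (simp add: pq)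
    show "fs.lin (tmap L w (xs ! i) :: 'k fock \<Rightarrow> 'k fock)" by (rule lin_tmap)
    show "\<exists>c. tmap L w (xs ! i) (e x) = e (tmap L w (xs ! i) x) + fscale c (tmap L w (xs ! i) x)"
      if "e \<in> row_ops L" for e and x :: "'k fock"
      using tmap_commute[OF _ that, of p q x] mem[OF i] by (intro exI[of _ 0]) (simp add: pq)
    show "tmap L w (xs ! i) (tvec L w (xs ! j)) = (0 :: 'k fock)" if "j < i" for j using xs(3)[OF i that] .
  qed
  also have "fs.dim (tensor_space L \<nu> w :: 'k fock set) \<le> card B" using B by (intro fs.dim_le_card)
  also note B(3)
  also have "(\<Sum>i<length xs. ?d (xs ! i)) = (\<Sum>x\<in>covers \<nu> w. ?d x)"
    unfolding xs(2)[symmetric] using xs(1) by (simp add: sum.distinct_set_conv_list sum_list_sum_nth atLeast0LessThan)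
  also have "\<dots> = (\<Sum>(p, q)\<in>covers \<nu> w. fs.dim (gen_orbit L (w \<circ> Transposition.transpose p q) :: 'k fock set))"
    by (intro sum.cong) (auto simp: orbit_tmap_tvec)
  finally show ?thesis .
qed

end

subsection \<open>The transition inequality\<close>

text \<open>For the last descent \<open>r\<close> of \<open>w\<close> and the last \<open>q\<close> with \<open>w q < w r\<close>, the permutation
  \<open>u = w t\<^sub>r\<^sub>q\<close> satisfies \<open>schub w = schub u + (\<Sum>p. schub (u t\<^sub>p\<^sub>r))\<close>, the sum over covers
  \<open>p < r\<close> of \<open>u\<close>. The dimensions of the orbits satisfy the corresponding inequality.\<close>

lemma proj_cells_arith:
  fixes i j p q r a b P Q R :: nat
  assumes "1 \<le> p" "p < r" "r < q" "P < Q" "Q < R"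
    and "p < i \<Longrightarrow> i < r \<Longrightarrow> a < P \<or> Q < a" "r < i \<Longrightarrow> i < q \<Longrightarrow> a < Q" "q < i \<Longrightarrow> R < a"
    and "a = P \<longleftrightarrow> i = p" "a = Q \<longleftrightarrow> i = q" "a = R \<longleftrightarrow> i = r"
    and "p < j \<Longrightarrow> j < r \<Longrightarrow> b < P \<or> Q < b" "r < j \<Longrightarrow> j < q \<Longrightarrow> b < Q" "q < j \<Longrightarrow> R < b"
    and "b = P \<longleftrightarrow> j = p" "b = Q \<longleftrightarrow> j = q" "b = R \<longleftrightarrow> j = r"
    and "r < i \<Longrightarrow> i < j \<Longrightarrow> a < b"
  shows "j = r \<and> (i = p \<or> (1 \<le> i \<and> i < p \<and> P < a \<and> a < Q) \<or> (1 \<le> i \<and> i < r \<and> Q < a \<and> a < R)) \<or> \<not> (j = q \<and> (i = p \<or> (1 \<le> i \<and> i < p \<and> P < a \<and> a < Q) \<or> (1 \<le> i \<and> i < r \<and> Q < a \<and> a < R))) \<and>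
      (j = q \<and> (1 \<le> i \<and> i < p \<and> P < a \<and> a < Q) \<or> \<not> (j = p \<and> (1 \<le> i \<and> i < p \<and> P < a \<and> a < Q)) \<and>
        (i = p \<and> (r < j \<and> P < b \<and> b < R) \<or> \<not> (i = r \<and> (r < j \<and> P < b \<and> b < R)) \<and> 1 \<le> i \<and> i < j \<and> b < a)) \<longleftrightarrow>
    1 \<le> i \<and> i < j \<and> (if j = p then Q else if j = r then P else if j = q then R else b) < (if i = p then Q else if i = r then P else if i = q then R else a)"
proof -
  note o = assms(1-5) and ai = assms(6) and am = assms(7)
    and aP = assms(9) and aQ = assms(10) and aR = assms(11)
    and bi = assms(12) and bm = assms(13) and bl = assms(14)
    and bP = assms(15) and bQ = assms(16) and bR = assms(17)
  consider "j = p" | "j = r" | "j = q" | "j \<noteq> p" "j \<noteq> r" "j \<noteq> q" by blast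
  then show ?thesis
  proof cases
    case 1
    then have "b = P" using bP by simp
    then show ?thesis using 1 o aQ by (cases "i < p") auto
  next
    case 2
    then have b: "b = R" using bR by simp
    show ?thesis
    proof (cases "i < r")
      case True
      then have n: "i \<noteq> r" "i \<noteq> q" "a \<noteq> Q" "a \<noteq> R" using o aQ aR by auto
      consider "i < p" | "i = p" | "p < i" by linarith
      then show ?thesis
      proof cases
        case a: 1
        then show ?thesis using 2 b o n True by simp linarith
      next
        case a: 2
        then show ?thesis using 2 b o n True by simp
      next
        case a: 3
        then have "a < P \<or> Q < a" using ai True by blast
        then show ?thesis using 2 b o n True a by simp linarith
      qed
    next
      case False
      then show ?thesis using 2 b o by simp
    qed
  next
    case 3
    then have b: "b = Q" using bQ by simp
    consider "i = p" | "i < r" "i \<noteq> p" | "i = r" | "r < i" "i < q" | "q \<le> i" by linarith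
    then show ?thesis
    proof cases
      case a: 1
      then show ?thesis using 3 b o by simp
    next
      case a: 2
      then have "a \<noteq> R" "i \<noteq> q" using aR o by auto
      then show ?thesis using 3 b o a by simp linarith
    next
      case a: 3
      then show ?thesis using 3 b o by simp
    next
      case a: 4
      then have "a < Q" by (rule am)
      then show ?thesis using 3 b o a by simp
    next
      case a: 5
      then show ?thesis using 3 b o by simp
    qed
  next
    case 4
    then have n: "b \<noteq> P" "b \<noteq> Q" "b \<noteq> R" using bP bQ bR by auto
    consider "i = p" | "i = r" | "i = q" | "i \<noteq> p" "i \<noteq> r" "i \<noteq> q" by blast
    then show ?thesis
    proof cases
      case a: 1
      then have aP': "a = P" using aP by simp
      consider "j < p" | "p < j" "j < r" | "r < j" "j < q" | "q < j" using 4 by linarith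
      then show ?thesis
      proof cases
        case c: 1
        then show ?thesis using 4 a aP' o by simp
      next
        case c: 2
        then have "b < P \<or> Q < b" by (rule bi)
        then show ?thesis using 4 a aP' o c n by simp linarith
      next
        case c: 3
        then have "b < Q" by (rule bm)
        then show ?thesis using 4 a aP' o c n by simp linarith
      next
        case c: 4
        then have "R < b" by (rule bl)
        then show ?thesis using 4 a aP' o c n by simp
      qed
    next
      case a: 2
      then have "a = R" using aR by simp
      then show ?thesis using 4 a o n by simp linarith
    next
      case a: 3
      then have "a = Q" using aQ by simp
      then show ?thesis using 4 a o n bl by (cases "q < j") auto
    next
      case a: 4
      then show ?thesis using 4 by simp
    qed
  qed
qed

text \<open>The inversion test for \<open>u\<close>, with \<open>a, b, Q, R\<close> in place of the
  values of \<open>w\<close> at \<open>i, j, q, r\<close>; the left side deletes the cell of the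
  pair \<open>r\<close>, \<open>q\<close> and moves rows from column \<open>q\<close> to column
  \<open>r\<close>.\<close>

lemma last_proj_cells_arith:
  fixes i j q r a b Q R :: nat
  assumes "1 \<le> r" "r < q" "Q < R"
    and "r < i \<Longrightarrow> i < q \<Longrightarrow> a < Q" "q < i \<Longrightarrow> R < a" "a = Q \<longleftrightarrow> i = q" "a = R \<longleftrightarrow> i = r"
    and "r < j \<Longrightarrow> j < q \<Longrightarrow> b < Q" "q < j \<Longrightarrow> R < b" "b = Q \<longleftrightarrow> j = q" "b = R \<longleftrightarrow> j = r"
    and "r < i \<Longrightarrow> i < j \<Longrightarrow> a < b"
  shows "j = r \<and> (1 \<le> i \<and> i < r \<and> Q < a \<and> a < R) \<or> \<not> (j = q \<and> (1 \<le> i \<and> i < r \<and> Q < a \<and> a < R)) \<and> \<not> (j = q \<and> i = r) \<and> 1 \<le> i \<and> i < j \<and> b < a \<longleftrightarrow>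
    1 \<le> i \<and> i < j \<and> (if j = r then Q else if j = q then R else b) < (if i = r then Q else if i = q then R else a)"
proof -
  note o = assms(1-3) and am = assms(4) and aQ = assms(6) and aR = assms(7)
    and bm = assms(8) and bl = assms(9) and bQ = assms(10) and bR = assms(11)
  consider "j = r" | "j = q" | "j \<noteq> r" "j \<noteq> q" by blast
  then show ?thesis
  proof cases
    case 1
    then have "b = R" using bR by simp
    then show ?thesis using 1 o aR by (cases "i < r") auto
  next
    case 2
    then have b: "b = Q" using bQ by simp
    consider "i < r" | "i = r" | "r < i" "i < q" | "q \<le> i" by linarith
    then show ?thesis
    proof cases
      case a: 1
      then have "a \<noteq> R" "i \<noteq> q" using aR o by auto
      then show ?thesis using 2 b o a by simp linarith
    next
      case a: 2
      then show ?thesis using 2 b o by simp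
    next
      case a: 3
      then have "a < Q" by (rule am)
      then show ?thesis using 2 b o a by simp
    next
      case a: 4
      then show ?thesis using 2 b o by simp
    qed
  next
    case 3
    consider "i = r" | "i = q" | "i \<noteq> r" "i \<noteq> q" by blast
    then show ?thesis
    proof cases
      case a: 1
      then have "a = R" using aR by simp
      moreover have "b < Q" if "r < j" "j < q" using bm that .
      ultimately show ?thesis using 3 a o bl by (cases "q < j"; cases "j < r") auto
    next
      case a: 2
      then have "a = Q" using aQ by simp
      then show ?thesis using 3 a o bl by (cases "q < j") auto
    next
      case a: 3
      then show ?thesis using 3 by simp
    qed
  qed
qed

section \<open>Transition at the last descent\<close>

locale last_descent =
  fixes w :: "nat \<Rightarrow> nat" and N L r q :: nat
  assumes w: "w permutes {1..N}" and L: "N < L"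
    and r: "1 \<le> r" "r < q" "q \<le> N" and wq: "w q < w r"
    and incr: "\<And>i j. r < i \<Longrightarrow> i < j \<Longrightarrow> w i < w j"
    and above: "\<And>i. q < i \<Longrightarrow> w r < w i"
begin

definition u :: "nat \<Rightarrow> nat" where
  "u = w \<circ> Transposition.transpose r q"

lemma u_simps: "u r = w q" "u q = w r" "i \<noteq> r \<Longrightarrow> i \<noteq> q \<Longrightarrow> u i = w i"
  by (simp_all add: u_def Transposition.transpose_def)

lemma u_permutes: "u permutes {1..N}"
  unfolding u_def by (rule permutes_transpose_right[OF w]) (use r in auto)

lemma w_u: "w = u \<circ> Transposition.transpose r q"
  by (simp add: u_def comp_assoc)

lemma below: "r < i \<Longrightarrow> i < q \<Longrightarrow> w i < w q"
  by (rule incr)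

text \<open>Between \<open>r\<close> and \<open>q\<close> the values stay below
  \<open>u r = w q\<close>; beyond \<open>q\<close> they exceed \<open>u q = w r\<close>, so that
  \<open>q\<close> itself is in the way. This is the uniqueness that \<open>schub_transition\<close>
  asks for.\<close>

lemma cover_u_iff: "cover u r x \<longleftrightarrow> x = q"
proof
  assume c: "cover u r x"
  then have x: "r < x" "w q < u x" and b: "\<And>i. r < i \<Longrightarrow> i < x \<Longrightarrow> \<not> (w q < u i \<and> u i < u x)"
    by (auto simp: cover_def u_simps)
  show "x = q"
  proof (rule ccontr)
    assume "x \<noteq> q"
    then have "q < x" using x below[of x] by (cases "x < q") (auto simp: u_simps)
    then show False using b[of q] r above[of x] wq by (simp add: u_simps)
  qed
next
  assume "x = q"
  then show "cover u r x" using r wq below unfolding cover_def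
    by (auto simp: u_simps dest: less_asym)
qed

definition preds :: "nat set" where "preds = {p. cover u p r}"

lemma finite_preds: "finite preds"
  by (rule finite_subset[of _ "{..<r}"]) (auto simp: preds_def cover_def)

lemma preds_iff: "p \<in> preds \<longleftrightarrow> 1 \<le> p \<and> p < r \<and> w p < w q \<and> (\<forall>i. p < i \<and> i < r \<longrightarrow> w i < w p \<or> w q < w i)"
proof -
  have "w i \<noteq> w p" "w i \<noteq> w q" if "p < i" "i < r" for i
    using perm_eq_iff[OF w] that r by auto
  then have "\<not> (w p < w i \<and> w i < w q) \<longleftrightarrow> w i < w p \<or> w q < w i" if "p < i" "i < r" for i
    using that by (metis linorder_neqE_nat less_asym less_trans)
  then show ?thesis using r unfolding preds_def cover_def by (auto simp: u_simps)
qed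

text \<open>From \<open>w\<close> to \<open>u t\<^sub>p\<^sub>r\<close> the entries at p < r < q are
  permuted cyclically. \<open>K p\<close> lists the columns in which a cell passes from row
  \<open>r\<close> to row \<open>p\<close>, \<open>Y p\<close> the rows passing from column
  \<open>p\<close> to column \<open>q\<close>, and \<open>p\<close>, \<open>Y p\<close> and
  \<open>B\<close> together those passing from column \<open>q\<close> to column
  \<open>r\<close>.\<close>

definition Y :: "nat \<Rightarrow> nat set" where "Y p = {i. 1 \<le> i \<and> i < p \<and> w p < w i \<and> w i < w q}"
definition B :: "nat set" where "B = {i. 1 \<le> i \<and> i < r \<and> w q < w i \<and> w i < w r}"
definition K :: "nat \<Rightarrow> nat set" where "K p = {k. r < k \<and> w p < w k \<and> w k < w r}"

definition moved :: "nat \<Rightarrow> (nat \<times> nat) set" where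
  "moved p = relocate (\<lambda>j. (j, p)) (\<lambda>j. (j, r)) (K p) (cells w)"

definition vec :: "nat \<Rightarrow> 'k::field_char_0 fock" where
  "vec p = (eop L p r ^^ card (K p)) (delta (cells w))"

definition proj :: "nat \<Rightarrow> 'k::field_char_0 fock \<Rightarrow> 'k fock" where
  "proj p f = (Eop L r q ^^ card (insert p (Y p \<union> B))) ((Eop L q p ^^ card (Y p)) f)"

text \<open>The set of inversions of \<open>u\<close> has one element less than that of
  \<open>w\<close>, and operators that only move cells cannot lose one. The annihilator removes the
  inversion of \<open>r\<close> and \<open>q\<close>; it shifts the weight, hence the defect in
  \<open>last_proj_twist\<close>.\<close>

definition last_proj :: "'k::field_char_0 fock \<Rightarrow> 'k fock" where
  "last_proj f = (Eop L r q ^^ card B) (ann (q, r) f)"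

lemma qL: "q < L" using r L by simp

lemma vec_eq:
  assumes p: "p \<in> preds"
  shows "\<exists>c::'k::field_char_0. c \<noteq> 0 \<and> vec p = fscale c (delta (moved p))"
proof -
  have c: "1 \<le> p" "p < r" "w p < w q" using p by (auto simp: preds_iff)
  have J: "K p = {j. j < L \<and> (j, r) \<in> cells w \<and> (j, p) \<notin> cells w}"
  proof -
    have "w p \<le> w j \<longleftrightarrow> w p < w j" if "r < j" for j
      using perm_eq_iff[OF w, of j p] that c by (auto simp: le_less)
    moreover have "j < L" if "(j, r) \<in> cells w" for j using cells_subset[OF w] that L by auto
    ultimately show ?thesis using c r(1) unfolding K_def
      by (auto simp: mem_cells not_less)
  qed
  show ?thesis unfolding vec_def moved_def
    by (rule eop_funpow[OF _ J]) (use c in simp)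
qed

lemma mem_moved:
  "(j, i) \<in> moved p \<longleftrightarrow> i = p \<and> j \<in> K p \<or> \<not> (i = r \<and> j \<in> K p) \<and> 1 \<le> i \<and> i < j \<and> w j < w i"
  by (auto simp: moved_def relocate_def mem_cells)

lemma q_in_K: "p \<in> preds \<Longrightarrow> q \<in> K p"
  using r wq by (auto simp: K_def preds_iff)

lemma proj_vec:
  assumes p: "p \<in> preds"
  shows "\<exists>c::'k::field_char_0. c \<noteq> 0 \<and> proj p (vec p) = fscale c (delta (cells (u \<circ> Transposition.transpose p r)))"
proof -
  have c: "1 \<le> p" "p < r" "w p < w q" "\<And>i. p < i \<Longrightarrow> i < r \<Longrightarrow> w i < w p \<or> w q < w i"
    using p by (auto simp: preds_iff)
  obtain a1 :: 'k where a1: "a1 \<noteq> 0" "vec p = fscale a1 (delta (moved p))" using vec_eq[OF p] by blast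
  have neq: "w i = w p \<longleftrightarrow> i = p" "w i = w q \<longleftrightarrow> i = q" "w i = w r \<longleftrightarrow> i = r" for i
    using perm_eq_iff[OF w] by auto
  have I1: "Y p = {i. i < L \<and> (p, i) \<in> moved p \<and> (q, i) \<notin> moved p}"
  proof -
    have "p \<notin> K p" "i < L \<or> \<not> i < p" "i = r \<longrightarrow> \<not> i < p" for i using c qL r by (auto simp: K_def)
    moreover have "i < p \<Longrightarrow> \<not> w q < w i \<longleftrightarrow> w i < w q" for i using neq(2)[of i] c r by auto
    ultimately show ?thesis using c r q_in_K[OF p] unfolding mem_moved Y_def by auto
  qed
  let ?T1 = "relocate (Pair q) (Pair p) (Y p) (moved p)"
  obtain a2 :: 'k where a2: "a2 \<noteq> 0" "(Eop L q p ^^ card (Y p)) (delta (moved p)) = fscale a2 (delta ?T1)"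
    using Eop_funpow(1)[OF _ I1, where 'k = 'k] c r by force
  have mem1: "(j, i) \<in> ?T1 \<longleftrightarrow> j = q \<and> i \<in> Y p \<or> \<not> (j = p \<and> i \<in> Y p) \<and> (j, i) \<in> moved p" for j i
    by (auto simp: relocate_def)
  let ?Z = "insert p (Y p \<union> B)"
  \<comment> \<open>Row \<open>p\<close> of column \<open>q\<close> is occupied because
    \<open>vec p\<close> has moved the cell of row \<open>r\<close> there.\<close>
  have I2: "?Z = {i. i < L \<and> (q, i) \<in> ?T1 \<and> (r, i) \<notin> ?T1}"
  proof -
    have "i \<in> ?Z \<longleftrightarrow> i < L \<and> (q, i) \<in> ?T1 \<and> (r, i) \<notin> ?T1" for i
    proof -
      have Tq: "(q, i) \<in> ?T1 \<longleftrightarrow> i \<in> Y p \<or> i = p \<or> i \<noteq> r \<and> 1 \<le> i \<and> i < q \<and> w q < w i"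
        using c r q_in_K[OF p] unfolding mem1 mem_moved by auto
      have Tr: "(r, i) \<in> ?T1 \<longleftrightarrow> 1 \<le> i \<and> i < r \<and> w r < w i"
        using c r unfolding mem1 mem_moved K_def by auto
      show ?thesis unfolding Tq Tr
        using c r qL wq below[of i] neq(2)[of i] neq(3)[of i] unfolding Y_def B_def
        by (cases "i < r"; cases "i = r"; cases "i < q") auto
    qed
    then show ?thesis by blast
  qed
  let ?T2 = "relocate (Pair r) (Pair q) ?Z ?T1"
  obtain a3 :: 'k where a3: "a3 \<noteq> 0" "(Eop L r q ^^ card ?Z) (delta ?T1) = fscale a3 (delta ?T2)"
    using Eop_funpow(1)[OF _ I2, where 'k = 'k] r by force
  have mem2: "(j, i) \<in> ?T2 \<longleftrightarrow> j = r \<and> i \<in> ?Z \<or> \<not> (j = q \<and> i \<in> ?Z) \<and> (j, i) \<in> ?T1" for j i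
    by (auto simp: relocate_def)
  have "(j, i) \<in> ?T2 \<longleftrightarrow> (j, i) \<in> cells (u \<circ> Transposition.transpose p r)" for j i
  proof -
    let ?v = "\<lambda>x. if x = p then w q else if x = r then w p else if x = q then w r else w x"
    have v: "(u \<circ> Transposition.transpose p r) x = ?v x" for x
      using c r by (auto simp: u_simps Transposition.transpose_def)
    show ?thesis unfolding mem2 mem1 mem_moved mem_cells v
      unfolding insert_iff Un_iff Y_def B_def K_def mem_Collect_eq
      by (rule proj_cells_arith[OF c(1,2) r(2) c(3) wq c(4) below above neq c(4) below above neq incr])
  qed
  then have "?T2 = cells (u \<circ> Transposition.transpose p r)" by auto
  then have "proj p (vec p) = fscale (a1 * a2 * a3) (delta (cells (u \<circ> Transposition.transpose p r)))"
    unfolding proj_def by (simp add: a1 a2 a3 fs.lin_scale[OF fs.lin_funpow[OF lin_Eop]])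
  then show ?thesis using a1(1) a2(1) a3(1) by (metis mult_eq_0_iff)
qed

text \<open>As \<open>p\<close> lies between \<open>p'\<close> and \<open>r\<close>, the cover at
  \<open>p'\<close> gives w p < w p', so \<open>p'\<close> is counted in \<open>Y p\<close>. But
  \<open>vec p'\<close> has filled row \<open>p'\<close> of column \<open>q\<close>; that move is
  blocked and the exponent is too large.\<close>

lemma proj_vec_eq_0:
  assumes p: "p \<in> preds" and p': "p' \<in> preds" "p' < p"
  shows "proj p (vec p') = (0 :: 'k::field_char_0 fock)"
proof -
  have c: "1 \<le> p" "p < r" "w p < w q" using p by (auto simp: preds_iff)
  have c': "1 \<le> p'" "w p' < w q" "w p < w p'"
    using p'(1) p'(2) c by (auto simp: preds_iff dest: spec[of _ p])
  obtain a1 :: 'k where a1: "a1 \<noteq> 0" "vec p' = fscale a1 (delta (moved p'))" using vec_eq[OF p'(1)] by blast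
  have "p' \<in> Y p" using c c' p' by (simp add: Y_def)
  let ?I = "{i. i < L \<and> (p, i) \<in> moved p' \<and> (q, i) \<notin> moved p'}"
  have "?I \<subseteq> Y p - {p'}"
  proof -
    have "i < p \<Longrightarrow> \<not> w q < w i \<longleftrightarrow> w i < w q" for i using perm_eq_iff[OF w, of i q] c r by auto
    then show ?thesis using c c' r q_in_K[OF p'(1)] unfolding mem_moved Y_def by (auto simp: K_def)
  qed
  moreover have "finite (Y p)" unfolding Y_def by auto
  ultimately have "card ?I < card (Y p)"
    using \<open>p' \<in> Y p\<close> by (meson card_Diff1_less card_mono finite_Diff le_less_trans)
  then have "(Eop L q p ^^ card (Y p)) (delta (moved p')) = (0 :: 'k fock)"
    using Eop_funpow(2)[of q p ?I L "moved p'" "card (Y p)", where 'k = 'k] c r by simp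
  then show ?thesis unfolding proj_def
    by (simp add: a1 fs.lin_scale[OF fs.lin_funpow[OF lin_Eop]] fs.lin_0[OF fs.lin_funpow[OF lin_Eop]])
qed

text \<open>The construction of \<open>vec p\<close> has moved the cell \<open>(q, r)\<close> to row
  \<open>p\<close>, so nothing is left to annihilate.\<close>

lemma last_proj_vec:
  assumes p: "p \<in> preds" shows "last_proj (vec p) = (0 :: 'k::field_char_0 fock)"
proof -
  obtain a1 :: 'k where a1: "a1 \<noteq> 0" "vec p = fscale a1 (delta (moved p))" using vec_eq[OF p] by blast
  have "(q, r) \<notin> moved p" using q_in_K[OF p] p by (auto simp: mem_moved preds_iff)
  then show ?thesis unfolding last_proj_def
    by (simp add: a1 fs.lin_scale[OF lin_ann] ann_delta fs.lin_0[OF fs.lin_funpow[OF lin_Eop]])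
qed

lemma last_proj_delta:
  "\<exists>c::'k::field_char_0. c \<noteq> 0 \<and> last_proj (delta (cells w)) = fscale c (delta (cells u))"
proof -
  have qr: "(q, r) \<in> cells w" using r wq by (simp add: mem_cells)
  let ?S = "cells w - {(q, r)}"
  have neq: "w i = w q \<longleftrightarrow> i = q" "w i = w r \<longleftrightarrow> i = r" for i
    using perm_eq_iff[OF w] by auto
  have I: "B = {i. i < L \<and> (q, i) \<in> ?S \<and> (r, i) \<notin> ?S}"
  proof -
    have "i \<in> B \<longleftrightarrow> i < L \<and> (q, i) \<in> ?S \<and> (r, i) \<notin> ?S" for i
      using r qL wq below[of i] neq[of i] unfolding B_def
      by (cases "i < r"; cases "i = r"; cases "i < q") (auto simp: mem_cells)
    then show ?thesis by blast
  qed
  obtain a :: 'k where a: "a \<noteq> 0" "(Eop L r q ^^ card B) (delta ?S) = fscale a (delta (relocate (Pair r) (Pair q) B ?S))"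
    using Eop_funpow(1)[OF _ I, where 'k = 'k] r by force
  have "(j, i) \<in> relocate (Pair r) (Pair q) B ?S \<longleftrightarrow> (j, i) \<in> cells u" for j i
  proof -
    have 1: "(j, i) \<in> relocate (Pair r) (Pair q) B ?S \<longleftrightarrow>
      j = r \<and> i \<in> B \<or> \<not> (j = q \<and> i \<in> B) \<and> (j, i) \<noteq> (q, r) \<and> 1 \<le> i \<and> i < j \<and> w j < w i"
      by (auto simp: relocate_def mem_cells)
    have v: "u x = (if x = r then w q else if x = q then w r else w x)" for x
      by (simp add: u_simps)
    show ?thesis unfolding 1 mem_cells v
      unfolding B_def mem_Collect_eq prod.inject
      by (rule last_proj_cells_arith[OF r(1,2) wq below above neq below above neq incr])
  qed
  then have "relocate (Pair r) (Pair q) B ?S = cells u" by auto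
  then have "last_proj (delta (cells w)) = fscale (csign (q, r) (cells w) * a) (delta (cells u))"
    unfolding last_proj_def
    by (simp add: ann_delta qr a fs.lin_scale[OF fs.lin_funpow[OF lin_Eop]])
  then show ?thesis using a(1) csign_neq_0 by (metis mult_eq_0_iff)
qed

lemma lin_proj: "fs.lin (proj p)" and lin_last_proj: "fs.lin last_proj"
  unfolding proj_def[abs_def] last_proj_def[abs_def]
  by (intro fs.lin_comp[OF fs.lin_funpow[OF lin_Eop]] fs.lin_funpow lin_Eop lin_ann)+

lemma Eop_funpow_commute:
  assumes "e \<in> row_ops L" "j < L" "k < L"
  shows "e ((Eop L j k ^^ n) x) = (Eop L j k ^^ n) (e x)"
proof -
  obtain a b where e: "e = eop L a b" "a \<le> b" "b < L" using assms(1) by (auto simp: row_ops_def)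
  show ?thesis unfolding e(1)
    by (rule fs.funpow_commute, rule eop_Eop) (use assms e in auto)
qed

lemma proj_commute:
  assumes "p \<in> preds" "e \<in> row_ops L" shows "proj p (e x) = e (proj p x)"
proof -
  have "p < L" using assms(1) r L by (auto simp: preds_iff)
  then show ?thesis using qL r L unfolding proj_def by (simp add: Eop_funpow_commute[OF assms(2)])
qed

text \<open>Passing \<open>e\<^sub>a\<^sub>b\<close> across the annihilator of row \<open>r\<close>
  leaves an annihilator of row \<open>b\<close> if a = r. For b = r this is the same operator again.
  For b > r it vanishes on the orbit: no inversion of \<open>w\<close> has its row after the last
  descent, and row operators never increase rows.\<close>

lemma last_proj_twist:
  assumes e: "e \<in> row_ops L" and x: "x \<in> gen_orbit L w"
  shows "\<exists>c. last_proj (e x) = e (last_proj x) + fscale c (last_proj x)"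
proof -
  obtain a b where ab: "e = eop L a b" "a \<le> b" "b < L" using e by (auto simp: row_ops_def)
  have "i \<le> r" if "(j, i) \<in> cells w" for j i
    using that incr[of i j] by (cases "r < i") (auto simp: mem_cells dest: less_asym)
  then have xs: "x \<in> supported (\<lambda>S. \<forall>(j, i)\<in>S. i \<le> r)" using gen_orbit_rows x by blast
  have ann: "ann (q, b) x = 0" if "r < b"
  proof
    fix S
    have "x (insert (q, b) S) = 0" using xs that unfolding supported_def by fastforce
    then show "ann (q, b) x S = 0 S" by (simp add: ann_def)
  qed
  have "\<exists>c. ann (q, r) (e x) = e (ann (q, r) x) + fscale c (ann (q, r) x)"
  proof (cases "a = r")
    case True
    let ?c = "if b = r then 1 else 0"
    have "(if a = r then ann (q, b) x else 0) = fscale ?c (ann (q, r) x)"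
      using ann ab True by (cases "b = r") auto
    then have "eop L a b (ann (q, r) x) = ann (q, r) (eop L a b x) - fscale ?c (ann (q, r) x)"
      using eop_ann[OF qL, of a b r x] by simp
    then show ?thesis unfolding ab(1) by (intro exI[of _ ?c]) simp
  next
    case False
    then show ?thesis unfolding ab(1) using eop_ann[OF qL, of a b r x]
      by (intro exI[of _ 0]) simp
  qed
  then obtain c where c: "ann (q, r) (e x) = e (ann (q, r) x) + fscale c (ann (q, r) x)" by blast
  have "last_proj (e x) = e (last_proj x) + fscale c (last_proj x)"
    unfolding last_proj_def c using r L qL
    by (simp add: Eop_funpow_commute[OF e] fs.lin_add[OF fs.lin_funpow[OF lin_Eop]]
      fs.lin_scale[OF fs.lin_funpow[OF lin_Eop]])
  then show ?thesis by blast
qed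

lemma vec_gen_orbit: "p \<in> preds \<Longrightarrow> vec p \<in> gen_orbit L w"
proof -
  assume "p \<in> preds"
  then have "1 \<le> p" "p \<le> r" "r < L" using r L by (auto simp: preds_iff)
  then have "eop L p r \<in> row_ops L" unfolding row_ops_def by blast
  then show ?thesis unfolding vec_def gen_orbit_def by (intro fs.orbit_closed_funpow fs.orbit_base)
qed

text \<open>The generator of the orbit of \<open>w\<close> comes last in the chain and is sent to
  that of \<open>u\<close>; the vectors \<open>vec p\<close> precede it with \<open>p\<close>
  increasing, the order in which \<open>proj_vec_eq_0\<close> gives triangularity.\<close>

lemma dim_transition:
  "fs.dim (gen_orbit L u :: 'k::field_char_0 fock set) +
   (\<Sum>p | cover u p r. fs.dim (gen_orbit L (u \<circ> Transposition.transpose p r) :: 'k fock set)) \<le>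
   fs.dim (gen_orbit L w :: 'k fock set)"
proof -
  define xs where "xs = sorted_list_of_set preds"
  have xs: "distinct xs" "set xs = preds" "sorted xs" using finite_preds by (simp_all add: xs_def)
  have mem: "xs ! i \<in> preds" if "i < length xs" for i using nth_mem[OF that] xs by simp
  define v :: "nat \<Rightarrow> 'k fock" where "v i = (if i < length xs then vec (xs ! i) else delta (cells w))" for i
  define f :: "nat \<Rightarrow> 'k fock \<Rightarrow> 'k fock" where "f i = (if i < length xs then proj (xs ! i) else last_proj)" for i
  obtain C :: "'k fock set" where C: "finite C" "gen_orbit L w \<subseteq> fs.span C"
    using gen_orbit_finite_span[OF cells_subset_box[OF w L]] by blast
  let ?d = "\<lambda>i. fs.dim (fs.orbit (row_ops L) (f i (v i)))"
  have "(\<Sum>i<Suc (length xs). ?d i) \<le> fs.dim (gen_orbit L w :: 'k fock set)"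
  proof (rule fs.orbit_chain(1)[where k = "Suc (length xs)" and v = v and f = f and A = "row_ops L" and M = "gen_orbit L w" and B = C])
    show "gen_orbit L w \<subseteq> fs.span C" "finite C" by (rule C)+
    show "fs.subspace (gen_orbit L w :: 'k fock set)" unfolding gen_orbit_def by (rule fs.subspace_orbit)
    show "fs.lin e" if "e \<in> row_ops L" for e :: "'k fock \<Rightarrow> 'k fock" by (rule lin_row_ops[OF that])
    show "e x \<in> gen_orbit L w" if "e \<in> row_ops L" "x \<in> gen_orbit L w" for e and x :: "'k fock"
      using that unfolding gen_orbit_def by (rule fs.orbit_closed)
  next
    fix i assume i: "i < Suc (length xs)"
    show "v i \<in> gen_orbit L w"
      using vec_gen_orbit mem fs.orbit_base unfolding v_def gen_orbit_def by auto
    show "fs.lin (f i)" by (simp add: f_def lin_proj lin_last_proj)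
    show "\<exists>c. f i (e x) = e (f i x) + fscale c (f i x)"
      if "e \<in> row_ops L" "x \<in> gen_orbit L w" for e and x :: "'k fock"
    proof (cases "i < length xs")
      case True
      then show ?thesis using proj_commute[OF mem that(1)] by (intro exI[of _ 0]) (simp add: f_def)
    next
      case False
      then show ?thesis using last_proj_twist[OF that] by (simp add: f_def)
    qed
    fix j assume j: "j < i"
    show "f i (v j) = 0"
    proof (cases "i < length xs")
      case True
      then have "xs ! j < xs ! i" using j xs sorted_nth_mono[of xs j i] nth_eq_iff_index_eq[of xs i j] by auto
      then show ?thesis using True j proj_vec_eq_0[OF mem mem, of i j, where 'k = 'k] by (simp add: f_def v_def)
    next
      case False
      then have jl: "j < length xs" using i j by simp
      then show ?thesis using False last_proj_vec[OF mem[OF jl], where 'k = 'k] by (simp add: f_def v_def)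
    qed
  qed
  moreover have "(\<Sum>i<length xs. ?d i) = (\<Sum>p\<in>preds. fs.dim (gen_orbit L (u \<circ> Transposition.transpose p r) :: 'k fock set))"
  proof -
    have "?d i = fs.dim (gen_orbit L (u \<circ> Transposition.transpose (xs ! i) r) :: 'k fock set)" if "i < length xs" for i
      using proj_vec[OF mem[OF that], where 'k = 'k] that by (auto simp: f_def v_def gen_orbit_def fs.orbit_scale)
    then have "(\<Sum>i<length xs. ?d i) = (\<Sum>i<length xs. fs.dim (gen_orbit L (u \<circ> Transposition.transpose (xs ! i) r) :: 'k fock set))"
      by (intro sum.cong) auto
    also have "\<dots> = (\<Sum>p\<in>set xs. fs.dim (gen_orbit L (u \<circ> Transposition.transpose p r) :: 'k fock set))"
      using xs(1) by (simp add: sum.distinct_set_conv_list sum_list_sum_nth atLeast0LessThan)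
    finally show ?thesis using xs by simp
  qed
  moreover have "?d (length xs) = fs.dim (gen_orbit L u :: 'k fock set)"
    using last_proj_delta[where 'k = 'k] by (auto simp: f_def v_def gen_orbit_def fs.orbit_scale)
  ultimately show ?thesis by (simp add: preds_def)
qed

end

subsection \<open>Dimensions of orbits are Schubert numbers\<close>

lemma orbit_delta_empty:
  assumes "cells w = {}"
  shows "gen_orbit L w = fs.span {delta {} :: 'k::field_char_0 fock}"
proof
  have "eop L a b (delta {}) = (0 :: 'k fock)" for a b
    by (simp add: eop_def ann_delta)
  then have z: "e (delta {}) = (0 :: 'k fock)" if "e \<in> row_ops L" for e
    using that by (auto simp: row_ops_def)
  show "gen_orbit L w \<subseteq> fs.span {delta {} :: 'k fock}"
    unfolding gen_orbit_def assms
  proof (rule fs.orbit_subset[OF fs.subspace_span])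
    fix e :: "'k fock \<Rightarrow> 'k fock" and x assume e: "e \<in> row_ops L" "x \<in> fs.span {delta {} :: 'k fock}"
    show "e x \<in> fs.span {delta {}}"
      by (rule fs.span_Union_closed[OF _ lin_row_ops[OF e(1)] e(2)]) (use z[OF e(1)] fs.span_zero in auto)
  qed (simp add: fs.span_base)
  show "fs.span {delta {} :: 'k fock} \<subseteq> gen_orbit L w"
    unfolding gen_orbit_def assms using fs.orbit_base
    by (intro fs.span_minimal fs.subspace_orbit) auto
qed

lemma dim_orbit_empty:
  assumes "cells w = {}"
  shows "fs.dim (gen_orbit L w :: 'k::field_char_0 fock set) = 1"
proof -
  have "delta {} {} \<noteq> (0 :: 'k)" by (simp add: delta_def)
  then have "delta {} \<noteq> (0 :: 'k fock)" by (metis zero_fun_apply)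
  then have "fs.independent {delta {} :: 'k fock}" by simp
  then show ?thesis unfolding orbit_delta_empty[OF assms]
    by (simp add: fs.dim_eq_card_independent)
qed

lemma schub_empty: "cells w = {} \<Longrightarrow> schub w = 1"
  by (simp add: schub_def)

lemma cells_nonempty_descent:
  assumes w: "w permutes {1..N}" and "cells w \<noteq> {}"
  shows "\<exists>i. 1 \<le> i \<and> Suc i \<le> N \<and> w (Suc i) < w i"
proof (rule ccontr)
  assume n: "\<not> ?thesis"
  have s: "w i < w (Suc i)" for i
  proof (cases "1 \<le> i \<and> Suc i \<le> N")
    case True
    then have "\<not> w (Suc i) < w i" using n by blast
    then show ?thesis using perm_eq_iff[OF w, of i "Suc i"] by auto
  next
    case False
    then show ?thesis
      using perm_0[OF w] perm_pos[OF w, of "Suc 0"] perm_large[OF w, of "Suc i"] perm_le[OF w, of i] perm_large[OF w, of i]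
      by (cases "i = 0"; cases "i \<le> N") auto
  qed
  have "w i < w j" if "i < j" for i j using lift_Suc_mono_less[of w i j] s that by blast
  moreover obtain j i where "(j, i) \<in> cells w" using assms(2) by auto
  ultimately show False unfolding mem_cells by (meson less_asym)
qed

lemma last_descent_exists:
  assumes w: "w permutes {1..N}" and "cells w \<noteq> {}" and L: "N < L"
  shows "\<exists>r q. last_descent w N L r q"
proof -
  let ?D = "{i. 1 \<le> i \<and> Suc i \<le> N \<and> w (Suc i) < w i}"
  have fin: "finite ?D" by (rule finite_subset[of _ "{..N}"]) auto
  define r where "r = Max ?D"
  have r: "r \<in> ?D" unfolding r_def using cells_nonempty_descent[OF assms(1,2)] by (intro Max_in fin) auto
  have up: "w i < w (Suc i)" if "r < i" for i
  proof (cases "Suc i \<le> N")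
    case True
    have "i \<notin> ?D" using Max_ge[OF fin, of i] that unfolding r_def by auto
    then have "\<not> w (Suc i) < w i" using True that r by auto
    then show ?thesis using perm_eq_iff[OF w, of i "Suc i"] by auto
  next
    case False
    then show ?thesis
      using perm_large[OF w, of "Suc i"] perm_le[OF w, of i] perm_large[OF w, of i] by (cases "i \<le> N") auto
  qed
  have incr: "w i < w j" if "r < i" "i < j" for i j
    using that(2)
  proof (induction j)
    case (Suc j)
    then show ?case using up[of j] that(1) by (cases "i = j") auto
  qed simp
  let ?Q = "{q. r < q \<and> q \<le> N \<and> w q < w r}"
  have finQ: "finite ?Q" by simp
  define q where "q = Max ?Q"
  have "Suc r \<in> ?Q" using r by simp
  then have q: "q \<in> ?Q" unfolding q_def by (intro Max_in finQ) auto
  have above: "w r < w i" if "q < i" for i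
  proof (cases "i \<le> N")
    case True
    have "i \<notin> ?Q"
    proof
      assume "i \<in> ?Q"
      from Max_ge[OF finQ this] show False using that unfolding q_def by simp
    qed
    then show ?thesis using that True q perm_eq_iff[OF w, of i r] by auto
  next
    case False
    then show ?thesis using perm_large[OF w, of i] perm_le[OF w, of r] r by simp
  qed
  have "last_descent w N L r q"
    using r q w L incr above by unfold_locales auto
  then show ?thesis by blast
qed

text \<open>Handles the terms \<open>u t\<^sub>p\<^sub>r\<close> of the transition formula, which
  are as long as \<open>w\<close>: they agree with \<open>w\<close> before \<open>p\<close> and have
  the larger value \<open>w q\<close> at \<open>p\<close>. Among the finitely many permutations of
  {1..N} this cannot go on.\<close>

definition lex_greater :: "nat \<Rightarrow> ((nat \<Rightarrow> nat) \<times> (nat \<Rightarrow> nat)) set" where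
  "lex_greater N = {(x, y). x permutes {1..N} \<and> y permutes {1..N} \<and> (\<exists>p. (\<forall>i<p. x i = y i) \<and> y p < x p)}"

lemma wf_lex_greater: "wf (lex_greater N)"
proof (rule finite_acyclic_wf)
  have "lex_greater N \<subseteq> {w. w permutes {1..N}} \<times> {w. w permutes {1..N}}" by (auto simp: lex_greater_def)
  then show "finite (lex_greater N)" by (rule finite_subset) (simp add: finite_permutations)
  have "trans (lex_greater N)"
  proof (rule transI)
    fix x y z assume "(x, y) \<in> lex_greater N" "(y, z) \<in> lex_greater N"
    then obtain p p' where p: "x permutes {1..N}" "z permutes {1..N}"
      "\<forall>i<p. x i = y i" "y p < x p" "\<forall>i<p'. y i = z i" "z p' < y p'" by (auto simp: lex_greater_def)
    have "(\<forall>i<min p p'. x i = z i) \<and> z (min p p') < x (min p p')"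
      using p by (cases p p' rule: linorder_cases) auto
    then show "(x, z) \<in> lex_greater N" using p(1,2) unfolding lex_greater_def by blast
  qed
  moreover have "irrefl (lex_greater N)" by (auto simp: lex_greater_def irrefl_def)
  ultimately show "acyclic (lex_greater N)" by (simp add: acyclic_irrefl)
qed

text \<open>Numbers and dimensions satisfy the same recursion, the former with equality and the
  latter with an inequality. The outer induction on the length covers \<open>u\<close>, the inner
  one along \<open>lex_greater\<close> the terms of the same length as \<open>w\<close>.\<close>

lemma schub_le_dim:
  assumes "w permutes {1..N}" "N < L"
  shows "schub w \<le> real (fs.dim (gen_orbit L w :: 'k::field_char_0 fock set))"
  using assms(1)
proof (induction "card (cells w)" arbitrary: w rule: less_induct)
  case outer: less
  show ?case
    using outer.prems outer.hyps
  proof (induction w rule: wf_induct_rule[OF wf_lex_greater[of N]])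
    case (1 w)
    note w = 1(2) and smaller = 1(3)
    show ?case
    proof (cases "cells w = {}")
      case True
      then show ?thesis by (simp add: dim_orbit_empty schub_empty)
    next
      case False
      obtain r q where "last_descent w N L r q" using last_descent_exists[OF w False assms(2)] by blast
      then interpret last_descent w N L r q .
      have c: "cover u r q" by (simp add: cover_u_iff)
      have card: "card (cells w) = Suc (card (cells u))"
        using card_cells_cover[OF u_permutes c] by (simp add: w_u[symmetric])
      have "schub u \<le> real (fs.dim (gen_orbit L u :: 'k fock set))"
        using smaller[OF _ u_permutes] card by simp
      moreover have "schub (u \<circ> Transposition.transpose p r) \<le>
          real (fs.dim (gen_orbit L (u \<circ> Transposition.transpose p r) :: 'k fock set))" if p: "p \<in> preds" for p
      proof (rule 1(1))
        have cp: "cover u p r" using p by (simp add: preds_def)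
        have pr: "1 \<le> p" "p < r" "w p < w q" using p by (auto simp: preds_iff)
        show perm: "u \<circ> Transposition.transpose p r permutes {1..N}"
          by (rule permutes_transpose_right[OF u_permutes]) (use pr r in auto)
        have "(u \<circ> Transposition.transpose p r) i = w i" if "i < p" for i
          using that pr r by (simp add: Transposition.transpose_def u_simps)
        moreover have "(u \<circ> Transposition.transpose p r) p = w q" by (simp add: u_simps)
        ultimately show "(u \<circ> Transposition.transpose p r, w) \<in> lex_greater N"
          unfolding lex_greater_def mem_Collect_eq prod.case using w perm pr(3)
          by (intro conjI exI[of _ p]) auto
        have "card (cells (u \<circ> Transposition.transpose p r)) = card (cells w)"
          using card card_cells_cover[OF u_permutes cp] by simp
        then show "schub x \<le> real (fs.dim (gen_orbit L x :: 'k fock set))"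
          if "card (cells x) < card (cells (u \<circ> Transposition.transpose p r))" "x permutes {1..N}" for x
          using smaller[OF _ that(2)] that(1) by simp
      qed
      then have "(\<Sum>p\<in>preds. schub (u \<circ> Transposition.transpose p r)) \<le>
        (\<Sum>p\<in>preds. real (fs.dim (gen_orbit L (u \<circ> Transposition.transpose p r) :: 'k fock set)))"
        by (intro sum_mono)
      moreover have "schub w = schub u + (\<Sum>p\<in>preds. schub (u \<circ> Transposition.transpose p r))"
        using schub_transition[OF u_permutes r(1) cover_u_iff] by (simp add: w_u[symmetric] preds_def)
      moreover have "real (fs.dim (gen_orbit L u :: 'k fock set)) +
        (\<Sum>p\<in>preds. real (fs.dim (gen_orbit L (u \<circ> Transposition.transpose p r) :: 'k fock set))) \<le>
        real (fs.dim (gen_orbit L w :: 'k fock set))"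
        using dim_transition[where 'k = 'k] unfolding preds_def
        by (simp only: of_nat_sum[symmetric] of_nat_add[symmetric] of_nat_le_iff)
      ultimately show ?thesis by linarith
    qed
  qed
qed

text \<open>\<open>w\<close> is itself a cover of a shorter \<open>u\<close>. By
  \<open>sum_dim_covers_le\<close>, induction and Monk's formula, the dimensions of all covers of
  \<open>u\<close> add up to at most the sum of their Schubert numbers, while each is at least its
  own number. So none can be larger.\<close>

lemma dim_eq_schub:
  assumes "w permutes {1..N}" "Suc N < L"
  shows "real (fs.dim (gen_orbit L w :: 'k::field_char_0 fock set)) = schub w"
  using assms(1)
proof (induction "card (cells w)" arbitrary: w rule: less_induct)
  case less
  note w = less.prems
  show ?case
  proof (cases "cells w = {}")
    case True
    then show ?thesis by (simp add: dim_orbit_empty schub_empty)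
  next
    case False
    obtain r where r: "1 \<le> r" "Suc r \<le> N" "w (Suc r) < w r"
      using cells_nonempty_descent[OF w False] by blast
    define u where "u = w \<circ> Transposition.transpose r (Suc r)"
    have u: "u permutes {1..N}" unfolding u_def
      by (rule permutes_transpose_right[OF w]) (use r in auto)
    have wu: "w = u \<circ> Transposition.transpose r (Suc r)" by (simp add: u_def comp_assoc)
    have c: "cover u r (Suc r)" using r by (auto simp: cover_def u_def)
    have mem: "(r, Suc r) \<in> covers r u" using c by (simp add: covers_def)
    let ?d = "\<lambda>(p, q). real (fs.dim (gen_orbit L (u \<circ> Transposition.transpose p q) :: 'k fock set))"
    let ?s = "\<lambda>(p, q). schub (u \<circ> Transposition.transpose p q)"
    have le: "?s x \<le> ?d x" if "x \<in> covers r u" for x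
    proof -
      obtain p q where x: "x = (p, q)" by fastforce
      \<comment> \<open>A cover may leave {1..N} by one position, so the lower bound is invoked for
        N + 1.\<close>
      have "q \<le> Suc N" using covers_bound[OF u, of p q r] that r x by simp
      then have "u \<circ> Transposition.transpose p q permutes {1..Suc N}"
        using that unfolding x by (intro permutes_transpose_right[OF u]) (auto simp: covers_def cover_def)
      then show ?thesis using schub_le_dim assms(2) unfolding x by auto
    qed
    have "card (cells u) < card (cells w)"
      using card_cells_cover[OF u c] by (simp add: wu[symmetric])
    then have du: "real (fs.dim (gen_orbit L u :: 'k fock set)) = schub u" using less.hyps u by blast
    have "real (\<Sum>(p, q)\<in>covers r u. fs.dim (gen_orbit L (u \<circ> Transposition.transpose p q) :: 'k fock set)) \<le>
      real (r * fs.dim (gen_orbit L u :: 'k fock set))"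
      using sum_dim_covers_le[OF u assms(2), of r, where 'k = 'k] r by (simp only: of_nat_le_iff)
    then have sum_le: "sum ?d (covers r u) \<le> sum ?s (covers r u)"
      using du schub_monk[OF u, of r] by (simp add: case_prod_unfold)
    have "?d (r, Suc r) \<le> ?s (r, Suc r)"
    proof (rule ccontr)
      assume "\<not> ?d (r, Suc r) \<le> ?s (r, Suc r)"
      then have "sum ?s (covers r u) < sum ?d (covers r u)"
        using le mem finite_covers[OF u] by (intro sum_strict_mono_ex1) force+
      then show False using sum_le by simp
    qed
    then show ?thesis using le[OF mem] by (simp add: wu[symmetric])
  qed
qed

text \<open>The reverse of the count in \<open>orbit_chain\<close>: Monk's formula turns \<nu> times
  the exact dimension for \<open>w\<close> into a sum of Schubert numbers, each bounded by the
  dimension of its cover.\<close>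

lemma dim_tensor_space_le:
  assumes w: "w permutes {1..N}" and L: "Suc N < L" and "\<nu> \<le> N"
  shows "fs.dim (tensor_space L \<nu> w :: 'k::field_char_0 fock set) \<le>
    (\<Sum>(p, q)\<in>covers \<nu> w. fs.dim (gen_orbit L (w \<circ> Transposition.transpose p q) :: 'k fock set))"
proof -
  obtain B where B: "finite B" "(tensor_space L \<nu> w :: 'k fock set) \<subseteq> fs.span B"
    "card B \<le> \<nu> * fs.dim (gen_orbit L w :: 'k fock set)"
    using tensor_space_finite_span[OF assms] by blast
  have "fs.dim (tensor_space L \<nu> w :: 'k fock set) \<le> card B" using B by (intro fs.dim_le_card)
  with B(3) have "real (fs.dim (tensor_space L \<nu> w :: 'k fock set)) \<le> real (\<nu> * fs.dim (gen_orbit L w :: 'k fock set))"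
    by (simp only: of_nat_le_iff)
  also have "\<dots> = (\<Sum>(p, q)\<in>covers \<nu> w. schub (w \<circ> Transposition.transpose p q))"
    using schub_monk[OF w, of \<nu>] dim_eq_schub[OF w L, where 'k = 'k] by simp
  also have "\<dots> \<le> (\<Sum>(p, q)\<in>covers \<nu> w. real (fs.dim (gen_orbit L (w \<circ> Transposition.transpose p q) :: 'k fock set)))"
  proof (intro sum_mono)
    fix x assume "x \<in> covers \<nu> w"
    then obtain p q where x: "x = (p, q)" "(p, q) \<in> covers \<nu> w" by (cases x) auto
    have "q \<le> Suc N" using covers_bound[OF w x(2)] assms(3) by simp
    then have "w \<circ> Transposition.transpose p q permutes {1..Suc N}"
      using x(2) by (intro permutes_transpose_right[OF w]) (auto simp: covers_def cover_def)
    then show "(case x of (p, q) \<Rightarrow> schub (w \<circ> Transposition.transpose p q)) \<le>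
      (case x of (p, q) \<Rightarrow> real (fs.dim (gen_orbit L (w \<circ> Transposition.transpose p q) :: 'k fock set)))"
      using schub_le_dim[of _ "Suc N" L, where 'k = 'k] L unfolding x by auto
  qed
  also have "\<dots> = real (\<Sum>(p, q)\<in>covers \<nu> w. fs.dim (gen_orbit L (w \<circ> Transposition.transpose p q) :: 'k fock set))"
    by (simp add: case_prod_unfold)
  finally show ?thesis by (simp only: of_nat_le_iff)
qed

section \<open>Realizing modules in the Fock space\<close>

text \<open>Matrix entries are indexed from 0, the rows of cells from 1.\<close>

definition rho :: "nat \<Rightarrow> nat \<Rightarrow> 'k::field mat \<Rightarrow> 'k fock \<Rightarrow> 'k fock" where
  "rho L n X f = (\<Sum>a<n. \<Sum>b<n. fscale (X $$ (a, b)) (eop L (Suc a) (Suc b) f))"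

lemma (in lin_space) lin_scaled: "lin h \<Longrightarrow> lin (\<lambda>x. scale c (h x))"
  by (simp add: lin_def scale_right_distrib scale_left_commute)

lemma lin_rho: "fs.lin (rho L n X)"
  unfolding rho_def[abs_def] by (intro fs.lin_sum fs.lin_scaled lin_eop)

lemma fscale_apply: "fscale c f S = c * f S"
  by (simp add: fscale_def)

lemma rho_add:
  assumes "X \<in> carrier_mat n n" "Y \<in> carrier_mat n n"
  shows "rho L n (X + Y) f = rho L n X f + rho L n Y f"
  using assms unfolding rho_def sum.distrib[symmetric]
  by (intro sum.cong refl) (simp add: fs.scale_left_distrib)

lemma rho_smult:
  assumes "X \<in> carrier_mat n n"
  shows "rho L n (c \<cdot>\<^sub>m X) f = fscale c (rho L n X f)"
  using assms unfolding rho_def fs.scale_sum_right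
  by (intro sum.cong refl) simp

lemma sum_swap_pairs:
  "(\<Sum>a\<in>A. \<Sum>b\<in>B. \<Sum>c\<in>C. \<Sum>d\<in>D. h a b c d) = (\<Sum>c\<in>C. \<Sum>d\<in>D. \<Sum>a\<in>A. \<Sum>b\<in>B. h a b c d)"
proof -
  have "(\<Sum>a\<in>A. \<Sum>b\<in>B. \<Sum>c\<in>C. \<Sum>d\<in>D. h a b c d) = (\<Sum>a\<in>A. \<Sum>c\<in>C. \<Sum>b\<in>B. \<Sum>d\<in>D. h a b c d)"
    by (rule sum.cong[OF refl], rule sum.swap)
  also have "\<dots> = (\<Sum>c\<in>C. \<Sum>a\<in>A. \<Sum>b\<in>B. \<Sum>d\<in>D. h a b c d)" by (rule sum.swap)
  also have "\<dots> = (\<Sum>c\<in>C. \<Sum>a\<in>A. \<Sum>d\<in>D. \<Sum>b\<in>B. h a b c d)"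
    by (rule sum.cong[OF refl], rule sum.cong[OF refl], rule sum.swap)
  also have "\<dots> = (\<Sum>c\<in>C. \<Sum>d\<in>D. \<Sum>a\<in>A. \<Sum>b\<in>B. h a b c d)"
    by (rule sum.cong[OF refl], rule sum.swap)
  finally show ?thesis .
qed

text \<open>Bilinear expansion reduces the claim to \<open>eop_eop\<close>, whose two Kronecker
  deltas collapse the fourfold sums to entries of the two matrix products.\<close>

lemma rho_commutator:
  fixes X Y :: "'k::field mat"
  assumes X: "X \<in> carrier_mat n n" and Y: "Y \<in> carrier_mat n n"
  shows "rho L n (X * Y - Y * X) f = rho L n X (rho L n Y f) - rho L n Y (rho L n X f)"
proof
  fix S
  let ?e = "\<lambda>a b. eop L (Suc a) (Suc b) f S"
  let ?ee = "\<lambda>a b c d. eop L (Suc a) (Suc b) (eop L (Suc c) (Suc d) f) S"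
  have rr: "rho L n X (rho L n Y f) S = (\<Sum>a<n. \<Sum>b<n. \<Sum>c<n. \<Sum>d<n. X $$ (a, b) * Y $$ (c, d) * ?ee a b c d)"
    for X Y :: "'k mat"
    by (simp add: rho_def fs.lin_map_sum[OF lin_eop] fs.lin_scale[OF lin_eop] sum_eval fscale_apply
        sum_distrib_left mult.assoc)
  have "(\<Sum>a<n. \<Sum>b<n. \<Sum>c<n. \<Sum>d<n. Y $$ (a, b) * X $$ (c, d) * ?ee a b c d) =
      (\<Sum>a<n. \<Sum>b<n. \<Sum>c<n. \<Sum>d<n. X $$ (a, b) * Y $$ (c, d) * ?ee c d a b)"
    by (subst sum_swap_pairs) (simp only: mult.commute)
  then have "rho L n X (rho L n Y f) S - rho L n Y (rho L n X f) S =
    (\<Sum>a<n. \<Sum>b<n. \<Sum>c<n. \<Sum>d<n. X $$ (a, b) * Y $$ (c, d) * (?ee a b c d - ?ee c d a b))"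
    unfolding rr by (simp only: sum_subtractf[symmetric] right_diff_distrib)
  also have "\<dots> = (\<Sum>a<n. \<Sum>b<n. \<Sum>c<n. \<Sum>d<n. (if c = b then X $$ (a, b) * Y $$ (c, d) * ?e a d else 0)
       - (if d = a then X $$ (a, b) * Y $$ (c, d) * ?e c b else 0))"
  proof (intro sum.cong refl)
    fix a b c d
    have "?ee a b c d - ?ee c d a b = (if c = b then ?e a d else 0) - (if d = a then ?e c b else 0)"
      using fun_cong[OF eop_eop[of L "Suc a" "Suc b" "Suc c" "Suc d" f], of S]
      by (cases "c = b"; cases "d = a") auto
    then show "X $$ (a, b) * Y $$ (c, d) * (?ee a b c d - ?ee c d a b) =
      (if c = b then X $$ (a, b) * Y $$ (c, d) * ?e a d else 0) - (if d = a then X $$ (a, b) * Y $$ (c, d) * ?e c b else 0)"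
      by (simp add: right_diff_distrib)
  qed
  also have "\<dots> = (\<Sum>a<n. \<Sum>b<n. (\<Sum>d<n. X $$ (a, b) * Y $$ (b, d) * ?e a d) - (\<Sum>c<n. X $$ (a, b) * Y $$ (c, a) * ?e c b))"
  proof (intro sum.cong refl)
    fix a b assume ab: "a \<in> {..<n}" "b \<in> {..<n}"
    have "(\<Sum>c<n. \<Sum>d<n. if c = b then X $$ (a, b) * Y $$ (c, d) * ?e a d else 0) = (\<Sum>d<n. X $$ (a, b) * Y $$ (b, d) * ?e a d)"
      using ab by (subst sum.swap) simp
    moreover have "(\<Sum>c<n. \<Sum>d<n. if d = a then X $$ (a, b) * Y $$ (c, d) * ?e c b else 0) = (\<Sum>c<n. X $$ (a, b) * Y $$ (c, a) * ?e c b)"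
      using ab by simp
    ultimately show "(\<Sum>c<n. \<Sum>d<n. (if c = b then X $$ (a, b) * Y $$ (c, d) * ?e a d else 0)
       - (if d = a then X $$ (a, b) * Y $$ (c, d) * ?e c b else 0)) =
       (\<Sum>d<n. X $$ (a, b) * Y $$ (b, d) * ?e a d) - (\<Sum>c<n. X $$ (a, b) * Y $$ (c, a) * ?e c b)"
      by (simp only: sum_subtractf)
  qed
  also have "\<dots> = (\<Sum>a<n. \<Sum>d<n. (\<Sum>b<n. X $$ (a, b) * Y $$ (b, d)) * ?e a d) - (\<Sum>c<n. \<Sum>b<n. (\<Sum>a<n. Y $$ (c, a) * X $$ (a, b)) * ?e c b)"
  proof -
    have "(\<Sum>a<n. \<Sum>b<n. \<Sum>d<n. X $$ (a, b) * Y $$ (b, d) * ?e a d) = (\<Sum>a<n. \<Sum>d<n. (\<Sum>b<n. X $$ (a, b) * Y $$ (b, d)) * ?e a d)"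
      unfolding sum_distrib_right by (rule sum.cong[OF refl], rule sum.swap)
    moreover have "(\<Sum>a<n. \<Sum>b<n. \<Sum>c<n. X $$ (a, b) * Y $$ (c, a) * ?e c b) = (\<Sum>c<n. \<Sum>b<n. (\<Sum>a<n. Y $$ (c, a) * X $$ (a, b)) * ?e c b)"
    proof -
      have "(\<Sum>a<n. \<Sum>b<n. \<Sum>c<n. X $$ (a, b) * Y $$ (c, a) * ?e c b) = (\<Sum>a<n. \<Sum>c<n. \<Sum>b<n. X $$ (a, b) * Y $$ (c, a) * ?e c b)"
        by (rule sum.cong[OF refl], rule sum.swap)
      also have "\<dots> = (\<Sum>c<n. \<Sum>a<n. \<Sum>b<n. X $$ (a, b) * Y $$ (c, a) * ?e c b)" by (rule sum.swap)
      also have "\<dots> = (\<Sum>c<n. \<Sum>b<n. \<Sum>a<n. X $$ (a, b) * Y $$ (c, a) * ?e c b)"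
        by (rule sum.cong[OF refl], rule sum.swap)
      finally show ?thesis unfolding sum_distrib_right by (simp only: mult.commute[of "X $$ _"])
    qed
    ultimately show ?thesis by (simp only: sum_subtractf)
  qed
  also have "\<dots> = rho L n (X * Y - Y * X) f S"
    using X Y unfolding rho_def sum_eval fscale_apply sum_subtractf[symmetric]
    by (intro sum.cong refl) (auto simp: scalar_prod_def atLeast0LessThan algebra_simps)
  finally show "rho L n (X * Y - Y * X) f S = (rho L n X (rho L n Y f) - rho L n Y (rho L n X f)) S"
    by simp
qed

section \<open>Closure properties of upper triangular matrices\<close>

lemma borel_carrier: "X \<in> borel_alg n \<Longrightarrow> X \<in> carrier_mat n n"
  by (simp add: borel_alg_def)

lemma borel_add: "X \<in> borel_alg n \<Longrightarrow> Y \<in> borel_alg n \<Longrightarrow> X + Y \<in> borel_alg n"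
  by (auto simp: borel_alg_def upper_triangular_def)

lemma borel_smult: "X \<in> borel_alg n \<Longrightarrow> c \<cdot>\<^sub>m X \<in> borel_alg n"
  by (auto simp: borel_alg_def upper_triangular_def)

lemma borel_mult:
  assumes "X \<in> borel_alg n" "Y \<in> borel_alg n" shows "X * Y \<in> borel_alg n"
proof -
  have "(X * Y) $$ (i, j) = 0" if "i < n" "j < i" for i j
  proof -
    have "X $$ (i, k) * Y $$ (k, j) = 0" if "k < n" for k
      using assms \<open>i < n\<close> \<open>j < i\<close> that by (cases "k < i") (auto simp: borel_alg_def upper_triangular_def)
    then show ?thesis using assms that by (auto simp: borel_alg_def scalar_prod_def intro!: sum.neutral)
  qed
  then show ?thesis using assms by (auto simp: borel_alg_def upper_triangular_def)
qed

lemma borel_diff: "X \<in> borel_alg n \<Longrightarrow> Y \<in> borel_alg n \<Longrightarrow> X - Y \<in> borel_alg n"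
  by (auto simp: borel_alg_def upper_triangular_def)

lemma borel_commutator:
  assumes "X \<in> borel_alg n" "Y \<in> borel_alg n" shows "X * Y - Y * X \<in> borel_alg n"
  using borel_diff[OF borel_mult[OF assms] borel_mult[OF assms(2,1)]] .

text \<open>The last clause stands in for the existence of negatives, as \<open>M\<close> is not known to be a module.\<close>

definition lifts :: "nat \<Rightarrow> nat \<Rightarrow> ('k::field, 'v) brep \<Rightarrow> ('v \<Rightarrow> 'k fock) \<Rightarrow> bool" where
  "lifts n L M g \<longleftrightarrow> \<zero>\<^bsub>M\<^esub> \<in> carrier M \<and> g \<zero>\<^bsub>M\<^esub> = 0 \<and>
    (\<forall>x\<in>carrier M. \<forall>y\<in>carrier M. x \<oplus>\<^bsub>M\<^esub> y \<in> carrier M \<and> g (x \<oplus>\<^bsub>M\<^esub> y) = g x + g y) \<and>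
    (\<forall>c. \<forall>x\<in>carrier M. c \<odot>\<^bsub>M\<^esub> x \<in> carrier M \<and> g (c \<odot>\<^bsub>M\<^esub> x) = fscale c (g x)) \<and>
    (\<forall>X\<in>borel_alg n. \<forall>x\<in>carrier M. act M X x \<in> carrier M \<and> g (act M X x) = rho L n X (g x)) \<and>
    (\<forall>x\<in>carrier M. \<forall>y\<in>carrier M. \<exists>h\<in>carrier M. h \<oplus>\<^bsub>M\<^esub> y = x)"

text \<open>Identifies \<open>M\<close> with a subspace of the Fock space stable under upper
  triangular matrices. The axioms of a module and of a representation are then inherited from there
  instead of being verified in nested quotients.\<close>

definition realizes :: "nat \<Rightarrow> nat \<Rightarrow> ('k::field, 'v) brep \<Rightarrow> ('v \<Rightarrow> 'k fock) \<Rightarrow> bool" where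
  "realizes n L M f \<longleftrightarrow> lifts n L M f \<and> inj_on f (carrier M)"

context
  fixes n L :: nat and M :: "('k::field, 'v) brep" and g :: "'v \<Rightarrow> 'k fock"
  assumes l: "lifts n L M g"
begin

lemma lifts_zero: "\<zero>\<^bsub>M\<^esub> \<in> carrier M" "g \<zero>\<^bsub>M\<^esub> = 0"
  and lifts_add: "x \<in> carrier M \<Longrightarrow> y \<in> carrier M \<Longrightarrow> x \<oplus>\<^bsub>M\<^esub> y \<in> carrier M"
    "x \<in> carrier M \<Longrightarrow> y \<in> carrier M \<Longrightarrow> g (x \<oplus>\<^bsub>M\<^esub> y) = g x + g y"
  and lifts_smult: "x \<in> carrier M \<Longrightarrow> c \<odot>\<^bsub>M\<^esub> x \<in> carrier M"
    "x \<in> carrier M \<Longrightarrow> g (c \<odot>\<^bsub>M\<^esub> x) = fscale c (g x)"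
  and lifts_act: "X \<in> borel_alg n \<Longrightarrow> x \<in> carrier M \<Longrightarrow> act M X x \<in> carrier M"
    "X \<in> borel_alg n \<Longrightarrow> x \<in> carrier M \<Longrightarrow> g (act M X x) = rho L n X (g x)"
  and lifts_diff: "x \<in> carrier M \<Longrightarrow> y \<in> carrier M \<Longrightarrow> \<exists>h\<in>carrier M. h \<oplus>\<^bsub>M\<^esub> y = x"
  using l unfolding lifts_def by blast+

lemma subspace_lifts_image: "fs.subspace (g ` carrier M)"
proof (rule fs.subspaceI)
  show "0 \<in> g ` carrier M" using lifts_zero by force
  show "x + y \<in> g ` carrier M" if "x \<in> g ` carrier M" "y \<in> g ` carrier M" for x y
    using that lifts_add by (auto simp: image_iff) metis
  show "fscale c x \<in> g ` carrier M" if "x \<in> g ` carrier M" for c x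
    using that lifts_smult by (auto simp: image_iff) metis
qed

end

section \<open>Structure inherited from the Fock space\<close>

context
  fixes n L :: nat and M :: "('k::field, 'v) brep" and f :: "'v \<Rightarrow> 'k fock"
  assumes r: "realizes n L M f"
begin

lemma realizes_lifts: "lifts n L M f" and realizes_inj: "inj_on f (carrier M)"
  using r by (auto simp: realizes_def)

lemmas realizes_simps = lifts_zero[OF realizes_lifts] lifts_add[OF realizes_lifts] lifts_smult[OF realizes_lifts]
  lifts_act[OF realizes_lifts]

lemma realizes_eqI: "x \<in> carrier M \<Longrightarrow> y \<in> carrier M \<Longrightarrow> f x = f y \<Longrightarrow> x = y"
  using realizes_inj by (auto dest: inj_onD)

lemma realizes_abelian_group: "abelian_group M"
proof (rule abelian_groupI)
  fix x assume x: "x \<in> carrier M"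
  show "\<exists>y\<in>carrier M. y \<oplus>\<^bsub>M\<^esub> x = \<zero>\<^bsub>M\<^esub>"
    using lifts_diff[OF realizes_lifts realizes_simps(1) x] .
qed (auto intro!: realizes_eqI simp: realizes_simps algebra_simps)

lemma realizes_module: "module class_ring M"
proof (rule moduleI)
  show "cring (class_ring :: 'k ring)" by (rule class_cring.cring_axioms)
  show "abelian_group M" by (rule realizes_abelian_group)
qed (auto intro!: realizes_eqI simp: realizes_simps fs.scale_left_distrib fs.scale_right_distrib)

lemma realizes_a_minus:
  assumes "x \<in> carrier M" "y \<in> carrier M"
  shows "x \<ominus>\<^bsub>M\<^esub> y \<in> carrier M" "f (x \<ominus>\<^bsub>M\<^esub> y) = f x - f y"
proof -
  interpret abelian_group M by (rule realizes_abelian_group)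
  show 1: "x \<ominus>\<^bsub>M\<^esub> y \<in> carrier M" using assms by simp
  have "f (x \<ominus>\<^bsub>M\<^esub> y) + f y = f x"
    using assms 1 by (simp add: realizes_simps(4)[symmetric] a_minus_def a_assoc l_neg)
  then show "f (x \<ominus>\<^bsub>M\<^esub> y) = f x - f y" by (simp add: eq_diff_eq)
qed

lemma realizes_b_module: "b_module n M"
  unfolding b_module_def
proof (intro conjI ballI allI)
  show "module class_ring M" by (rule realizes_module)
  fix X :: "'k mat" assume X: "X \<in> borel_alg n"
  show "act M X \<in> LinearCombinations.module_hom class_ring M M"
    using X unfolding LinearCombinations.module_hom_def
    by (auto intro!: realizes_eqI simp: realizes_simps fs.lin_add[OF lin_rho] fs.lin_scale[OF lin_rho])
  show "act M (c \<cdot>\<^sub>m X) v = c \<odot>\<^bsub>M\<^esub> act M X v" if "v \<in> carrier M" for c v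
    using X that borel_smult[OF X] by (intro realizes_eqI) (auto simp: realizes_simps rho_smult[OF borel_carrier[OF X]])
  fix Y :: "'k mat" and v assume Y: "Y \<in> borel_alg n" and v: "v \<in> carrier M"
  show "act M (X + Y) v = act M X v \<oplus>\<^bsub>M\<^esub> act M Y v"
    using X Y v borel_add[OF X Y]
    by (intro realizes_eqI) (auto simp: realizes_simps rho_add[OF borel_carrier[OF X] borel_carrier[OF Y]])
  show "act M (X * Y - Y * X) v = act M X (act M Y v) \<ominus>\<^bsub>M\<^esub> act M Y (act M X v)"
    using X Y v borel_commutator[OF X Y]
    by (intro realizes_eqI)
      (auto simp: realizes_simps realizes_a_minus rho_commutator[OF borel_carrier[OF X] borel_carrier[OF Y]])
qed

text \<open>Injectivity recovers \<open>N\<close> from its image, so all closure properties can be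
  checked on the image.\<close>

lemma realizes_restrict:
  assumes N: "N \<subseteq> carrier M" "fs.subspace (f ` N)"
    and closed: "\<And>X y. X \<in> borel_alg n \<Longrightarrow> y \<in> f ` N \<Longrightarrow> rho L n X y \<in> f ` N"
  shows "realizes n L (M\<lparr>carrier := N\<rparr>) f" and "b_submodule n N M"
proof -
  have mem: "x \<in> N" if "x \<in> carrier M" "f x \<in> f ` N" for x
    using that N(1) realizes_eqI by (metis image_iff subsetD)
  have z: "\<zero>\<^bsub>M\<^esub> \<in> N" using realizes_simps(1,2) fs.subspace_0[OF N(2)] by (intro mem) auto
  have a: "x \<oplus>\<^bsub>M\<^esub> y \<in> N" if "x \<in> N" "y \<in> N" for x y
  proof -
    have "x \<in> carrier M" "y \<in> carrier M" using that N(1) by auto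
    then show ?thesis using fs.subspace_add[OF N(2), of "f x" "f y"] that by (intro mem) (auto simp: realizes_simps)
  qed
  have s: "c \<odot>\<^bsub>M\<^esub> x \<in> N" if "x \<in> N" for c x
  proof -
    have "x \<in> carrier M" using that N(1) by auto
    then show ?thesis using fs.subspace_scale[OF N(2), of "f x"] that by (intro mem) (auto simp: realizes_simps)
  qed
  have t: "act M X x \<in> N" if "X \<in> borel_alg n" "x \<in> N" for X x
  proof -
    have "x \<in> carrier M" using that N(1) by auto
    then show ?thesis using closed[OF that(1), of "f x"] that by (intro mem) (auto simp: realizes_simps)
  qed
  have d: "\<exists>h\<in>N. h \<oplus>\<^bsub>M\<^esub> y = x" if "x \<in> N" "y \<in> N" for x y
  proof -
    have c: "x \<in> carrier M" "y \<in> carrier M" using that N(1) by auto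
    then obtain h where h: "h \<in> carrier M" "h \<oplus>\<^bsub>M\<^esub> y = x" using lifts_diff[OF realizes_lifts] by blast
    then have "f h = f x - f y" using realizes_simps(4)[OF h(1) c(2)] by simp
    then have "h \<in> N" using h(1) that fs.subspace_diff[OF N(2), of "f x" "f y"] by (intro mem) auto
    then show ?thesis using h by blast
  qed
  have "inj_on f N" using realizes_inj N(1) inj_on_subset by blast
  then show "realizes n L (M\<lparr>carrier := N\<rparr>) f"
    using z a s t d N(1) unfolding realizes_def lifts_def
    by (auto simp: realizes_simps subsetD[OF N(1)])
  show "b_submodule n N M"
    unfolding b_submodule_def submodule_def using realizes_module N(1) z a s t by auto
qed

end

lemma realizes_isomorphic:
  fixes M :: "('k::field, 'v) brep" and M' :: "('k, 'u) brep"
  assumes f: "realizes n L M f" and f': "realizes n L M' f'" and im: "f ` carrier M = f' ` carrier M'"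
  shows "b_isomorphic n M M'"
  unfolding b_isomorphic_def
proof (intro bexI conjI ballI)
  define h where "h = (\<lambda>x. inv_into (carrier M') f' (f x))"
  have h: "h x \<in> carrier M'" "f' (h x) = f x" if "x \<in> carrier M" for x
  proof -
    have "f x \<in> f' ` carrier M'" using that im by auto
    then show "h x \<in> carrier M'" "f' (h x) = f x" unfolding h_def by (auto intro: inv_into_into f_inv_into_f)
  qed
  note R = realizes_simps[OF f] and R' = realizes_simps[OF f'] and eq = realizes_eqI[OF f']
  show "h (act M X v) = act M' X (h v)" if "X \<in> borel_alg n" "v \<in> carrier M" for X v
    using that h R(7-)[OF that] by (intro eq) (auto simp: R R')
  show "h \<in> LinearCombinations.module_hom class_ring M M'"
    unfolding LinearCombinations.module_hom_def using h by (auto intro!: eq simp: R R')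
  show "bij_betw h (carrier M) (carrier M')"
  proof (rule bij_betw_imageI)
    show "inj_on h (carrier M)" using h realizes_eqI[OF f] by (metis inj_onI)
    have "y \<in> h ` carrier M" if "y \<in> carrier M'" for y
    proof -
      have "f' y \<in> f ` carrier M" unfolding im using that by blast
      then obtain x where x: "x \<in> carrier M" "f' y = f x" by blast
      then have "h x = y" using h[OF x(1)] that by (intro eq) auto
      then show ?thesis using x(1) by blast
    qed
    then show "h ` carrier M = carrier M'" using h(1) by blast
  qed
qed

text \<open>The cosets of the kernel of \<open>g\<close> are the fibres of \<open>g\<close>.\<close>

lemma quotient_realizes:
  fixes M :: "('k::field, 'v) brep"
  assumes l: "lifts n L M g"
  defines "I \<equiv> {x \<in> carrier M. g x = 0}" and "F \<equiv> \<lambda>C. g (SOME x. x \<in> C)"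
  shows "realizes n L (quot_rep M I) F" and "F ` carrier (quot_rep M I) = g ` carrier M"
    and "x \<in> carrier M \<Longrightarrow> F (I +>\<^bsub>M\<^esub> x) = g x"
proof -
  note R = lifts_zero[OF l] lifts_add[OF l] lifts_smult[OF l] lifts_act[OF l]
  define lv where "lv = (\<lambda>y. {z \<in> carrier M. g z = y})"
  have lv: "z \<in> lv y \<longleftrightarrow> z \<in> carrier M \<and> g z = y" for z y by (simp add: lv_def)
  have coset: "I +>\<^bsub>M\<^esub> x = lv (g x)" if x: "x \<in> carrier M" for x
  proof -
    have "y \<in> I +>\<^bsub>M\<^esub> x" if y: "y \<in> carrier M" "g y = g x" for y
    proof -
      obtain h where h: "h \<in> carrier M" "h \<oplus>\<^bsub>M\<^esub> x = y" using lifts_diff[OF l y(1) x] by blast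
      then have "g h = 0" using R(4)[OF h(1) x] y(2) by simp
      then show ?thesis using h unfolding a_r_coset_def' I_def by auto
    qed
    moreover have "y \<in> lv (g x)" if "y \<in> I +>\<^bsub>M\<^esub> x" for y
      using that x unfolding a_r_coset_def' I_def lv by (auto simp: R)
    ultimately show ?thesis unfolding lv_def by blast
  qed
  have Fl: "F (lv (g x)) = g x" if "x \<in> carrier M" for x
  proof -
    have "x \<in> lv (g x)" using that by (simp add: lv)
    then have "(SOME y. y \<in> lv (g x)) \<in> lv (g x)" by (rule someI)
    then show ?thesis by (simp add: F_def lv)
  qed
  show "x \<in> carrier M \<Longrightarrow> F (I +>\<^bsub>M\<^esub> x) = g x" by (simp add: coset Fl)
  have car: "carrier (quot_rep M I) = (\<lambda>x. lv (g x)) ` carrier M"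
    unfolding quot_rep_def A_RCOSETS_def' by (auto simp: coset)
  show im: "F ` carrier (quot_rep M I) = g ` carrier M"
    unfolding car image_image using Fl by (intro image_cong) auto
  have cm: "lv (g y) \<in> carrier (quot_rep M I)" if "y \<in> carrier M" for y
    unfolding car using that by (rule imageI)
  have zero: "\<zero>\<^bsub>quot_rep M I\<^esub> = lv (g \<zero>\<^bsub>M\<^esub>)" by (simp add: quot_rep_def I_def R lv_def)
  have add: "lv (g x) \<oplus>\<^bsub>quot_rep M I\<^esub> lv (g y) = lv (g (x \<oplus>\<^bsub>M\<^esub> y))"
    if x: "x \<in> carrier M" and y: "y \<in> carrier M" for x y
  proof -
    have "z \<in> lv (g x) <+>\<^bsub>M\<^esub> lv (g y)" if "z \<in> lv (g (x \<oplus>\<^bsub>M\<^esub> y))" for z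
    proof -
      have z: "z \<in> carrier M" "g z = g x + g y" using that R(4)[OF x y] by (auto simp: lv)
      obtain h where h: "h \<in> carrier M" "h \<oplus>\<^bsub>M\<^esub> y = z" using lifts_diff[OF l z(1) y] by blast
      then have "g h = g x" using R(4)[OF h(1) y] z(2) by simp
      then have "h \<in> lv (g x)" "y \<in> lv (g y)" using h y by (auto simp: lv)
      then show ?thesis using h(2) unfolding set_add_def' by blast
    qed
    moreover have "z \<in> lv (g (x \<oplus>\<^bsub>M\<^esub> y))" if "z \<in> lv (g x) <+>\<^bsub>M\<^esub> lv (g y)" for z
      using that x y unfolding set_add_def' by (auto simp: R lv)
    ultimately have "lv (g x) <+>\<^bsub>M\<^esub> lv (g y) = lv (g (x \<oplus>\<^bsub>M\<^esub> y))" by blast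
    then show ?thesis by (simp add: quot_rep_def)
  qed
  have smult: "c \<odot>\<^bsub>quot_rep M I\<^esub> lv (g x) = lv (g (c \<odot>\<^bsub>M\<^esub> x))" if x: "x \<in> carrier M" for c x
  proof -
    have "(\<Union>v\<in>lv (g x). I +>\<^bsub>M\<^esub> (c \<odot>\<^bsub>M\<^esub> v)) = (\<Union>v\<in>lv (g x). lv (g (c \<odot>\<^bsub>M\<^esub> x)))"
      using x by (intro SUP_cong refl) (auto simp: coset R lv)
    moreover have "x \<in> lv (g x)" using x by (simp add: lv)
    ultimately show ?thesis by (auto simp: quot_rep_def)
  qed
  have act: "act (quot_rep M I) X (lv (g x)) = lv (g (act M X x))" if x: "x \<in> carrier M" "X \<in> borel_alg n" for X x
  proof -
    have "(\<Union>v\<in>lv (g x). I +>\<^bsub>M\<^esub> act M X v) = (\<Union>v\<in>lv (g x). lv (g (act M X x)))"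
      using x by (intro SUP_cong refl) (auto simp: coset R lv)
    moreover have "x \<in> lv (g x)" using x by (simp add: lv)
    ultimately show ?thesis by (auto simp: quot_rep_def)
  qed
  have diff: "\<exists>h\<in>carrier M. lv (g h) \<oplus>\<^bsub>quot_rep M I\<^esub> lv (g y) = lv (g x)"
    if "x \<in> carrier M" "y \<in> carrier M" for x y
    using lifts_diff[OF l that] add that by blast
  have inj: "inj_on F (carrier (quot_rep M I))"
  proof (rule inj_onI)
    fix C D assume C: "C \<in> carrier (quot_rep M I)" and D: "D \<in> carrier (quot_rep M I)" and e: "F C = F D"
    obtain x where x: "x \<in> carrier M" "C = lv (g x)" using C unfolding car by blast
    obtain y where y: "y \<in> carrier M" "D = lv (g y)" using D unfolding car by blast
    show "C = D" using e unfolding x(2) y(2) Fl[OF x(1)] Fl[OF y(1)] by simp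
  qed
  show "realizes n L (quot_rep M I) F"
    unfolding realizes_def lifts_def
  proof (intro conjI inj ballI allI)
    show "\<zero>\<^bsub>quot_rep M I\<^esub> \<in> carrier (quot_rep M I)"
      unfolding zero car using R(1) by (rule imageI)
    show "F \<zero>\<^bsub>quot_rep M I\<^esub> = 0" unfolding zero using Fl[OF R(1)] R(2) by simp
    fix C assume "C \<in> carrier (quot_rep M I)"
    then obtain x where x: "x \<in> carrier M" "C = lv (g x)" unfolding car by blast
    show "c \<odot>\<^bsub>quot_rep M I\<^esub> C \<in> carrier (quot_rep M I)" for c
      unfolding x(2) smult[OF x(1)] by (rule cm[OF R(5)[OF x(1)]])
    show "F (c \<odot>\<^bsub>quot_rep M I\<^esub> C) = fscale c (F C)" for c
      unfolding x(2) smult[OF x(1)] Fl[OF R(5)[OF x(1)]] Fl[OF x(1)] by (rule R(6)[OF x(1)])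
    show "act (quot_rep M I) X C \<in> carrier (quot_rep M I)" "F (act (quot_rep M I) X C) = rho L n X (F C)"
      if X: "X \<in> borel_alg n" for X
      unfolding x(2) act[OF x(1) X] Fl[OF R(7)[OF X x(1)]] Fl[OF x(1)]
      by (rule cm[OF R(7)[OF X x(1)]], rule R(8)[OF X x(1)])
    fix D assume "D \<in> carrier (quot_rep M I)"
    then obtain y where y: "y \<in> carrier M" "D = lv (g y)" unfolding car by blast
    show "C \<oplus>\<^bsub>quot_rep M I\<^esub> D \<in> carrier (quot_rep M I)" "F (C \<oplus>\<^bsub>quot_rep M I\<^esub> D) = F C + F D"
      unfolding x(2) y(2) add[OF x(1) y(1)] Fl[OF R(3)[OF x(1) y(1)]] Fl[OF x(1)] Fl[OF y(1)]
      by (rule cm[OF R(3)[OF x(1) y(1)]], rule R(4)[OF x(1) y(1)])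
    show "\<exists>h\<in>carrier (quot_rep M I). h \<oplus>\<^bsub>quot_rep M I\<^esub> D = C"
      using diff[OF x(1) y(1)] unfolding x(2) y(2) car by blast
  qed
qed

subsection \<open>Quotients of free modules\<close>

abbreviation pscale :: "'k::field \<Rightarrow> ('x \<Rightarrow>\<^sub>0 'k) \<Rightarrow> 'x \<Rightarrow>\<^sub>0 'k" where
  "pscale c \<equiv> Poly_Mapping.map ((*) c)"

lemma lookup_pscale: "Poly_Mapping.lookup (pscale c p) x = c * Poly_Mapping.lookup p x"
  by (auto simp: Poly_Mapping.map.rep_eq when_def)

lemma pscale_single: "pscale c (Poly_Mapping.single x a) = Poly_Mapping.single x (c * a)"
  by (intro poly_mapping_eqI) (auto simp: lookup_pscale lookup_single when_def)

lemma keys_pscale: "Poly_Mapping.keys (pscale c p) \<subseteq> Poly_Mapping.keys p"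
  by (auto simp: in_keys_iff lookup_pscale)

text \<open>The linear extension of \<open>G\<close> from basis elements to the free module.\<close>

definition comb :: "('x \<Rightarrow> 'k::field fock) \<Rightarrow> ('x \<Rightarrow>\<^sub>0 'k) \<Rightarrow> 'k fock" where
  "comb G p = (\<Sum>x\<in>Poly_Mapping.keys p. fscale (Poly_Mapping.lookup p x) (G x))"

lemma comb_superset:
  assumes "finite A" "Poly_Mapping.keys p \<subseteq> A"
  shows "comb G p = (\<Sum>x\<in>A. fscale (Poly_Mapping.lookup p x) (G x))"
  unfolding comb_def using assms by (intro sum.mono_neutral_left) (auto simp: in_keys_iff)

lemma comb_0: "comb G 0 = 0"
  by (simp add: comb_def)

lemma comb_add: "comb G (p + q) = comb G p + comb G q"
proof -
  let ?A = "Poly_Mapping.keys p \<union> Poly_Mapping.keys q"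
  have "comb G (p + q) = (\<Sum>x\<in>?A. fscale (Poly_Mapping.lookup (p + q) x) (G x))"
    using Poly_Mapping.keys_add[of p q] by (intro comb_superset) auto
  also have "\<dots> = comb G p + comb G q"
    by (simp add: lookup_add fs.scale_left_distrib sum.distrib comb_superset[of ?A])
  finally show ?thesis .
qed

lemma comb_scale: "comb G (pscale c p) = fscale c (comb G p)"
  by (subst comb_superset[OF finite_keys keys_pscale[of c p]]) (simp add: comb_def fs.scale_sum_right lookup_pscale)

lemma comb_single: "comb G (Poly_Mapping.single x c) = fscale c (G x)"
  by (simp add: comb_superset[of "{x}"] lookup_single)

lemma comb_sum: "comb G (\<Sum>i\<in>X. p i) = (\<Sum>i\<in>X. comb G (p i))"
  by (induction X rule: infinite_finite_induct) (auto simp: comb_0 comb_add)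

lemma comb_diff: "comb G (p - q) = comb G p - comb G q"
  using comb_add[of G "p - q" q] by simp

lemma keys_sum_subset: "(\<And>i. i \<in> X \<Longrightarrow> Poly_Mapping.keys (p i) \<subseteq> S) \<Longrightarrow> Poly_Mapping.keys (\<Sum>i\<in>X. p i) \<subseteq> S"
proof (induction X rule: infinite_finite_induct)
  case (insert x X)
  then show ?case using Poly_Mapping.keys_add[of "p x" "sum p X"] by auto
qed auto

lemma keys_add_subset: "Poly_Mapping.keys p \<subseteq> S \<Longrightarrow> Poly_Mapping.keys q \<subseteq> S \<Longrightarrow> Poly_Mapping.keys (p + q) \<subseteq> S"
  using Poly_Mapping.keys_add[of p q] by auto

lemma keys_diff_subset: "Poly_Mapping.keys p \<subseteq> S \<Longrightarrow> Poly_Mapping.keys q \<subseteq> S \<Longrightarrow> Poly_Mapping.keys (p - q) \<subseteq> S"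
proof
  fix x assume "Poly_Mapping.keys p \<subseteq> S" "Poly_Mapping.keys q \<subseteq> S" and x: "x \<in> Poly_Mapping.keys (p - q)"
  then have "x \<notin> S \<Longrightarrow> Poly_Mapping.lookup p x = 0 \<and> Poly_Mapping.lookup q x = 0"
    by (auto simp: in_keys_iff)
  then show "x \<in> S" using x by (cases "x \<in> S") (auto simp: in_keys_iff lookup_minus)
qed

lemma keys_pscale_subset: "Poly_Mapping.keys p \<subseteq> S \<Longrightarrow> Poly_Mapping.keys (pscale c p) \<subseteq> S"
  by (rule subset_trans[OF keys_pscale])

lemma sum_single_lookup: "(\<Sum>x\<in>Poly_Mapping.keys p. Poly_Mapping.single x (Poly_Mapping.lookup p x)) = p"
  by (intro poly_mapping_eqI) (simp add: lookup_sum lookup_single when_def in_keys_iff)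

text \<open>Closure without reference to a carrier; \<open>free_rep_submodule_iff\<close> adds the
  carrier. The straightening arguments quantify over such sets.\<close>

definition psubspace :: "('x \<Rightarrow>\<^sub>0 'k::field) set \<Rightarrow> bool" where
  "psubspace T \<longleftrightarrow> 0 \<in> T \<and> (\<forall>p\<in>T. \<forall>q\<in>T. p + q \<in> T) \<and> (\<forall>c. \<forall>p\<in>T. pscale c p \<in> T)"

lemma psubspace_0: "psubspace T \<Longrightarrow> 0 \<in> T"
  and psubspace_add: "psubspace T \<Longrightarrow> p \<in> T \<Longrightarrow> q \<in> T \<Longrightarrow> p + q \<in> T"
  and psubspace_scale: "psubspace T \<Longrightarrow> p \<in> T \<Longrightarrow> pscale c p \<in> T"
  by (simp_all add: psubspace_def)

section \<open>Free modules, spans of relations and straightening\<close>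

lemma free_rep_simps:
  "carrier (free_rep J M) = {f. Poly_Mapping.keys f \<subseteq> (\<Pi>\<^sub>E j\<in>J. carrier (M j))}"
  "\<zero>\<^bsub>free_rep J M\<^esub> = 0" "f \<oplus>\<^bsub>free_rep J M\<^esub> g = f + g" "c \<odot>\<^bsub>free_rep J M\<^esub> f = pscale c f"
  by (simp_all add: free_rep_def)

lemma free_rep_module: "module class_ring (free_rep J M :: ('k::field, (nat \<Rightarrow> 'v) \<Rightarrow>\<^sub>0 'k) brep)"
proof (rule moduleI)
  show "cring (class_ring :: 'k ring)" by (rule class_cring.cring_axioms)
  show "abelian_group (free_rep J M :: ('k, (nat \<Rightarrow> 'v) \<Rightarrow>\<^sub>0 'k) brep)"
  proof (rule abelian_groupI)
    fix x :: "(nat \<Rightarrow> 'v) \<Rightarrow>\<^sub>0 'k" assume "x \<in> carrier (free_rep J M)"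
    then show "\<exists>y\<in>carrier (free_rep J M). y \<oplus>\<^bsub>free_rep J M\<^esub> x = \<zero>\<^bsub>free_rep J M\<^esub>"
      by (intro bexI[of _ "- x"]) (auto simp: free_rep_simps)
    show "x \<oplus>\<^bsub>free_rep J M\<^esub> y \<in> carrier (free_rep J M)"
      if "x \<in> carrier (free_rep J M)" "y \<in> carrier (free_rep J M)" for x y :: "(nat \<Rightarrow> 'v) \<Rightarrow>\<^sub>0 'k"
      using that by (simp add: free_rep_simps keys_add_subset)
  qed (simp_all add: free_rep_simps ac_simps)
  show "c \<odot>\<^bsub>free_rep J M\<^esub> x \<in> carrier (free_rep J M)" if "x \<in> carrier (free_rep J M)" for c :: 'k and x
    using that by (simp add: free_rep_simps keys_pscale_subset)
qed (auto simp: free_rep_simps lookup_pscale lookup_add algebra_simps intro!: poly_mapping_eqI)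

lemma free_rep_submodule_iff:
  "submodule class_ring N (free_rep J M) \<longleftrightarrow> N \<subseteq> carrier (free_rep J M) \<and> psubspace N"
  unfolding submodule_def psubspace_def using free_rep_module by (auto simp: free_rep_simps)

lemma free_rep_span:
  assumes "S \<subseteq> carrier (free_rep J M)"
  defines "N \<equiv> LinearCombinations.module.span class_ring (free_rep J M) S"
  shows "S \<subseteq> N" "N \<subseteq> carrier (free_rep J M)" "psubspace N"
    and "S \<subseteq> K \<Longrightarrow> K \<subseteq> carrier (free_rep J M) \<Longrightarrow> psubspace K \<Longrightarrow> N \<subseteq> K"
proof -
  interpret m: Module.module class_ring "free_rep J M" by (rule free_rep_module)
  show "S \<subseteq> N" unfolding N_def by (rule m.in_own_span[OF assms(1)])
  show "N \<subseteq> carrier (free_rep J M)" "psubspace N"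
    using m.span_is_submodule[OF assms(1)] unfolding N_def free_rep_submodule_iff by auto
  show "S \<subseteq> K \<Longrightarrow> K \<subseteq> carrier (free_rep J M) \<Longrightarrow> psubspace K \<Longrightarrow> N \<subseteq> K"
    unfolding N_def by (rule m.span_is_subset) (auto simp: free_rep_submodule_iff)
qed

text \<open>Equivariance is asked for on basis elements only. The free module need not be a
  representation and \<open>comb G\<close> need not be injective, hence \<open>lifts\<close>; both
  defects disappear in \<open>quotient_realizes\<close>.\<close>

lemma free_rep_lifts:
  fixes M :: "nat \<Rightarrow> ('k::field, 'v) brep"
  assumes "finite J"
    and act: "\<And>j X a. j \<in> J \<Longrightarrow> X \<in> borel_alg n \<Longrightarrow> a \<in> carrier (M j) \<Longrightarrow> act (M j) X a \<in> carrier (M j)"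
    and eqv: "\<And>X x. X \<in> borel_alg n \<Longrightarrow> x \<in> (\<Pi>\<^sub>E j\<in>J. carrier (M j)) \<Longrightarrow>
       (\<Sum>j\<in>J. G (x(j := act (M j) X (x j)))) = rho L n X (G x)"
  shows "lifts n L (free_rep J M) (comb G)"
  unfolding lifts_def
proof (intro conjI ballI allI)
  let ?P = "\<Pi>\<^sub>E j\<in>J. carrier (M j)"
  fix p assume p: "p \<in> carrier (free_rep J M)"
  then have kp: "Poly_Mapping.keys p \<subseteq> ?P" by (simp add: free_rep_simps)
  show "c \<odot>\<^bsub>free_rep J M\<^esub> p \<in> carrier (free_rep J M)" "comb G (c \<odot>\<^bsub>free_rep J M\<^esub> p) = fscale c (comb G p)" for c
    using kp by (simp_all add: free_rep_simps keys_pscale_subset comb_scale)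
  show "act (free_rep J M) X p \<in> carrier (free_rep J M)" "comb G (act (free_rep J M) X p) = rho L n X (comb G p)"
    if X: "X \<in> borel_alg n" for X
  proof -
    have a: "act (free_rep J M) X p = (\<Sum>x\<in>Poly_Mapping.keys p. \<Sum>j\<in>J.
      Poly_Mapping.single (x(j := act (M j) X (x j))) (Poly_Mapping.lookup p x))" by (simp add: free_rep_def)
    have "x(j := act (M j) X (x j)) \<in> ?P" if "x \<in> Poly_Mapping.keys p" "j \<in> J" for x j
    proof -
      have x: "x \<in> ?P" using kp that by blast
      then have "act (M j) X (x j) \<in> carrier (M j)" using that(2) X act by (auto simp: PiE_def Pi_def)
      then show ?thesis using x that(2) by (auto simp: PiE_def Pi_def extensional_def)
    qed
    then show "act (free_rep J M) X p \<in> carrier (free_rep J M)"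
      unfolding a free_rep_simps mem_Collect_eq
      by (intro keys_sum_subset) (auto split: if_splits)
    have "comb G (act (free_rep J M) X p) = (\<Sum>x\<in>Poly_Mapping.keys p. fscale (Poly_Mapping.lookup p x)
        (\<Sum>j\<in>J. G (x(j := act (M j) X (x j)))))"
      unfolding a by (simp add: comb_sum comb_single fs.scale_sum_right)
    also have "\<dots> = (\<Sum>x\<in>Poly_Mapping.keys p. fscale (Poly_Mapping.lookup p x) (rho L n X (G x)))"
      using eqv[OF X] kp by (intro sum.cong refl) (simp add: subsetD)
    also have "\<dots> = rho L n X (comb G p)"
      by (simp add: comb_def fs.lin_map_sum[OF lin_rho] fs.lin_scale[OF lin_rho])
    finally show "comb G (act (free_rep J M) X p) = rho L n X (comb G p)" .
  qed
  fix q assume q: "q \<in> carrier (free_rep J M)"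
  show "p \<oplus>\<^bsub>free_rep J M\<^esub> q \<in> carrier (free_rep J M)" "comb G (p \<oplus>\<^bsub>free_rep J M\<^esub> q) = comb G p + comb G q"
    using p q by (simp_all add: free_rep_simps keys_add_subset comb_add)
  show "\<exists>h\<in>carrier (free_rep J M). h \<oplus>\<^bsub>free_rep J M\<^esub> q = p"
    using p q by (intro bexI[of _ "p - q"]) (simp_all add: free_rep_simps keys_diff_subset)
qed (simp_all add: free_rep_simps comb_0)

text \<open>A presentation argument: the relations lie in the kernel; modulo their span every basis
  element reduces to combinations of \<open>Reps\<close>, on which \<open>comb G\<close> is
  injective; so an element of the kernel reduces to 0. Reduction is phrased through arbitrary
  subspaces \<open>T\<close> so that closure arguments can prove it.\<close>

lemma span_eq_kernel:
  fixes M :: "nat \<Rightarrow> ('k::field, 'v) brep"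
  assumes S: "S \<subseteq> carrier (free_rep J M)" "\<And>p. p \<in> S \<Longrightarrow> comb G p = 0"
    and straight: "\<And>T x. psubspace T \<Longrightarrow> S \<subseteq> T \<Longrightarrow> (\<And>y. y \<in> Reps \<Longrightarrow> Poly_Mapping.single y 1 \<in> T) \<Longrightarrow>
       x \<in> (\<Pi>\<^sub>E j\<in>J. carrier (M j)) \<Longrightarrow> Poly_Mapping.single x 1 \<in> T"
    and indep: "\<And>q. Poly_Mapping.keys q \<subseteq> Reps \<Longrightarrow> comb G q = 0 \<Longrightarrow> q = 0"
  shows "LinearCombinations.module.span class_ring (free_rep J M) S = {p \<in> carrier (free_rep J M). comb G p = 0}"
proof
  let ?N = "LinearCombinations.module.span class_ring (free_rep J M) S"
  let ?K = "{p \<in> carrier (free_rep J M). comb G p = 0}"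
  note N = free_rep_span[OF S(1)]
  have "psubspace ?K" unfolding psubspace_def
    by (auto simp: free_rep_simps comb_0 comb_add comb_scale keys_add_subset keys_pscale_subset)
  then show NK: "?N \<subseteq> ?K" using S by (intro N(4)) auto
  show "?K \<subseteq> ?N"
  proof
    fix p assume p: "p \<in> ?K"
    \<comment> \<open>Everything that reduces to \<open>Reps\<close> modulo the span.\<close>
    let ?T = "{p. \<exists>q. Poly_Mapping.keys q \<subseteq> Reps \<and> p - q \<in> ?N}"
    have z: "0 \<in> ?N" and add: "\<And>a b. a \<in> ?N \<Longrightarrow> b \<in> ?N \<Longrightarrow> a + b \<in> ?N"
      and sc: "\<And>c a. a \<in> ?N \<Longrightarrow> pscale c a \<in> ?N"
      using N(3) by (auto simp: psubspace_def)
    have T: "psubspace ?T" unfolding psubspace_def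
    proof (intro conjI ballI allI)
      show "0 \<in> ?T" using z by (auto intro!: exI[of _ 0])
      fix a assume "a \<in> ?T"
      then obtain qa where qa: "Poly_Mapping.keys qa \<subseteq> Reps" "a - qa \<in> ?N" by blast
      have "pscale c a - pscale c qa = pscale c (a - qa)" for c
        by (intro poly_mapping_eqI) (simp add: lookup_pscale lookup_minus algebra_simps)
      then show "pscale c a \<in> ?T" for c
        using sc[OF qa(2), of c] keys_pscale_subset[OF qa(1), of c] by auto
      fix b assume "b \<in> ?T"
      then obtain qb where qb: "Poly_Mapping.keys qb \<subseteq> Reps" "b - qb \<in> ?N" by blast
      have "a + b - (qa + qb) = (a - qa) + (b - qb)" by simp
      then show "a + b \<in> ?T"
        using add[OF qa(2) qb(2)] keys_add_subset[OF qa(1) qb(1)] by (metis (mono_tags, lifting) mem_Collect_eq)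
    qed
    have "S \<subseteq> ?T" using N(1) by (auto intro!: exI[of _ 0])
    moreover have "Poly_Mapping.single y 1 \<in> ?T" if "y \<in> Reps" for y
      using that z by (auto intro!: exI[of _ "Poly_Mapping.single y 1"])
    ultimately have s: "Poly_Mapping.single x 1 \<in> ?T" if "x \<in> (\<Pi>\<^sub>E j\<in>J. carrier (M j))" for x
      using straight[OF T _ _ that] by blast
    have "p \<in> ?T"
    proof -
      have "pscale c (Poly_Mapping.single x 1) \<in> ?T" if "x \<in> Poly_Mapping.keys p" for c x
      proof -
        have "Poly_Mapping.single x 1 \<in> ?T" using s p that by (auto simp: free_rep_simps)
        then show ?thesis using T unfolding psubspace_def by blast
      qed
      then have sg: "Poly_Mapping.single x (Poly_Mapping.lookup p x) \<in> ?T" if "x \<in> Poly_Mapping.keys p" for x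
        using that by (metis (no_types, lifting) pscale_single mult.right_neutral)
      have "(\<Sum>x\<in>A. Poly_Mapping.single x (Poly_Mapping.lookup p x)) \<in> ?T" if fin: "finite A" "A \<subseteq> Poly_Mapping.keys p" for A
        using fin
      proof (induction A rule: finite_induct)
        case empty
        show ?case unfolding sum.empty by (rule psubspace_0[OF T])
      next
        case (insert a A)
        then have "Poly_Mapping.single a (Poly_Mapping.lookup p a) \<in> ?T"
          "(\<Sum>x\<in>A. Poly_Mapping.single x (Poly_Mapping.lookup p x)) \<in> ?T" using sg by auto
        then show ?case unfolding sum.insert[OF insert.hyps] by (rule psubspace_add[OF T])
      qed
      from this[OF finite_keys subset_refl] show ?thesis
        by (simp only: sum_single_lookup)
    qed
    then obtain q where q: "Poly_Mapping.keys q \<subseteq> Reps" "p - q \<in> ?N" by blast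
    have "comb G (p - q) = 0" using NK q(2) by blast
    then have "comb G q = 0" using p by (simp add: comb_diff)
    then have "q = 0" using indep q(1) by blast
    then show "p \<in> ?N" using q(2) by simp
  qed
qed

text \<open>Places are freed one at a time. With the other entries fixed, the admissible values in
  place \<open>j\<close> contain \<open>B j\<close> and are closed under the operations by the
  multilinear relations; their image under \<open>f j\<close> is therefore everything.\<close>

lemma multilinear_straighten:
  fixes M :: "nat \<Rightarrow> ('k::field, 'v) brep"
  assumes J: "finite J" and real: "\<And>j. j \<in> J \<Longrightarrow> realizes n L (M j) (f j)"
    and B: "\<And>j. j \<in> J \<Longrightarrow> B j \<subseteq> carrier (M j)" "\<And>j. j \<in> J \<Longrightarrow> f j ` carrier (M j) \<subseteq> fs.span (f j ` B j)"
    and T: "psubspace T" "multilinear_rels J M \<subseteq> T"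
    and base: "\<And>y. y \<in> (\<Pi>\<^sub>E j\<in>J. B j) \<Longrightarrow> Poly_Mapping.single y 1 \<in> T"
    and x: "x \<in> (\<Pi>\<^sub>E j\<in>J. carrier (M j))"
  shows "Poly_Mapping.single x 1 \<in> T"
proof -
  have T0: "0 \<in> T" and Tadd: "\<And>a b. a \<in> T \<Longrightarrow> b \<in> T \<Longrightarrow> a + b \<in> T"
    and Tsc: "\<And>c a. a \<in> T \<Longrightarrow> pscale c a \<in> T"
    using T(1) by (auto simp: psubspace_def)
  have "Poly_Mapping.single x 1 \<in> T"
    if "K \<subseteq> J" "x \<in> (\<Pi>\<^sub>E j\<in>J. carrier (M j))" "\<forall>j\<in>J - K. x j \<in> B j" for K x
    using finite_subset[OF that(1) J] that
  proof (induction K arbitrary: x rule: finite_induct)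
    case empty
    then show ?case by (intro base) (auto simp: PiE_def Pi_def)
  next
    case (insert j K)
    have j: "j \<in> J" using insert.prems by simp
    note R = lifts_zero[OF realizes_lifts[OF real[OF j]]] lifts_add[OF realizes_lifts[OF real[OF j]]]
      lifts_smult[OF realizes_lifts[OF real[OF j]]]
    define D where "D = {a \<in> carrier (M j). Poly_Mapping.single (x(j := a)) 1 \<in> T}"
    have BD: "B j \<subseteq> D"
    proof
      fix b assume b: "b \<in> B j"
      then have bc: "b \<in> carrier (M j)" using B(1)[OF j] by blast
      have "Poly_Mapping.single (x(j := b)) 1 \<in> T"
        using insert.prems b bc j
        by (intro insert.IH) (auto simp: PiE_def Pi_def extensional_def)
      then show "b \<in> D" using bc by (simp add: D_def)
    qed
    have add: "a \<oplus>\<^bsub>M j\<^esub> b \<in> D" if "a \<in> D" "b \<in> D" for a b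
    proof -
      have ab: "a \<in> carrier (M j)" "b \<in> carrier (M j)" "Poly_Mapping.single (x(j := a)) 1 \<in> T"
        "Poly_Mapping.single (x(j := b)) 1 \<in> T" using that by (auto simp: D_def)
      have "Poly_Mapping.single (x(j := a \<oplus>\<^bsub>M j\<^esub> b)) 1 - Poly_Mapping.single (x(j := a)) 1 - Poly_Mapping.single (x(j := b)) 1 \<in> T"
        using T(2) insert.prems(2) j ab unfolding multilinear_rels_def by blast
      from Tadd[OF Tadd[OF this ab(3)] ab(4)] show ?thesis using ab R by (simp add: D_def)
    qed
    \<comment> \<open>The alternative c = 0 provides the zero vector even if \<open>B j\<close> is
      empty.\<close>
    have smult: "c \<odot>\<^bsub>M j\<^esub> a \<in> D" if "a \<in> carrier (M j)" "c = 0 \<or> a \<in> D" for a c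
    proof -
      have "Poly_Mapping.single (x(j := c \<odot>\<^bsub>M j\<^esub> a)) 1 - Poly_Mapping.single (x(j := a)) c \<in> T"
        using T(2) insert.prems(2) j that unfolding multilinear_rels_def by blast
      moreover have "Poly_Mapping.single (x(j := a)) c \<in> T"
        using that(2) Tsc[of "Poly_Mapping.single (x(j := a)) 1" c] T0 by (auto simp: D_def pscale_single)
      ultimately show ?thesis using Tadd that(1) R by (fastforce simp: D_def)
    qed
    have "fs.subspace (f j ` D)"
    proof (rule fs.subspaceI)
      have "0 \<odot>\<^bsub>M j\<^esub> \<zero>\<^bsub>M j\<^esub> \<in> D" "f j (0 \<odot>\<^bsub>M j\<^esub> \<zero>\<^bsub>M j\<^esub>) = 0" using smult[of "\<zero>\<^bsub>M j\<^esub>" 0] R by auto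
      then show "0 \<in> f j ` D" by force
      show "y + z \<in> f j ` D" if yz: "y \<in> f j ` D" "z \<in> f j ` D" for y z
      proof -
        obtain a b where ab: "a \<in> D" "b \<in> D" "y = f j a" "z = f j b" using yz by blast
        then have "y + z = f j (a \<oplus>\<^bsub>M j\<^esub> b)" using R(4) by (simp add: D_def)
        then show ?thesis using add[OF ab(1,2)] by blast
      qed
      show "fscale c y \<in> f j ` D" if y: "y \<in> f j ` D" for c y
      proof -
        obtain a where a: "a \<in> D" "y = f j a" using y by blast
        then have "fscale c y = f j (c \<odot>\<^bsub>M j\<^esub> a)" using R(6) by (simp add: D_def)
        then show ?thesis using smult[of a c] a by (auto simp: D_def)
      qed
    qed
    then have "fs.span (f j ` B j) \<subseteq> f j ` D" using BD by (intro fs.span_minimal image_mono)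
    then have im: "f j ` carrier (M j) \<subseteq> f j ` D" using B(2)[OF j] by blast
    have xj: "x j \<in> carrier (M j)" using insert.prems(2) j by (auto simp: PiE_def Pi_def)
    then obtain d where d: "d \<in> D" "f j (x j) = f j d" using im by blast
    then have "x j = d" using xj realizes_eqI[OF real[OF j]] by (auto simp: D_def)
    then have "x(j := d) = x" by auto
    then show ?case using d(1) by (simp add: D_def)
  qed
  from this[OF subset_refl x] show ?thesis by simp
qed

section \<open>Tensor products\<close>

text \<open>The tensor product of factors that live in disjoint sets \<open>K j\<close> of columns.
  No signs are needed, because \<open>csign\<close> sees one column only.\<close>

definition bprod :: "nat set \<Rightarrow> (nat \<Rightarrow> nat set) \<Rightarrow> (nat \<Rightarrow> 'k::field fock) \<Rightarrow> 'k fock" where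
  "bprod J K h = (\<lambda>S. if S \<subseteq> (\<Union>j\<in>J. K j) \<times> UNIV then \<Prod>j\<in>J. h j (S \<inter> (K j \<times> UNIV)) else 0)"

abbreviation in_block :: "nat set \<Rightarrow> 'k::field fock set" where
  "in_block K \<equiv> supported (\<lambda>S. S \<subseteq> K \<times> UNIV)"

section \<open>The Leibniz rule for products of blocks\<close>

lemma csign_cong: "(\<And>i. (fst c, i) \<in> S \<longleftrightarrow> (fst c, i) \<in> S') \<Longrightarrow> csign c S = csign c S'"
  by (simp add: csign_def)

lemma hop_apply:
  "cre (c, a) (ann (c, b) f) S =
   (if (c, a) \<in> S \<and> (c, b) \<notin> S - {(c, a)} then csign (c, a) S * csign (c, b) (S - {(c, a)}) * f (insert (c, b) (S - {(c, a)})) else 0)"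
  by (simp add: cre_def ann_def)

lemma hop_in_block: "c \<notin> K \<Longrightarrow> f \<in> in_block K \<Longrightarrow> cre (c, a) (ann (c, b) f) = 0"
  by (rule ext) (auto simp: hop_apply supported_def)

lemma bprod_upd:
  assumes "finite J" "i \<in> J"
  shows "bprod J K (h(i := u)) S = (if S \<subseteq> (\<Union>j\<in>J. K j) \<times> UNIV then
    u (S \<inter> (K i \<times> UNIV)) * (\<Prod>j\<in>J - {i}. h j (S \<inter> (K j \<times> UNIV))) else 0)"
  using assms by (auto simp: bprod_def prod.remove[of J i] intro!: prod.cong)

lemma lin_bprod: "finite J \<Longrightarrow> i \<in> J \<Longrightarrow> fs.lin (\<lambda>u. bprod J K (h(i := u)))"
  by (auto simp: fs.lin_def bprod_upd fun_eq_iff fscale_def algebra_simps)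

text \<open>A move within column \<open>c\<close> changes only the block containing
  \<open>c\<close>, and its signs depend on that column alone.\<close>

lemma bprod_hop:
  assumes J: "finite J" "i \<in> J" and c: "c \<in> K i" "\<And>j. j \<in> J \<Longrightarrow> j \<noteq> i \<Longrightarrow> c \<notin> K j"
  shows "cre (c, a) (ann (c, b) (bprod J K h)) = bprod J K (h(i := cre (c, a) (ann (c, b) (h i))))"
proof
  fix S
  let ?U = "(\<Union>j\<in>J. K j) \<times> (UNIV :: nat set)" and ?Bi = "K i \<times> (UNIV :: nat set)"
  let ?S = "insert (c, b) (S - {(c, a)})"
  have other: "?S \<inter> (K j \<times> UNIV) = S \<inter> (K j \<times> UNIV)" if "j \<in> J - {i}" for j
    using c(2) that by auto
  have here: "?S \<inter> ?Bi = insert (c, b) (S \<inter> ?Bi - {(c, a)})" using c(1) by auto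
  have sub: "?S \<subseteq> ?U \<longleftrightarrow> S \<subseteq> ?U" if "(c, a) \<in> S" using c(1) J(2) that by auto
  have sg: "csign (c, a) (S \<inter> ?Bi) = csign (c, a) S" "csign (c, b) (S \<inter> ?Bi - {(c, a)}) = csign (c, b) (S - {(c, a)})"
    using c(1) by (auto intro!: csign_cong)
  have h: "bprod J K h ?S = (if ?S \<subseteq> ?U then h i (?S \<inter> ?Bi) * (\<Prod>j\<in>J - {i}. h j (?S \<inter> (K j \<times> UNIV))) else 0)"
    using bprod_upd[OF J, of K h "h i"] by simp
  have P: "(\<Prod>j\<in>J - {i}. h j (?S \<inter> (K j \<times> UNIV))) = (\<Prod>j\<in>J - {i}. h j (S \<inter> (K j \<times> UNIV)))"
    using other by (intro prod.cong refl) simp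
  show "cre (c, a) (ann (c, b) (bprod J K h)) S = bprod J K (h(i := cre (c, a) (ann (c, b) (h i)))) S"
    unfolding bprod_upd[OF J] hop_apply h P here sg using c(1) sub by auto
qed

lemma bprod_hop_outside:
  assumes "c \<notin> (\<Union>j\<in>J. K j)" shows "cre (c, a) (ann (c, b) (bprod J K h)) = 0"
  by (rule hop_in_block[OF assms]) (auto simp: supported_def bprod_def split: if_splits)

context
  fixes J :: "nat set" and K :: "nat \<Rightarrow> nat set"
  assumes J: "finite J" and disj: "\<And>i j. i \<in> J \<Longrightarrow> j \<in> J \<Longrightarrow> i \<noteq> j \<Longrightarrow> K i \<inter> K j = {}"
begin

lemma bprod_hop_sum:
  assumes h: "\<And>j. j \<in> J \<Longrightarrow> h j \<in> in_block (K j)"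
  shows "cre (c, a) (ann (c, b) (bprod J K h)) = (\<Sum>i\<in>J. bprod J K (h(i := cre (c, a) (ann (c, b) (h i)))))"
proof (cases "c \<in> (\<Union>j\<in>J. K j)")
  case False
  then have "bprod J K (h(i := cre (c, a) (ann (c, b) (h i)))) = 0" if "i \<in> J" for i
    using hop_in_block[OF _ h[OF that], of c a b] fs.lin_0[OF lin_bprod[OF J that]] that by auto
  then show ?thesis using bprod_hop_outside[OF False] by simp
next
  case True
  then obtain i where i: "i \<in> J" "c \<in> K i" by blast
  then have ni: "c \<notin> K j" if "j \<in> J" "j \<noteq> i" for j using disj that by blast
  have "(\<Sum>i\<in>J. bprod J K (h(i := cre (c, a) (ann (c, b) (h i))))) =
    bprod J K (h(i := cre (c, a) (ann (c, b) (h i)))) + (\<Sum>j\<in>J - {i}. bprod J K (h(j := cre (c, a) (ann (c, b) (h j)))))"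
    using J i(1) by (rule sum.remove)
  also have "(\<Sum>j\<in>J - {i}. bprod J K (h(j := cre (c, a) (ann (c, b) (h j))))) = 0"
  proof (rule sum.neutral, rule ballI)
    fix j assume j: "j \<in> J - {i}"
    then have "cre (c, a) (ann (c, b) (h j)) = 0" using hop_in_block[OF ni h] by blast
    then show "bprod J K (h(j := cre (c, a) (ann (c, b) (h j)))) = 0"
      using fs.lin_0[OF lin_bprod[OF J, of j K h]] j by simp
  qed
  finally have "(\<Sum>i\<in>J. bprod J K (h(i := cre (c, a) (ann (c, b) (h i))))) = bprod J K (h(i := cre (c, a) (ann (c, b) (h i))))"
    by (simp only: add_0_right)
  moreover have "cre (c, a) (ann (c, b) (bprod J K h)) = bprod J K (h(i := cre (c, a) (ann (c, b) (h i))))"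
    by (rule bprod_hop, rule J, rule i(1), rule i(2), rule ni)
  ultimately show ?thesis by (simp only:)
qed

lemma eop_bprod:
  assumes h: "\<And>j. j \<in> J \<Longrightarrow> h j \<in> in_block (K j)"
  shows "eop L a b (bprod J K h) = (\<Sum>i\<in>J. bprod J K (h(i := eop L a b (h i))))"
proof -
  have lin: "fs.lin (\<lambda>u. bprod J K (h(i := u)))" if "i \<in> J" for i by (rule lin_bprod[OF J that])
  have "eop L a b (bprod J K h) = (\<Sum>c<L. \<Sum>i\<in>J. bprod J K (h(i := cre (c, a) (ann (c, b) (h i)))))"
    unfolding eop_def by (intro sum.cong refl bprod_hop_sum h)
  also have "\<dots> = (\<Sum>i\<in>J. \<Sum>c<L. bprod J K (h(i := cre (c, a) (ann (c, b) (h i)))))" by (rule sum.swap)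
  also have "\<dots> = (\<Sum>i\<in>J. bprod J K (h(i := eop L a b (h i))))"
    unfolding eop_def by (intro sum.cong refl) (simp add: fs.lin_map_sum[OF lin])
  finally show ?thesis .
qed

lemma rho_bprod:
  assumes h: "\<And>j. j \<in> J \<Longrightarrow> h j \<in> in_block (K j)"
  shows "rho L n X (bprod J K h) = (\<Sum>i\<in>J. bprod J K (h(i := rho L n X (h i))))"
proof -
  have lin: "fs.lin (\<lambda>u. bprod J K (h(i := u)))" if "i \<in> J" for i by (rule lin_bprod[OF J that])
  have "(\<Sum>i\<in>J. bprod J K (h(i := rho L n X (h i)))) =
    (\<Sum>i\<in>J. \<Sum>a<n. \<Sum>b<n. fscale (X $$ (a, b)) (bprod J K (h(i := eop L (Suc a) (Suc b) (h i)))))"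
    unfolding rho_def by (intro sum.cong refl) (simp add: fs.lin_map_sum[OF lin] fs.lin_scale[OF lin])
  also have "\<dots> = (\<Sum>a<n. \<Sum>i\<in>J. \<Sum>b<n. fscale (X $$ (a, b)) (bprod J K (h(i := eop L (Suc a) (Suc b) (h i)))))"
    by (rule sum.swap)
  also have "\<dots> = (\<Sum>a<n. \<Sum>b<n. \<Sum>i\<in>J. fscale (X $$ (a, b)) (bprod J K (h(i := eop L (Suc a) (Suc b) (h i)))))"
    by (rule sum.cong[OF refl], rule sum.swap)
  also have "\<dots> = rho L n X (bprod J K h)"
  proof -
    have "eop L a b (bprod J K h) = (\<Sum>i\<in>J. bprod J K (h(i := eop L a b (h i))))" for a b
      by (rule eop_bprod) (rule h)
    then show ?thesis unfolding rho_def by (simp only: fs.scale_sum_right)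
  qed
  finally show ?thesis ..
qed

end

text \<open>With the arguments of the other factors frozen, independence in factor \<open>i\<close>
  makes each of its coefficients vanish, and these coefficients are relations among fewer
  factors.\<close>

lemma prod_independent:
  fixes h :: "nat \<Rightarrow> 'v \<Rightarrow> 's \<Rightarrow> 'k::field"
  assumes "finite J" and "\<And>j. j \<in> J \<Longrightarrow> finite (B j)"
    and "\<And>j c. j \<in> J \<Longrightarrow> (\<And>s. (\<Sum>b\<in>B j. c b * h j b s) = 0) \<Longrightarrow> \<forall>b\<in>B j. c b = 0"
    and "\<And>s. (\<Sum>x\<in>PiE J B. c x * (\<Prod>j\<in>J. h j (x j) (s j))) = 0"
    and "x \<in> PiE J B"
  shows "c x = 0"
  using assms
proof (induction J arbitrary: c x rule: finite_induct)
  case empty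
  then show ?case by simp
next
  case (insert i J)
  let ?d = "\<lambda>s b. \<Sum>y\<in>PiE J B. c (y(i := b)) * (\<Prod>j\<in>J. h j (y j) (s j))"
  have z: "(\<Sum>b\<in>B i. ?d s b * h i b t) = 0" for s t
  proof -
    let ?s = "s(i := t)"
    have "0 = (\<Sum>x\<in>PiE (insert i J) B. c x * (\<Prod>j\<in>insert i J. h j (x j) (?s j)))"
      using insert.prems(3)[of ?s] by simp
    also have "\<dots> = (\<Sum>(b, y)\<in>B i \<times> PiE J B. c (y(i := b)) * (\<Prod>j\<in>insert i J. h j ((y(i := b)) j) (?s j)))"
      unfolding PiE_insert_eq
      by (subst sum.reindex[OF inj_combinator[OF insert.hyps(2)]]) (simp add: case_prod_unfold)
    also have "\<dots> = (\<Sum>(b, y)\<in>B i \<times> PiE J B. c (y(i := b)) * (\<Prod>j\<in>J. h j (y j) (s j)) * h i b t)"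
    proof (intro sum.cong refl, clarify)
      fix b y
      have "(\<Prod>j\<in>insert i J. h j ((y(i := b)) j) (?s j)) = h i b t * (\<Prod>j\<in>J. h j ((y(i := b)) j) (?s j))"
        using insert.hyps by simp
      also have "(\<Prod>j\<in>J. h j ((y(i := b)) j) (?s j)) = (\<Prod>j\<in>J. h j (y j) (s j))"
        using insert.hyps(2) by (intro prod.cong) auto
      finally show "c (y(i := b)) * (\<Prod>j\<in>insert i J. h j ((y(i := b)) j) (?s j)) =
         c (y(i := b)) * (\<Prod>j\<in>J. h j (y j) (s j)) * h i b t" by (simp only: mult_ac)
    qed
    also have "\<dots> = (\<Sum>b\<in>B i. ?d s b * h i b t)"
      by (simp add: sum.cartesian_product sum_distrib_right)
    finally show ?thesis by simp
  qed
  have d: "?d s b = 0" if "b \<in> B i" for s b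
    using insert.prems(2)[of i "?d s", OF insertI1 z] that by (rule bspec)
  have xi: "x i \<in> B i" and y: "x(i := undefined) \<in> PiE J B"
    using insert.prems(4) insert.hyps(2) by (auto simp: PiE_def Pi_def extensional_def)
  have "(\<lambda>y. c (y(i := x i))) (x(i := undefined)) = 0"
  proof (rule insert.IH[OF _ _ _ y])
    show "finite (B j)" if "j \<in> J" for j using insert.prems(1)[OF insertI2[OF that]] .
    show "\<forall>b\<in>B j. e b = 0" if "j \<in> J" "\<And>s. (\<Sum>b\<in>B j. e b * h j b s) = 0" for j e
      by (rule insert.prems(2)[of j e, OF insertI2[OF that(1)] that(2)])
  qed (rule d[OF xi])
  then show ?case by simp
qed

lemma independent_functions:
  fixes f :: "'v \<Rightarrow> 'k::field fock"
  assumes "finite B" "inj_on f B" "fs.independent (f ` B)" and "\<And>s. (\<Sum>b\<in>B. c b * f b s) = 0"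
  shows "\<forall>b\<in>B. c b = 0"
proof
  fix b assume b: "b \<in> B"
  have "(\<Sum>v\<in>f ` B. fscale (c (inv_into B f v)) v) = (\<Sum>b\<in>B. fscale (c b) (f b))"
    using assms(2) by (simp add: sum.reindex)
  also have "\<dots> = 0" using assms(4) by (auto simp: fun_eq_iff sum_eval fscale_apply)
  finally have "c (inv_into B f (f b)) = 0"
    using fs.independentD[OF assms(3), of "f ` B" "\<lambda>v. c (inv_into B f v)" "f b"] assms(1) b by auto
  then show "c b = 0" using assms(2) b by simp
qed

text \<open>The multilinear relations reduce everything to tensors of basis vectors, and their
  images stay independent as functions; so the tensor ideal is the whole kernel of
  \<open>comb G\<close>.\<close>

lemma tensor_realizes:
  fixes M :: "nat \<Rightarrow> ('k::field, 'v) brep"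
  assumes J: "finite J" and disj: "\<And>i j. i \<in> J \<Longrightarrow> j \<in> J \<Longrightarrow> i \<noteq> j \<Longrightarrow> K i \<inter> K j = {}"
    and real: "\<And>j. j \<in> J \<Longrightarrow> realizes n L (M j) (f j)"
    and block: "\<And>j. j \<in> J \<Longrightarrow> f j ` carrier (M j) \<subseteq> in_block (K j)"
    and fin: "\<And>j. j \<in> J \<Longrightarrow> \<exists>C. finite C \<and> f j ` carrier (M j) \<subseteq> fs.span C"
  defines "G \<equiv> \<lambda>x. bprod J K (\<lambda>j. f j (x j))" and "P \<equiv> \<Pi>\<^sub>E j\<in>J. carrier (M j)"
  shows "\<exists>F. realizes n L (Tensor J M) F \<and> F ` carrier (Tensor J M) = fs.span (G ` P) \<and>
    (\<forall>x\<in>P. pure_tensor J M x \<in> carrier (Tensor J M) \<and> F (pure_tensor J M x) = G x)"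
proof -
  have G_upd: "G (x(j := a)) = bprod J K ((\<lambda>k. f k (x k))(j := f j a))" for x j a
    unfolding G_def by (rule arg_cong[of _ _ "bprod J K"]) auto
  have x_in: "x j \<in> carrier (M j)" if "x \<in> P" "j \<in> J" for x j
    using that by (auto simp: P_def PiE_def Pi_def)
  have upd_in: "x(j := a) \<in> P" if "x \<in> P" "j \<in> J" "a \<in> carrier (M j)" for x j a
    using that by (auto simp: P_def PiE_def Pi_def extensional_def)
  have lifts: "lifts n L (free_rep J M) (comb G)"
  proof (rule free_rep_lifts[OF J])
    show "act (M j) X a \<in> carrier (M j)" if "j \<in> J" "X \<in> borel_alg n" "a \<in> carrier (M j)" for j X a
      using lifts_act(1)[OF realizes_lifts[OF real[OF that(1)]] that(2,3)] .
    fix X :: "'k mat" and x assume X: "X \<in> borel_alg n" and "x \<in> (\<Pi>\<^sub>E j\<in>J. carrier (M j))"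
    then have x: "x \<in> P" by (simp add: P_def)
    have "(\<Sum>j\<in>J. G (x(j := act (M j) X (x j)))) = (\<Sum>j\<in>J. bprod J K ((\<lambda>k. f k (x k))(j := rho L n X (f j (x j)))))"
      using lifts_act(2)[OF realizes_lifts[OF real] X x_in[OF x]] by (intro sum.cong refl) (simp add: G_upd)
    also have "\<dots> = rho L n X (G x)"
      unfolding G_def using block x_in[OF x] by (intro rho_bprod[OF J disj, symmetric]) auto
    finally show "(\<Sum>j\<in>J. G (x(j := act (M j) X (x j)))) = rho L n X (G x)" .
  qed
  have "\<exists>B. finite B \<and> B \<subseteq> carrier (M j) \<and> fs.independent (f j ` B) \<and> f j ` carrier (M j) = fs.span (f j ` B)"
    if j: "j \<in> J" for j
  proof -
    obtain C where C: "finite C" "f j ` carrier (M j) \<subseteq> fs.span C" using fin[OF j] by blast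
    have sub: "fs.subspace (f j ` carrier (M j))" by (rule subspace_lifts_image[OF realizes_lifts[OF real[OF j]]])
    obtain D where D: "D \<subseteq> D" "finite D" "fs.independent D" "fs.span D = f j ` carrier (M j)"
      by (rule fs.finite_basis_extend[OF sub sub subset_refl C(2,1)]) blast
    let ?B = "{a \<in> carrier (M j). f j a \<in> D}"
    have "D \<subseteq> f j ` carrier (M j)" using D(4) fs.span_superset by blast
    then have im: "f j ` ?B = D" by blast
    have "inj_on (f j) ?B" using realizes_inj[OF real[OF j]] by (rule inj_on_subset) auto
    then have "finite ?B" using finite_imageD[of "f j" ?B] im D(2) by simp
    then show ?thesis using D im by (intro exI[of _ ?B]) auto
  qed
  then obtain B where B: "\<And>j. j \<in> J \<Longrightarrow> finite (B j)" "\<And>j. j \<in> J \<Longrightarrow> B j \<subseteq> carrier (M j)"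
    "\<And>j. j \<in> J \<Longrightarrow> fs.independent (f j ` B j)" "\<And>j. j \<in> J \<Longrightarrow> f j ` carrier (M j) = fs.span (f j ` B j)"
    by metis
  have rels: "p \<in> carrier (free_rep J M) \<and> comb G p = 0" if p: "p \<in> multilinear_rels J M" for p
  proof -
    consider x j a b where "x \<in> P" "j \<in> J" "a \<in> carrier (M j)" "b \<in> carrier (M j)"
        "p = Poly_Mapping.single (x(j := a \<oplus>\<^bsub>M j\<^esub> b)) 1 - Poly_Mapping.single (x(j := a)) 1 - Poly_Mapping.single (x(j := b)) 1"
      | x j a c where "x \<in> P" "j \<in> J" "a \<in> carrier (M j)"
        "p = Poly_Mapping.single (x(j := c \<odot>\<^bsub>M j\<^esub> a)) 1 - Poly_Mapping.single (x(j := a)) c"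
      using p unfolding multilinear_rels_def P_def by blast
    then show ?thesis
    proof cases
      case 1
      note R = lifts_add[OF realizes_lifts[OF real[OF 1(2)]] 1(3,4)]
      have "comb G p = 0" unfolding 1(5)
        by (simp add: comb_diff comb_single G_upd R(2) fs.lin_add[OF lin_bprod[OF J 1(2)]])
      moreover have "p \<in> carrier (free_rep J M)" unfolding 1(5) free_rep_simps mem_Collect_eq
        using upd_in[OF 1(1,2)] 1(3,4) R(1) by (intro keys_diff_subset) (simp_all add: P_def)
      ultimately show ?thesis by blast
    next
      case 2
      note R = lifts_smult[OF realizes_lifts[OF real[OF 2(2)]] 2(3)]
      have "comb G p = 0" unfolding 2(4)
        by (simp add: comb_diff comb_single G_upd R(2) fs.lin_scale[OF lin_bprod[OF J 2(2)]])
      moreover have "p \<in> carrier (free_rep J M)" unfolding 2(4) free_rep_simps mem_Collect_eq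
        using upd_in[OF 2(1,2)] 2(3) R(1) by (intro keys_diff_subset) (simp_all add: P_def)
      ultimately show ?thesis by blast
    qed
  qed
  have ideal: "tensor_ideal J M = {p \<in> carrier (free_rep J M). comb G p = 0}"
    unfolding tensor_ideal_def
  proof (rule span_eq_kernel[where Reps = "PiE J B"])
    show "Poly_Mapping.single x 1 \<in> T"
      if "psubspace T" "multilinear_rels J M \<subseteq> T" "\<And>y. y \<in> PiE J B \<Longrightarrow> Poly_Mapping.single y 1 \<in> T"
        "x \<in> (\<Pi>\<^sub>E j\<in>J. carrier (M j))" for T x
      using B(4) by (intro multilinear_straighten[OF J real B(2) _ that]) auto
    fix q :: "(nat \<Rightarrow> 'v) \<Rightarrow>\<^sub>0 'k" assume q: "Poly_Mapping.keys q \<subseteq> PiE J B" "comb G q = 0"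
    have finP: "finite (PiE J B)" using J B(1) by (intro finite_PiE) auto
    have "Poly_Mapping.lookup q x = 0" if x: "x \<in> PiE J B" for x
    proof (rule prod_independent[OF J B(1) _ _ x])
      show "\<forall>b\<in>B j. c b = 0" if "j \<in> J" "\<And>s. (\<Sum>b\<in>B j. c b * f j b s) = 0" for j c
        using that B by (intro independent_functions[of "B j" "f j"])
          (auto intro: inj_on_subset[OF realizes_inj[OF real[OF that(1)]] B(2)[OF that(1)]])
      fix s :: "nat \<Rightarrow> (nat \<times> nat) set"
      show "(\<Sum>x\<in>PiE J B. Poly_Mapping.lookup q x * (\<Prod>j\<in>J. f j (x j) (s j))) = 0"
      proof (cases "\<forall>j\<in>J. s j \<subseteq> K j \<times> UNIV")
        case True
        \<comment> \<open>At a union of sets from different blocks the factors take their arguments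
          independently of each other.\<close>
        let ?S = "\<Union>j\<in>J. s j"
        have "?S \<inter> (K j \<times> UNIV) = s j" if "j \<in> J" for j
          using that True disj by blast
        then have "G x ?S = (\<Prod>j\<in>J. f j (x j) (s j))" for x
          unfolding G_def bprod_def using True by (auto intro!: prod.cong)
        moreover have "(\<Sum>x\<in>PiE J B. Poly_Mapping.lookup q x * G x ?S) = comb G q ?S"
          by (simp add: comb_superset[OF finP q(1)] sum_eval fscale_apply)
        ultimately show ?thesis using q(2) by simp
      next
        case False
        then obtain j where j: "j \<in> J" "\<not> s j \<subseteq> K j \<times> UNIV" by blast
        have "f j (x j) (s j) = 0" if "x \<in> PiE J B" for x
        proof -
          have "x j \<in> carrier (M j)" using that j(1) B(2)[OF j(1)] by (auto simp: PiE_def Pi_def)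
          then have "f j (x j) \<in> in_block (K j)" using block[OF j(1)] by blast
          then show ?thesis using j(2) unfolding supported_def by blast
        qed
        then have "(\<Prod>j\<in>J. f j (x j) (s j)) = 0" if "x \<in> PiE J B" for x
          using that j(1) J by (auto intro: prod_zero)
        then show ?thesis by simp
      qed
    qed
    then show "q = 0" using q(1) by (auto intro!: poly_mapping_eqI) (metis in_keys_iff subsetD)
  qed (use rels in auto)
  note Q = quotient_realizes[OF lifts, folded ideal, folded Tensor_def]
  have single_in: "Poly_Mapping.single x 1 \<in> carrier (free_rep J M)" if "x \<in> P" for x
    using that by (simp add: free_rep_simps P_def)
  have im: "comb G ` carrier (free_rep J M) = fs.span (G ` P)"
  proof
    show "comb G ` carrier (free_rep J M) \<subseteq> fs.span (G ` P)"
    proof (rule image_subsetI)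
      fix p assume "p \<in> carrier (free_rep J M)"
      then have "Poly_Mapping.keys p \<subseteq> P" by (simp add: free_rep_simps P_def)
      then show "comb G p \<in> fs.span (G ` P)"
        unfolding comb_def by (intro fs.span_sum fs.span_scale fs.span_base imageI) auto
    qed
    have "G x \<in> comb G ` carrier (free_rep J M)" if "x \<in> P" for x
      using single_in[OF that] by (intro image_eqI[of _ _ "Poly_Mapping.single x 1"]) (simp_all add: comb_single)
    then show "fs.span (G ` P) \<subseteq> comb G ` carrier (free_rep J M)"
      by (intro fs.span_minimal subspace_lifts_image[OF lifts]) auto
  qed
  have "pure_tensor J M x \<in> carrier (Tensor J M)" if "x \<in> P" for x
    using single_in[OF that] unfolding pure_tensor_def Tensor_def quot_rep_def A_RCOSETS_def' by auto
  moreover have "(\<lambda>C. comb G (SOME x. x \<in> C)) (pure_tensor J M x) = G x" if "x \<in> P" for x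
    unfolding pure_tensor_def using Q(3)[OF single_in[OF that]] by (simp add: comb_single)
  ultimately show ?thesis using Q(1,2) im by (intro exI[of _ "\<lambda>C. comb G (SOME x. x \<in> C)"]) auto
qed

section \<open>Exterior powers\<close>

text \<open>Exterior multiplication by \<open>v\<close> in column \<gamma>.\<close>

definition cvec :: "nat \<Rightarrow> 'k::field vec \<Rightarrow> 'k fock \<Rightarrow> 'k fock" where
  "cvec \<gamma> v f = (\<Sum>i<dim_vec v. fscale (v $ i) (cre (\<gamma>, Suc i) f))"

definition wprod :: "nat \<Rightarrow> nat list \<Rightarrow> (nat \<Rightarrow> 'k::field vec) \<Rightarrow> 'k fock" where
  "wprod \<gamma> ks x = foldr (\<lambda>k. cvec \<gamma> (x k)) ks (delta {})"

lemma wprod_simps: "wprod \<gamma> [] x = delta {}" "wprod \<gamma> (k # ks) x = cvec \<gamma> (x k) (wprod \<gamma> ks x)"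
  by (simp_all add: wprod_def)

lemma wprod_cong: "(\<And>k. k \<in> set ks \<Longrightarrow> x k = y k) \<Longrightarrow> wprod \<gamma> ks x = wprod \<gamma> ks y"
  by (induction ks) (simp_all add: wprod_simps)

section \<open>Exterior multiplication by vectors in one column\<close>

lemma lin_cvec: "fs.lin (cvec \<gamma> v)"
  unfolding cvec_def[abs_def] by (intro fs.lin_sum fs.lin_scaled lin_cre)

lemma cvec_add: "u \<in> carrier_vec n \<Longrightarrow> v \<in> carrier_vec n \<Longrightarrow> cvec \<gamma> (u + v) f = cvec \<gamma> u f + cvec \<gamma> v f"
  by (simp add: cvec_def fs.scale_left_distrib sum.distrib)

lemma cvec_smult: "cvec \<gamma> (c \<cdot>\<^sub>v v) f = fscale c (cvec \<gamma> v f)"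
  by (simp add: cvec_def fs.scale_sum_right)

lemma cvec_unit: "i < n \<Longrightarrow> cvec \<gamma> (unit_vec n i) f = cre (\<gamma>, Suc i) f"
proof -
  assume i: "i < n"
  have "cvec \<gamma> (unit_vec n i) f = (\<Sum>k<n. if k = i then cre (\<gamma>, Suc i) f else 0)"
    unfolding cvec_def by (intro sum.cong) (auto simp: i)
  then show ?thesis using i by simp
qed

lemma cvec_anticommute: "cvec \<gamma> u (cvec \<gamma> v f) = - cvec \<gamma> v (cvec \<gamma> u f)"
proof -
  have e: "cvec \<gamma> u (cvec \<gamma> v f) = (\<Sum>i<dim_vec u. \<Sum>j<dim_vec v. fscale (u $ i * v $ j) (cre (\<gamma>, Suc i) (cre (\<gamma>, Suc j) f)))"
    for u v :: "'a vec"
    unfolding cvec_def by (simp add: fs.lin_map_sum[OF lin_cre] fs.lin_scale[OF lin_cre] fs.scale_sum_right)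
  have s: "fscale (v $ j * u $ i) (cre (\<gamma>, Suc j) (cre (\<gamma>, Suc i) f)) = - fscale (u $ i * v $ j) (cre (\<gamma>, Suc i) (cre (\<gamma>, Suc j) f))" for i j
    using cre_cre_same[of "(\<gamma>, Suc j)" "(\<gamma>, Suc i)" f] by (simp add: mult.commute)
  have "cvec \<gamma> v (cvec \<gamma> u f) = (\<Sum>i<dim_vec u. \<Sum>j<dim_vec v. fscale (v $ j * u $ i) (cre (\<gamma>, Suc j) (cre (\<gamma>, Suc i) f)))"
    unfolding e by (rule sum.swap)
  also have "\<dots> = - cvec \<gamma> u (cvec \<gamma> v f)" unfolding s e by (simp only: sum_negf)
  finally show ?thesis by simp
qed

text \<open>By anticommutation the value equals its own negative, and in characteristic zero it is
  0.\<close>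

lemma cvec_self:
  fixes f :: "'k::field_char_0 fock"
  shows "cvec \<gamma> v (cvec \<gamma> v f) = 0"
proof
  fix S
  have "cvec \<gamma> v (cvec \<gamma> v f) S = - cvec \<gamma> v (cvec \<gamma> v f) S"
    using fun_cong[OF cvec_anticommute[of \<gamma> v v f], of S] by (simp only: uminus_apply)
  then have "2 * cvec \<gamma> v (cvec \<gamma> v f) S = 0" by (simp only: eq_neg_iff_add_eq_0 mult_2)
  then show "cvec \<gamma> v (cvec \<gamma> v f) S = 0 S" by simp
qed

lemma cvec_wprod_eq_0:
  fixes x :: "nat \<Rightarrow> 'k::field_char_0 vec"
  shows "v \<in> x ` set ks \<Longrightarrow> cvec \<gamma> v (wprod \<gamma> ks x) = 0"
proof (induction ks)
  case (Cons k ks)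
  show ?case
  proof (cases "v = x k")
    case True then show ?thesis by (simp add: wprod_simps cvec_self)
  next
    case False
    then have "cvec \<gamma> v (wprod \<gamma> ks x) = 0" using Cons by auto
    then show ?thesis using cvec_anticommute[of \<gamma> v "x k"]
      by (simp add: wprod_simps fs.lin_0[OF lin_cvec])
  qed
qed simp

lemma wprod_alternating:
  fixes x :: "nat \<Rightarrow> 'k::field_char_0 vec"
  shows "\<not> distinct (map x ks) \<Longrightarrow> wprod \<gamma> ks x = 0"
  by (induction ks) (auto simp: wprod_simps cvec_wprod_eq_0 fs.lin_0[OF lin_cvec])

lemma wprod_upd_add:
  assumes "distinct ks" "k \<in> set ks" "u \<in> carrier_vec n" "v \<in> carrier_vec n"
  shows "wprod \<gamma> ks (x(k := u + v)) = wprod \<gamma> ks (x(k := u)) + wprod \<gamma> ks (x(k := v))"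
  using assms(1,2)
proof (induction ks)
  case (Cons m ks)
  show ?case
  proof (cases "k = m")
    case True
    have c: "wprod \<gamma> ks (x(k := a)) = wprod \<gamma> ks x" for a
      using Cons.prems True by (intro wprod_cong) auto
    show ?thesis using True unfolding wprod_simps c by (simp add: cvec_add[OF assms(3,4)])
  next
    case False
    have xm: "(x(k := a)) m = x m" for a using False by simp
    have IH: "wprod \<gamma> ks (x(k := u + v)) = wprod \<gamma> ks (x(k := u)) + wprod \<gamma> ks (x(k := v))"
      by (rule Cons.IH) (use Cons.prems False in auto)
    show ?thesis unfolding wprod_simps xm IH by (rule fs.lin_add[OF lin_cvec])
  qed
qed simp

lemma wprod_upd_smult:
  assumes "distinct ks" "k \<in> set ks"
  shows "wprod \<gamma> ks (x(k := c \<cdot>\<^sub>v u)) = fscale c (wprod \<gamma> ks (x(k := u)))"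
  using assms
proof (induction ks)
  case (Cons m ks)
  show ?case
  proof (cases "k = m")
    case True
    have c: "wprod \<gamma> ks (x(k := a)) = wprod \<gamma> ks x" for a
      using Cons.prems True by (intro wprod_cong) auto
    show ?thesis using True unfolding wprod_simps c by (simp add: cvec_smult)
  next
    case False
    then show ?thesis using Cons by (simp add: wprod_simps fs.lin_scale[OF lin_cvec])
  qed
qed simp

lemma cre_delta_empty: "cre c (delta {}) S = (if S = {c} then csign c {} else 0)"
  by (simp add: cre_delta fscale_apply) (simp add: delta_def)

lemma rho_delta_empty: "rho L n X (delta {}) = 0"
  by (simp add: rho_def eop_def ann_delta)

lemma rho_cre:
  assumes "\<gamma> < L" "i < n"
  shows "rho L n X (cre (\<gamma>, Suc i) f) = cre (\<gamma>, Suc i) (rho L n X f) + (\<Sum>a<n. fscale (X $$ (a, i)) (cre (\<gamma>, Suc a) f))"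
proof -
  have "rho L n X (cre (\<gamma>, Suc i) f) = (\<Sum>a<n. \<Sum>b<n. fscale (X $$ (a, b)) (cre (\<gamma>, Suc i) (eop L (Suc a) (Suc b) f))
      + (if b = i then fscale (X $$ (a, b)) (cre (\<gamma>, Suc a) f) else 0))"
    unfolding rho_def by (intro sum.cong refl) (simp add: eop_cre[OF assms(1)] fs.scale_right_distrib)
  also have "\<dots> = cre (\<gamma>, Suc i) (rho L n X f) + (\<Sum>a<n. fscale (X $$ (a, i)) (cre (\<gamma>, Suc a) f))"
    using assms(2) by (simp add: sum.distrib rho_def fs.lin_map_sum[OF lin_cre] fs.lin_scale[OF lin_cre])
  finally show ?thesis .
qed

lemma rho_cvec:
  assumes "\<gamma> < L" "X \<in> carrier_mat n n" "v \<in> carrier_vec n"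
  shows "rho L n X (cvec \<gamma> v f) = cvec \<gamma> v (rho L n X f) + cvec \<gamma> (X *\<^sub>v v) f"
proof -
  have d: "dim_vec v = n" using assms(3) by simp
  have "rho L n X (cvec \<gamma> v f) = (\<Sum>i<n. fscale (v $ i) (cre (\<gamma>, Suc i) (rho L n X f)) +
      (\<Sum>a<n. fscale (X $$ (a, i) * v $ i) (cre (\<gamma>, Suc a) f)))"
    unfolding cvec_def d fs.lin_map_sum[OF lin_rho]
    by (intro sum.cong refl) (simp add: fs.lin_scale[OF lin_rho] rho_cre[OF assms(1)] fs.scale_right_distrib
        fs.scale_sum_right mult.commute)
  also have "\<dots> = cvec \<gamma> v (rho L n X f) + (\<Sum>a<n. \<Sum>i<n. fscale (X $$ (a, i) * v $ i) (cre (\<gamma>, Suc a) f))"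
    unfolding sum.distrib cvec_def d by (subst sum.swap) simp
  also have "(\<Sum>a<n. \<Sum>i<n. fscale (X $$ (a, i) * v $ i) (cre (\<gamma>, Suc a) f)) = cvec \<gamma> (X *\<^sub>v v) f"
    using assms(2,3) unfolding cvec_def
    by (intro sum.cong) (auto simp: scalar_prod_def atLeast0LessThan fs.scale_sum_left intro!: sum.cong)
  finally show ?thesis .
qed

lemma rho_wprod:
  assumes "\<gamma> < L" "X \<in> carrier_mat n n" "distinct ks" "\<And>k. k \<in> set ks \<Longrightarrow> x k \<in> carrier_vec n"
  shows "(\<Sum>j\<in>set ks. wprod \<gamma> ks (x(j := X *\<^sub>v x j))) = rho L n X (wprod \<gamma> ks x)"
  using assms(3,4)
proof (induction ks)
  case Nil
  then show ?case by (simp add: wprod_simps rho_delta_empty)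
next
  case (Cons k ks)
  have "(\<Sum>j\<in>set ks. wprod \<gamma> (k # ks) (x(j := X *\<^sub>v x j))) = (\<Sum>j\<in>set ks. cvec \<gamma> (x k) (wprod \<gamma> ks (x(j := X *\<^sub>v x j))))"
    using Cons.prems by (intro sum.cong refl) (auto simp: wprod_simps)
  also have "\<dots> = cvec \<gamma> (x k) (\<Sum>j\<in>set ks. wprod \<gamma> ks (x(j := X *\<^sub>v x j)))"
    by (rule fs.lin_map_sum[OF lin_cvec, symmetric])
  also have "(\<Sum>j\<in>set ks. wprod \<gamma> ks (x(j := X *\<^sub>v x j))) = rho L n X (wprod \<gamma> ks x)"
    by (rule Cons.IH) (use Cons.prems in auto)
  finally have 1: "(\<Sum>j\<in>set ks. wprod \<gamma> (k # ks) (x(j := X *\<^sub>v x j))) = cvec \<gamma> (x k) (rho L n X (wprod \<gamma> ks x))" .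
  have "wprod \<gamma> ks (x(k := X *\<^sub>v x k)) = wprod \<gamma> ks x" using Cons.prems by (intro wprod_cong) auto
  then have 2: "wprod \<gamma> (k # ks) (x(k := X *\<^sub>v x k)) = cvec \<gamma> (X *\<^sub>v x k) (wprod \<gamma> ks x)"
    by (simp add: wprod_simps)
  have 3: "(\<Sum>j\<in>insert k (set ks). wprod \<gamma> (k # ks) (x(j := X *\<^sub>v x j))) =
     wprod \<gamma> (k # ks) (x(k := X *\<^sub>v x k)) + (\<Sum>j\<in>set ks. wprod \<gamma> (k # ks) (x(j := X *\<^sub>v x j)))"
    using Cons.prems(1) by (intro sum.insert) auto
  have 4: "rho L n X (wprod \<gamma> (k # ks) x) = cvec \<gamma> (x k) (rho L n X (wprod \<gamma> ks x)) + cvec \<gamma> (X *\<^sub>v x k) (wprod \<gamma> ks x)"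
    unfolding wprod_simps using Cons.prems(2) by (intro rho_cvec[OF assms(1,2)]) simp
  show ?case unfolding list.set 3 1 2 4 by (rule add.commute)
qed

text \<open>Different unit vectors create different cells, so no factor meets an occupied
  one.\<close>

lemma wprod_unit:
  fixes x :: "nat \<Rightarrow> 'k::field vec"
  assumes "\<And>k. k \<in> set ks \<Longrightarrow> x k = unit_vec n (e k) \<and> e k < n" "distinct (map e ks)"
  shows "\<exists>c. c \<noteq> 0 \<and> wprod \<gamma> ks x = fscale c (delta ((\<lambda>k. (\<gamma>, Suc (e k))) ` set ks))"
  using assms
proof (induction ks)
  case Nil
  show ?case by (intro exI[of _ 1]) (simp add: wprod_simps)
next
  case (Cons k ks)
  then obtain c where c: "c \<noteq> 0" "wprod \<gamma> ks x = fscale c (delta ((\<lambda>k. (\<gamma>, Suc (e k))) ` set ks))" by auto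
  let ?S = "(\<lambda>k. (\<gamma>, Suc (e k))) ` set ks"
  have "(\<gamma>, Suc (e k)) \<notin> ?S" using Cons.prems(2) by auto
  then have "wprod \<gamma> (k # ks) x = fscale (c * csign (\<gamma>, Suc (e k)) ?S) (delta (insert (\<gamma>, Suc (e k)) ?S))"
    using Cons.prems(1)[of k] by (simp add: wprod_simps c cvec_unit fs.lin_scale[OF lin_cre] cre_delta)
  moreover have "c * csign (\<gamma>, Suc (e k)) ?S \<noteq> 0" using c(1) csign_neq_0[of _ ?S, where 'a = 'k] by simp
  ultimately show ?case by (intro exI[of _ "c * csign (\<gamma>, Suc (e k)) ?S"]) simp
qed

lemma wprod_supported:
  assumes "\<And>k. k \<in> set ks \<Longrightarrow> x k \<in> carrier_vec n"
  shows "wprod \<gamma> ks x \<in> supported (\<lambda>S. S \<subseteq> {\<gamma>} \<times> {1..n})"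
  using assms
proof (induction ks)
  case Nil
  then show ?case by (simp add: wprod_simps delta_supported)
next
  case (Cons k ks)
  then have "wprod \<gamma> ks x \<in> supported (\<lambda>S. S \<subseteq> {\<gamma>} \<times> {1..n})" by simp
  then have "cre (\<gamma>, Suc i) (wprod \<gamma> ks x) \<in> supported (\<lambda>S. S \<subseteq> {\<gamma>} \<times> {1..n})" if "i < n" for i
    unfolding supported_def mem_Collect_eq
  proof (intro allI impI)
    fix S assume "cre (\<gamma>, Suc i) (wprod \<gamma> ks x) S \<noteq> 0"
    then have "wprod \<gamma> ks x (S - {(\<gamma>, Suc i)}) \<noteq> 0" by (auto simp: cre_def split: if_splits)
    then have "S - {(\<gamma>, Suc i)} \<subseteq> {\<gamma>} \<times> {1..n}" using \<open>wprod \<gamma> ks x \<in> _\<close> by (simp add: supported_def)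
    moreover have "(\<gamma>, Suc i) \<in> {\<gamma>} \<times> {1..n}" using that by simp
    ultimately show "S \<subseteq> {\<gamma>} \<times> {1..n}" by blast
  qed
  then show ?case using Cons.prems[of k] unfolding wprod_simps cvec_def
    by (intro fs.subspace_sum[OF subspace_supported] fs.subspace_scale[OF subspace_supported]) auto
qed

text \<open>Vectors as functions on single cells. This puts the spanning property of unit vectors
  into the form required by \<open>multilinear_straighten\<close>.\<close>

lemma vector_rep_realizes:
  assumes "\<gamma> < L"
  shows "realizes n L (vector_rep n) (\<lambda>v. cvec \<gamma> v (delta {}) :: 'k::field_char_0 fock)"
  unfolding realizes_def lifts_def
proof (intro conjI ballI allI)
  show "inj_on (\<lambda>v. cvec \<gamma> v (delta {}) :: 'k fock) (carrier (vector_rep n))"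
  proof (rule inj_onI)
    fix u v :: "'k vec"
    assume uv: "u \<in> carrier (vector_rep n)" "v \<in> carrier (vector_rep n)"
      and eq: "cvec \<gamma> u (delta {}) = (cvec \<gamma> v (delta {}) :: 'k fock)"
    have val: "cvec \<gamma> v (delta {}) {(\<gamma>, Suc i)} = v $ i * csign (\<gamma>, Suc i) {}" if "i < n" "dim_vec v = n"
      for v :: "'k vec" and i
    proof -
      have "cvec \<gamma> v (delta {}) {(\<gamma>, Suc i)} = (\<Sum>k<n. if k = i then v $ i * csign (\<gamma>, Suc i) {} else 0)"
        unfolding cvec_def sum_eval fscale_apply that(2)
        by (intro sum.cong refl) (auto simp: cre_delta_empty)
      then show ?thesis using that by simp
    qed
    have "u $ i = v $ i" if "i < n" for i
      using fun_cong[OF eq, of "{(\<gamma>, Suc i)}"] uv that csign_neq_0[of "(\<gamma>, Suc i)" "{}", where 'a = 'k]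
      by (simp add: val vector_rep_def)
    then show "u = v" using uv by (intro eq_vecI) (auto simp: vector_rep_def)
  qed
  show "cvec \<gamma> \<zero>\<^bsub>vector_rep n\<^esub> (delta {}) = (0 :: 'k fock)"
    by (simp add: vector_rep_def cvec_def)
  fix u :: "'k vec" assume u: "u \<in> carrier (vector_rep n)"
  show "act (vector_rep n) X u \<in> carrier (vector_rep n)"
    "cvec \<gamma> (act (vector_rep n) X u) (delta {}) = rho L n X (cvec \<gamma> u (delta {}))" if X: "X \<in> borel_alg n" for X
    using u borel_carrier[OF X] by (auto simp: vector_rep_def rho_cvec[OF assms] rho_delta_empty fs.lin_0[OF lin_cvec])
  fix v :: "'k vec" assume v: "v \<in> carrier (vector_rep n)"
  show "\<exists>h\<in>carrier (vector_rep n). h \<oplus>\<^bsub>vector_rep n\<^esub> v = u"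
    using u v by (intro bexI[of _ "u - v"]) (auto simp: vector_rep_def)
  show "cvec \<gamma> (u \<oplus>\<^bsub>vector_rep n\<^esub> v) (delta {}) = cvec \<gamma> u (delta {}) + (cvec \<gamma> v (delta {}) :: 'k fock)"
    using u v by (auto simp: vector_rep_def cvec_add)
qed (auto simp: vector_rep_def cvec_smult)

section \<open>Straightening in exterior powers\<close>

lemma vector_rep_simps:
  "carrier (vector_rep n) = carrier_vec n" "u \<oplus>\<^bsub>vector_rep n\<^esub> v = u + v"
  "c \<odot>\<^bsub>vector_rep n\<^esub> v = c \<cdot>\<^sub>v v" "act (vector_rep n) X v = X *\<^sub>v v"
  by (simp_all add: vector_rep_def)

text \<open>The relation for u + v in both places, expanded multilinearly, gives antisymmetry modulo
  \<open>T\<close>.\<close>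

lemma alternating_swap:
  fixes x :: "nat \<Rightarrow> 'k::field vec"
  assumes T: "psubspace T"
    and rels: "multilinear_rels {..<l} (\<lambda>_. vector_rep n) \<union> alternating_rels l (vector_rep n) \<subseteq> T"
    and x: "x \<in> {..<l} \<rightarrow>\<^sub>E carrier_vec n" and ab: "a < l" "b < l" "a \<noteq> b" and xT: "Poly_Mapping.single x 1 \<in> T"
  shows "Poly_Mapping.single (x \<circ> Transposition.transpose a b) 1 \<in> T"
proof -
  let ?u = "x a" and ?v = "x b"
  let ?s = "\<lambda>s t. Poly_Mapping.single (x(a := s, b := t)) (1 :: 'k)"
  have uv: "?u \<in> carrier_vec n" "?v \<in> carrier_vec n" using x ab by (auto simp: PiE_def Pi_def)
  then have w: "?u + ?v \<in> carrier_vec n" by simp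
  have upd: "x(a := s, b := t) \<in> {..<l} \<rightarrow>\<^sub>E carrier_vec n" if "s \<in> carrier_vec n" "t \<in> carrier_vec n" for s t
    using x ab that by (auto simp: PiE_def Pi_def extensional_def)
  have alt: "?s s s \<in> T" if "s \<in> carrier_vec n" for s
  proof -
    have "?s s s \<in> alternating_rels l (vector_rep n)"
      using upd[OF that that] ab unfolding alternating_rels_def vector_rep_simps by fastforce
    then show ?thesis using rels by blast
  qed
  have ml: "Poly_Mapping.single (y(j := p + q)) 1 - Poly_Mapping.single (y(j := p)) 1 - Poly_Mapping.single (y(j := q)) (1 :: 'k) \<in> T"
    if "y \<in> {..<l} \<rightarrow>\<^sub>E carrier_vec n" "j < l" "p \<in> carrier_vec n" "q \<in> carrier_vec n" for y j p q
  proof -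
    have "Poly_Mapping.single (y(j := p + q)) 1 - Poly_Mapping.single (y(j := p)) 1 - Poly_Mapping.single (y(j := q)) (1 :: 'k)
      \<in> multilinear_rels {..<l} (\<lambda>_. vector_rep n)"
      using that unfolding multilinear_rels_def vector_rep_simps by blast
    then show ?thesis using rels by blast
  qed
  have tw: "x(a := s, b := t) = x(b := t, a := s)" for s t using ab(3) by (rule fun_upd_twist)
  have 1: "?s s (?u + ?v) - ?s s ?u - ?s s ?v \<in> T" if "s \<in> carrier_vec n" for s
    using ml[OF upd[OF that uv(1)] ab(2) uv] by simp
  have 2: "?s (?u + ?v) t - ?s ?u t - ?s ?v t \<in> T" if "t \<in> carrier_vec n" for t
    using ml[OF upd[OF uv(1) that] ab(1) uv] unfolding tw by simp
  have neg: "- p \<in> T" if "p \<in> T" for p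
  proof -
    have "- p = pscale (- 1) p" by (intro poly_mapping_eqI) (simp add: lookup_pscale)
    then show ?thesis using psubspace_scale[OF T that] by simp
  qed
  note add = psubspace_add[OF T]
  have sum: "?s ?v ?u + ?s ?u ?v \<in> T"
  proof -
    \<comment> \<open>From the element with u + v in both places its expansions and the two elements
      with equal entries are removed; the mixed terms remain.\<close>
    have "?s ?v ?u + ?s ?u ?v = ?s (?u + ?v) (?u + ?v) + - (?s (?u + ?v) (?u + ?v) - ?s ?u (?u + ?v) - ?s ?v (?u + ?v))
      + - (?s ?u (?u + ?v) - ?s ?u ?u - ?s ?u ?v) + - (?s ?v (?u + ?v) - ?s ?v ?u - ?s ?v ?v) + - ?s ?u ?u + - ?s ?v ?v"
      by (simp add: algebra_simps)
    also have "\<dots> \<in> T" using alt[OF w] alt[OF uv(1)] alt[OF uv(2)] 1[OF uv(1)] 1[OF uv(2)] 2[OF w]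
      by (intro add neg)
    finally show ?thesis .
  qed
  have e: "x(a := ?u, b := ?v) = x" "x(a := ?v, b := ?u) = x \<circ> Transposition.transpose a b"
    using ab(3) by (auto simp: fun_eq_iff Transposition.transpose_def)
  have "?s ?v ?u = (?s ?v ?u + ?s ?u ?v) + - ?s ?u ?v" by simp
  also have "\<dots> \<in> T"
  proof (rule add[OF sum neg])
    show "?s ?u ?v \<in> T" unfolding e by (rule xT)
  qed
  finally show ?thesis unfolding e .
qed

lemma alternating_permute:
  fixes x :: "nat \<Rightarrow> 'k::field vec"
  assumes T: "psubspace T"
    and rels: "multilinear_rels {..<l} (\<lambda>_. vector_rep n) \<union> alternating_rels l (vector_rep n) \<subseteq> T"
    and p: "p permutes {..<l}"
    and x: "x \<in> {..<l} \<rightarrow>\<^sub>E carrier_vec n" and xT: "Poly_Mapping.single x 1 \<in> T"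
  shows "Poly_Mapping.single (x \<circ> p) 1 \<in> T"
  using p finite_lessThan x xT
proof (induction p arbitrary: x rule: permutes_induct)
  case id
  then show ?case by simp
next
  case (swap a b p)
  let ?t = "Transposition.transpose a b"
  have "x \<circ> ?t \<in> {..<l} \<rightarrow>\<^sub>E carrier_vec n"
    using swap.prems(1) swap.hyps(1,2) by (auto simp: PiE_def Pi_def extensional_def Transposition.transpose_def)
  moreover have "Poly_Mapping.single (x \<circ> ?t) 1 \<in> T"
    using swap.hyps(1-3) swap.prems by (intro alternating_swap[OF T rels]) auto
  ultimately have "Poly_Mapping.single ((x \<circ> ?t) \<circ> p) 1 \<in> T" by (rule swap.IH)
  then show ?case by (simp only: comp_assoc)
qed

text \<open>The standard basis of the exterior power, indexed by sets of l indices.\<close>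

definition sorted_units :: "nat \<Rightarrow> nat \<Rightarrow> nat set \<Rightarrow> nat \<Rightarrow> 'k::field vec" where
  "sorted_units n l A = (\<lambda>k\<in>{..<l}. unit_vec n (sorted_list_of_set A ! k))"

lemma sorted_list_nth:
  assumes "finite A" "card A = l"
  shows "bij_betw (\<lambda>k. sorted_list_of_set A ! k) {..<l} A"
  using bij_betw_nth[of "sorted_list_of_set A" "{..<l}" A] assms by simp

text \<open>A repeated index gives an alternating relation. Otherwise a permutation of the places
  sorts the indices, and \<open>alternating_permute\<close> carries the sorted case over.\<close>

lemma units_straighten:
  fixes e :: "nat \<Rightarrow> nat"
  assumes T: "psubspace T"
    and rels: "multilinear_rels {..<l} (\<lambda>_. vector_rep n) \<union> alternating_rels l (vector_rep n) \<subseteq> T"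
    and base: "\<And>A. A \<subseteq> {..<n} \<Longrightarrow> card A = l \<Longrightarrow> Poly_Mapping.single (sorted_units n l A :: nat \<Rightarrow> 'k::field vec) 1 \<in> T"
    and e: "\<And>k. k < l \<Longrightarrow> e k < n"
  shows "Poly_Mapping.single ((\<lambda>k\<in>{..<l}. unit_vec n (e k)) :: nat \<Rightarrow> 'k vec) 1 \<in> T"
proof (cases "inj_on e {..<l}")
  case False
  then obtain i j where ij: "i < l" "j < l" "i \<noteq> j" "e i = e j" by (auto simp: inj_on_def)
  let ?x = "(\<lambda>k\<in>{..<l}. unit_vec n (e k)) :: nat \<Rightarrow> 'k vec"
  have "?x \<in> {..<l} \<rightarrow>\<^sub>E carrier (vector_rep n)" by (auto simp: vector_rep_simps)
  moreover have "?x i = ?x j" using ij by simp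
  ultimately have "Poly_Mapping.single ?x 1 \<in> alternating_rels l (vector_rep n)"
    using ij(1-3) unfolding alternating_rels_def by blast
  then show ?thesis using rels by blast
next
  case True
  let ?A = "e ` {..<l}"
  let ?E = "\<lambda>k. sorted_list_of_set ?A ! k"
  have A: "?A \<subseteq> {..<n}" "card ?A = l" using e True by (auto simp: card_image)
  have E: "bij_betw ?E {..<l} ?A" using A by (intro sorted_list_nth) auto
  \<comment> \<open>The place that the index \<open>e k\<close> takes in the sorted list; the
    identity elsewhere, as \<open>permutes\<close> demands.\<close>
  define p where "p = (\<lambda>k. if k < l then inv_into {..<l} ?E (e k) else k)"
  have "bij_betw (\<lambda>k. inv_into {..<l} ?E (e k)) {..<l} {..<l}"
    using bij_betw_trans[of e "{..<l}" ?A "inv_into {..<l} ?E" "{..<l}"] bij_betw_inv_into[OF E] True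
    by (simp add: bij_betw_def comp_def)
  then have "bij_betw p {..<l} {..<l}" by (rule bij_betw_cong[THEN iffD1, rotated]) (simp add: p_def)
  then have p: "p permutes {..<l}" by (rule bij_imp_permutes) (simp add: p_def)
  have Ep: "?E (p k) = e k" if "k < l" for k
    using that E f_inv_into_f[of "e k" ?E "{..<l}"] by (auto simp: p_def bij_betw_def)
  have "p k < l \<longleftrightarrow> k < l" for k using permutes_in_image[OF p, of k] by simp
  then have "sorted_units n l ?A \<circ> p = ((\<lambda>k\<in>{..<l}. unit_vec n (e k)) :: nat \<Rightarrow> 'k vec)"
    using Ep by (auto simp: sorted_units_def fun_eq_iff)
  moreover have "(sorted_units n l ?A :: nat \<Rightarrow> 'k vec) \<in> {..<l} \<rightarrow>\<^sub>E carrier_vec n"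
    by (auto simp: sorted_units_def)
  ultimately show ?thesis
    using alternating_permute[OF T rels p _ base[OF A]] by metis
qed

text \<open>Sorted wedges go to nonzero multiples of delta functions at different sets of cells.
  Their independence is then immediate, and \<open>span_eq_kernel\<close> identifies the exterior
  ideal.\<close>

lemma exterior_realizes:
  assumes \<gamma>: "\<gamma> < L"
  shows "\<exists>F. realizes n L (exterior_power l (vector_rep n)) F \<and>
    F ` carrier (exterior_power l (vector_rep n)) \<subseteq> (supported (\<lambda>S. S \<subseteq> {\<gamma>} \<times> {1..n}) :: 'k::field_char_0 fock set) \<and>
    (\<forall>x. (\<forall>k<l. x k \<in> carrier_vec n) \<longrightarrow> wedge l (vector_rep n) x \<in> carrier (exterior_power l (vector_rep n)) \<and>
       F (wedge l (vector_rep n) x) = wprod \<gamma> [0..<l] x)"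
proof -
  let ?M = "\<lambda>_::nat. vector_rep n :: ('k, 'k vec) brep"
  let ?R = "free_rep {..<l} ?M"
  let ?P = "{..<l} \<rightarrow>\<^sub>E (carrier_vec n :: 'k vec set)"
  define G :: "(nat \<Rightarrow> 'k vec) \<Rightarrow> 'k fock" where "G = wprod \<gamma> [0..<l]"
  let ?S = "multilinear_rels {..<l} ?M \<union> alternating_rels l (vector_rep n)"
  have x_in: "x k \<in> carrier_vec n" if "x \<in> ?P" "k < l" for x k using that by (auto simp: PiE_def Pi_def)
  have upd_in: "x(j := a) \<in> ?P" if "x \<in> ?P" "j < l" "a \<in> carrier_vec n" for x j a
    using that by (auto simp: PiE_def Pi_def extensional_def)
  have lifts: "lifts n L ?R (comb G)"
  proof (rule free_rep_lifts)
    show "act (?M j) X a \<in> carrier (?M j)" if "X \<in> borel_alg n" "a \<in> carrier (?M j)" for j X a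
      using that borel_carrier[OF that(1)] by (simp add: vector_rep_simps)
    fix X :: "'k mat" and x :: "nat \<Rightarrow> 'k vec" assume X: "X \<in> borel_alg n" and x: "x \<in> (\<Pi>\<^sub>E j\<in>{..<l}. carrier (?M j))"
    have "(\<Sum>j\<in>set [0..<l]. wprod \<gamma> [0..<l] (x(j := X *\<^sub>v x j))) = rho L n X (wprod \<gamma> [0..<l] x)"
      using x x_in[of x] by (intro rho_wprod \<gamma> borel_carrier[OF X]) (auto simp: vector_rep_simps)
    then show "(\<Sum>j\<in>{..<l}. G (x(j := act (?M j) X (x j)))) = rho L n X (G x)"
      by (simp add: G_def vector_rep_simps atLeast0LessThan)
  qed simp
  have rels: "p \<in> carrier ?R \<and> comb G p = 0" if p: "p \<in> ?S" for p
  proof -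
    consider x j a b where "x \<in> ?P" "j < l" "a \<in> carrier_vec n" "b \<in> carrier_vec n"
        "p = Poly_Mapping.single (x(j := a + b)) 1 - Poly_Mapping.single (x(j := a)) 1 - Poly_Mapping.single (x(j := b)) 1"
      | x j a c where "x \<in> ?P" "j < l" "a \<in> carrier_vec n"
        "p = Poly_Mapping.single (x(j := c \<cdot>\<^sub>v a)) 1 - Poly_Mapping.single (x(j := a)) c"
      | x i j where "x \<in> ?P" "i < l" "j < l" "i \<noteq> j" "x i = x j" "p = Poly_Mapping.single x 1"
      using p unfolding multilinear_rels_def alternating_rels_def vector_rep_simps by blast
    then show ?thesis
    proof cases
      case 1
      have "comb G p = 0" unfolding 1(5) using 1(2)
        by (simp add: comb_diff comb_single G_def wprod_upd_add[OF _ _ 1(3,4)])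
      moreover have "p \<in> carrier ?R" unfolding 1(5) free_rep_simps vector_rep_simps mem_Collect_eq
        using upd_in[OF 1(1,2)] 1(3,4) by (intro keys_diff_subset) simp_all
      ultimately show ?thesis by blast
    next
      case 2
      have "comb G p = 0" unfolding 2(4) using 2(2)
        by (simp add: comb_diff comb_single G_def wprod_upd_smult)
      moreover have "p \<in> carrier ?R" unfolding 2(4) free_rep_simps vector_rep_simps mem_Collect_eq
        using upd_in[OF 2(1,2)] 2(3) by (intro keys_diff_subset) simp_all
      ultimately show ?thesis by blast
    next
      case 3
      have "\<not> distinct (map x [0..<l])"
      proof
        assume "distinct (map x [0..<l])"
        then have "inj_on x {..<l}" by (simp add: distinct_map atLeast0LessThan)
        then show False using 3(2-5) by (auto dest: inj_onD)
      qed
      then have "comb G p = 0" unfolding 3(6) by (simp add: comb_single G_def wprod_alternating)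
      moreover have "p \<in> carrier ?R" unfolding 3(6) free_rep_simps vector_rep_simps using 3(1) by simp
      ultimately show ?thesis by blast
    qed
  qed
  define \<A> where "\<A> = {A. A \<subseteq> {..<n} \<and> card A = l}"
  let ?Reps = "(sorted_units n l :: nat set \<Rightarrow> nat \<Rightarrow> 'k vec) ` \<A>"
  let ?cells = "\<lambda>A. (\<lambda>i. (\<gamma>, Suc i)) ` A"
  have G_rep: "\<exists>c. c \<noteq> 0 \<and> G (sorted_units n l A) = fscale c (delta (?cells A))" if A: "A \<in> \<A>" for A
  proof -
    have fA: "finite A" "card A = l" "A \<subseteq> {..<n}" using A finite_subset[of A "{..<n}"] by (auto simp: \<A>_def)
    note b = sorted_list_nth[OF fA(1,2)]
    have u: "sorted_units n l A k = (unit_vec n (sorted_list_of_set A ! k) :: 'k vec) \<and> sorted_list_of_set A ! k < n" if "k \<in> set [0..<l]" for k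
      using that bij_betwE[OF b] fA(3) by (auto simp: sorted_units_def)
    have "distinct (map (\<lambda>k. sorted_list_of_set A ! k) [0..<l])"
      using b by (simp add: distinct_map bij_betw_def atLeast0LessThan)
    from wprod_unit[OF u this, of \<gamma>] obtain c where
      c: "c \<noteq> 0" "G (sorted_units n l A) = fscale c (delta ((\<lambda>k. (\<gamma>, Suc (sorted_list_of_set A ! k))) ` set [0..<l]))"
      unfolding G_def by blast
    have "(\<lambda>k. (\<gamma>, Suc (sorted_list_of_set A ! k))) ` set [0..<l] = ?cells ((\<lambda>k. sorted_list_of_set A ! k) ` {..<l})"
      by (simp only: image_image set_upt atLeast0LessThan)
    also have "\<dots> = ?cells A" using b by (simp add: bij_betw_def)
    finally show ?thesis using c by auto
  qed
  have ideal: "exterior_ideal l (vector_rep n) = {p \<in> carrier ?R. comb G p = 0}"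
    unfolding exterior_ideal_def
  proof (rule span_eq_kernel[where Reps = ?Reps])
    fix T :: "((nat \<Rightarrow> 'k vec) \<Rightarrow>\<^sub>0 'k) set" and x
    assume T: "psubspace T" "?S \<subseteq> T" "\<And>y. y \<in> ?Reps \<Longrightarrow> Poly_Mapping.single y 1 \<in> T"
      and x: "x \<in> (\<Pi>\<^sub>E j\<in>{..<l}. carrier (?M j))"
    show "Poly_Mapping.single x 1 \<in> T"
    proof (rule multilinear_straighten[where B = "\<lambda>_. unit_vec n ` {..<n}" and J = "{..<l}" and M = ?M])
      show "realizes n L (?M j) (\<lambda>v. cvec \<gamma> v (delta {}))" for j :: nat by (rule vector_rep_realizes[OF \<gamma>])
      show "(\<lambda>v. cvec \<gamma> v (delta {})) ` carrier (?M j) \<subseteq> fs.span ((\<lambda>v. cvec \<gamma> v (delta {})) ` unit_vec n ` {..<n})" for j :: nat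
      proof (rule image_subsetI)
        fix v assume "v \<in> carrier (?M j)"
        then have "cvec \<gamma> v (delta {}) = (\<Sum>i<n. fscale (v $ i) (cvec \<gamma> (unit_vec n i) (delta {})))"
          by (auto simp: cvec_def[of \<gamma> v] vector_rep_simps cvec_unit intro!: sum.cong)
        also have "\<dots> \<in> fs.span ((\<lambda>v. cvec \<gamma> v (delta {})) ` unit_vec n ` {..<n})"
          by (intro fs.span_sum fs.span_scale fs.span_base) auto
        finally show "cvec \<gamma> v (delta {}) \<in> fs.span ((\<lambda>v. cvec \<gamma> v (delta {})) ` unit_vec n ` {..<n})" .
      qed
      show "multilinear_rels {..<l} ?M \<subseteq> T" using T(2) by simp
      fix y :: "nat \<Rightarrow> 'k vec" assume y: "y \<in> {..<l} \<rightarrow>\<^sub>E unit_vec n ` {..<n}"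
      then have "\<forall>k\<in>{..<l}. \<exists>i. y k = unit_vec n i \<and> i < n" by (auto simp: PiE_def Pi_def)
      then obtain e where e: "\<And>k. k < l \<Longrightarrow> y k = unit_vec n (e k) \<and> e k < n" by (metis lessThan_iff)
      have "y = (\<lambda>k\<in>{..<l}. unit_vec n (e k))" using y e by (auto simp: fun_eq_iff PiE_def extensional_def)
      then show "Poly_Mapping.single y 1 \<in> T"
        using units_straighten[OF T(1,2), of e] T(3) e by (auto simp: \<A>_def)
    qed (use T x in \<open>auto simp: vector_rep_simps\<close>)
  next
    fix q :: "(nat \<Rightarrow> 'k vec) \<Rightarrow>\<^sub>0 'k" assume q: "Poly_Mapping.keys q \<subseteq> ?Reps" "comb G q = 0"
    have "Poly_Mapping.lookup q (sorted_units n l A) = 0" if A: "A \<in> \<A>" for A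
    proof (rule ccontr)
      assume n0: "Poly_Mapping.lookup q (sorted_units n l A) \<noteq> 0"
      obtain c where c: "c \<noteq> 0" "G (sorted_units n l A) = fscale c (delta (?cells A))" using G_rep[OF A] by blast
      have "fscale (Poly_Mapping.lookup q x) (G x) (?cells A) = 0"
        if hx: "x \<in> Poly_Mapping.keys q - {sorted_units n l A}" for x
      proof -
        obtain A' where A': "A' \<in> \<A>" "x = sorted_units n l A'" "A' \<noteq> A" using hx q(1) by blast
        then obtain c' where "G x = fscale c' (delta (?cells A'))" using G_rep by blast
        moreover have "?cells A \<noteq> ?cells A'" using A'(3) by (auto simp: inj_image_eq_iff inj_on_def)
        ultimately show ?thesis by (simp add: fscale_apply delta_def)
      qed
      moreover have "sorted_units n l A \<in> Poly_Mapping.keys q" using n0 by (simp add: in_keys_iff)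
      ultimately have "comb G q (?cells A) = fscale (Poly_Mapping.lookup q (sorted_units n l A)) (G (sorted_units n l A)) (?cells A)"
        unfolding comb_def sum_eval by (simp add: sum.remove[of _ "sorted_units n l A"])
      then show False using q(2) n0 c by (simp add: fscale_apply delta_def)
    qed
    then show "q = 0" using q(1) by (intro poly_mapping_eqI) (metis imageE in_keys_iff lookup_zero subsetD)
  qed (use rels in auto)
  note Q = quotient_realizes[OF lifts, folded ideal, folded exterior_power_def]
  have im: "(\<lambda>C. comb G (SOME x. x \<in> C)) ` carrier (exterior_power l (vector_rep n)) \<subseteq> supported (\<lambda>S. S \<subseteq> {\<gamma>} \<times> {1..n})"
    unfolding Q(2)
  proof (rule image_subsetI)
    fix p assume "p \<in> carrier ?R"
    then have p: "Poly_Mapping.keys p \<subseteq> ?P" by (simp add: free_rep_simps vector_rep_simps)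
    have "G x \<in> supported (\<lambda>S. S \<subseteq> {\<gamma>} \<times> {1..n})" if "x \<in> ?P" for x
      unfolding G_def using x_in[OF that] by (intro wprod_supported) auto
    then show "comb G p \<in> supported (\<lambda>S. S \<subseteq> {\<gamma>} \<times> {1..n})"
      unfolding comb_def using p by (intro fs.subspace_sum[OF subspace_supported] fs.subspace_scale[OF subspace_supported]) auto
  qed
  have "wedge l (vector_rep n) x \<in> carrier (exterior_power l (vector_rep n)) \<and>
      comb G (SOME y. y \<in> wedge l (vector_rep n) x) = wprod \<gamma> [0..<l] x" if x: "\<forall>k<l. x k \<in> carrier_vec n" for x :: "nat \<Rightarrow> 'k vec"
  proof -
    have s: "Poly_Mapping.single (restrict x {..<l}) 1 \<in> carrier ?R"
      using x by (auto simp: free_rep_simps vector_rep_simps)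
    then have "wedge l (vector_rep n) x \<in> carrier (exterior_power l (vector_rep n))"
      unfolding wedge_def exterior_power_def quot_rep_def A_RCOSETS_def' by auto
    moreover have "comb G (SOME y. y \<in> wedge l (vector_rep n) x) = G (restrict x {..<l})"
      unfolding wedge_def using Q(3)[OF s] by (simp add: comb_single)
    moreover have "G (restrict x {..<l}) = wprod \<gamma> [0..<l] x" unfolding G_def by (intro wprod_cong) auto
    ultimately show ?thesis by simp
  qed
  then show ?thesis using Q(1) im by (intro exI[of _ "\<lambda>C. comb G (SOME x. x \<in> C)"]) auto
qed

section \<open>Realizing Kraskiewicz--Pragacz modules\<close>

lemma bprod_cong: "(\<And>j. j \<in> J \<Longrightarrow> h j = h' j) \<Longrightarrow> bprod J K h = bprod J K h'"
  by (auto simp: bprod_def intro!: prod.cong)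

lemma bprod_delta:
  assumes J: "finite J" and disj: "\<And>i j. i \<in> J \<Longrightarrow> j \<in> J \<Longrightarrow> i \<noteq> j \<Longrightarrow> K i \<inter> K j = {}"
    and T: "\<And>j. j \<in> J \<Longrightarrow> T j \<subseteq> K j \<times> UNIV"
  shows "bprod J K (\<lambda>j. fscale (c j) (delta (T j))) = fscale (\<Prod>j\<in>J. c j) (delta (\<Union>j\<in>J. T j))"
proof
  fix S
  have T_int: "(\<Union>i\<in>J. T i) \<inter> (K j \<times> UNIV) = T j" if "j \<in> J" for j
    using that T disj by blast
  show "bprod J K (\<lambda>j. fscale (c j) (delta (T j))) S = fscale (\<Prod>j\<in>J. c j) (delta (\<Union>j\<in>J. T j)) S"
  proof (cases "S = (\<Union>j\<in>J. T j)")
    case True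
    have "S \<subseteq> (\<Union>j\<in>J. K j) \<times> UNIV" unfolding True using T by blast
    then show ?thesis using T_int unfolding True bprod_def
      by (auto simp: fscale_apply delta_def intro!: prod.cong)
  next
    case False
    have "\<exists>j\<in>J. S \<inter> (K j \<times> UNIV) \<noteq> T j" if "S \<subseteq> (\<Union>j\<in>J. K j) \<times> UNIV"
    proof (rule ccontr)
      assume "\<not> ?thesis"
      then have "S \<inter> (K j \<times> UNIV) = T j" if "j \<in> J" for j using that by blast
      then have "(\<Union>j\<in>J. S \<inter> (K j \<times> UNIV)) = (\<Union>j\<in>J. T j)" by simp
      moreover have "(\<Union>j\<in>J. S \<inter> (K j \<times> UNIV)) = S" using \<open>S \<subseteq> _\<close> by auto
      ultimately show False using False by simp
    qed
    then have "bprod J K (\<lambda>j. fscale (c j) (delta (T j))) S = 0"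
      unfolding bprod_def using J by (auto simp: fscale_apply delta_def intro!: prod_zero)
    then show ?thesis using False by (simp add: fscale_apply delta_def)
  qed
qed

section \<open>Upper triangular matrices and row operators generate the same orbits\<close>

lemma rho_closed:
  assumes "fs.subspace W" "\<And>e y. e \<in> row_ops L \<Longrightarrow> y \<in> W \<Longrightarrow> e y \<in> W" "n < L"
    and X: "X \<in> borel_alg n" and "y \<in> W"
  shows "rho L n X y \<in> W"
  unfolding rho_def
proof (intro fs.subspace_sum[OF assms(1)])
  fix a b assume ab: "a \<in> {..<n}" "b \<in> {..<n}"
  show "fscale (X $$ (a, b)) (eop L (Suc a) (Suc b) y) \<in> W"
  proof (cases "a \<le> b")
    case True
    then have "eop L (Suc a) (Suc b) \<in> row_ops L" using ab assms(3) unfolding row_ops_def by fastforce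
    then show ?thesis using assms(2,5) by (intro fs.subspace_scale[OF assms(1)]) blast
  next
    case False
    then have "X $$ (a, b) = 0" using X ab by (auto simp: borel_alg_def upper_triangular_def)
    then show ?thesis using fs.subspace_0[OF assms(1)] by simp
  qed
qed

lemma rho_unit:
  assumes "a < n" "b < n"
  shows "rho L n (mat n n (\<lambda>(i, j). if i = a \<and> j = b then 1 else 0)) f = eop L (Suc a) (Suc b) f"
proof -
  have "rho L n (mat n n (\<lambda>(i, j). if i = a \<and> j = b then 1 else 0)) f =
    (\<Sum>i<n. \<Sum>j<n. if j = b then (if i = a then eop L (Suc a) (Suc b) f else 0) else 0)"
    unfolding rho_def by (intro sum.cong refl) auto
  also have "\<dots> = eop L (Suc a) (Suc b) f" using assms by simp
  finally show ?thesis .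
qed

text \<open>For b \<le> n the operator \<open>e\<^sub>a\<^sub>b\<close> is the action of a matrix
  unit. For b > n it kills everything in sight, since rows beyond \<open>n\<close> stay empty; the
  support condition is carried through the induction for this purpose.\<close>

lemma rho_orbit:
  assumes v: "v \<in> supported (\<lambda>S. \<forall>(j, i)\<in>S. i \<le> n)" and n: "n < L"
  shows "fs.orbit (rho L n ` borel_alg n) v = fs.orbit (row_ops L) v"
proof
  show "fs.orbit (rho L n ` borel_alg n) v \<subseteq> fs.orbit (row_ops L) v"
  proof (rule fs.orbit_subset[OF fs.subspace_orbit fs.orbit_base])
    fix e :: "'a fock \<Rightarrow> 'a fock" and x assume e: "e \<in> rho L n ` borel_alg n" and x: "x \<in> fs.orbit (row_ops L) v"
    obtain X where X: "e = rho L n X" "X \<in> borel_alg n" using e by blast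
    show "e x \<in> fs.orbit (row_ops L) v"
      unfolding X(1) by (rule rho_closed[OF fs.subspace_orbit _ n X(2) x]) (rule fs.orbit_closed)
  qed
  let ?W = "fs.orbit (rho L n ` borel_alg n) v \<inter> supported (\<lambda>S. \<forall>(j, i)\<in>S. i \<le> n)"
  have "fs.orbit (row_ops L) v \<subseteq> ?W"
  proof (rule fs.orbit_subset)
    show "fs.subspace ?W" by (intro fs.subspace_inter fs.subspace_orbit subspace_supported)
    show "v \<in> ?W" using v fs.orbit_base by blast
    fix e :: "'a fock \<Rightarrow> 'a fock" and x assume e: "e \<in> row_ops L" and x: "x \<in> ?W"
    obtain a b where ab: "e = eop L a b" "1 \<le> a" "a \<le> b" "b < L" using e by (auto simp: row_ops_def)
    have "e x \<in> supported (\<lambda>S. \<forall>(j, i)\<in>S. i \<le> n)"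
      unfolding ab(1) by (rule eop_supported) (use ab x in fastforce)+
    moreover have "e x \<in> fs.orbit (rho L n ` borel_alg n) v"
    proof (cases "b \<le> n")
      case True
      let ?X = "mat n n (\<lambda>(i, j). if i = a - 1 \<and> j = b - 1 then 1 else 0) :: 'a mat"
      have "?X \<in> borel_alg n" using ab by (auto simp: borel_alg_def upper_triangular_def)
      then have "rho L n ?X x \<in> fs.orbit (rho L n ` borel_alg n) v"
        by (rule fs.orbit_closed[OF imageI IntD1[OF x]])
      moreover have "rho L n ?X x = e x" using rho_unit[of "a - 1" n "b - 1" L x] ab True by simp
      ultimately show ?thesis by simp
    next
      case False
      have "cre (j, a) (ann (j, b) x) = 0" for j
      proof
        fix S
        have "x (insert (j, b) (S - {(j, a)})) = 0" using x False unfolding supported_def by fastforce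
        then show "cre (j, a) (ann (j, b) x) S = 0 S" by (simp add: hop_apply)
      qed
      then have "e x = 0" by (simp add: ab(1) eop_def)
      then show ?thesis using fs.subspace_0[OF fs.subspace_orbit] by simp
    qed
    ultimately show "e x \<in> ?W" by blast
  qed
  then show "fs.orbit (row_ops L) v \<subseteq> fs.orbit (rho L n ` borel_alg n) v" by blast
qed

text \<open>Each side contains the other by minimality: the span of the words is stable, as applying
  \<open>X\<close> only lengthens a word, and the orbit contains every word applied to the
  generator.\<close>

lemma U_orbit_image:
  fixes M :: "('k::field, 'v) brep"
  assumes f: "realizes n L M f" and u: "u \<in> carrier M"
  shows "U_orbit n M u \<subseteq> carrier M" and "f ` U_orbit n M u = fs.orbit (rho L n ` borel_alg n) (f u)"
proof -
  note R = realizes_simps[OF f]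
  have mod: "module class_ring M" by (rule realizes_module[OF f])
  interpret m: Module.module class_ring M by (rule mod)
  let ?S = "{foldr (act M) Xs u | Xs. set Xs \<subseteq> borel_alg n}"
  have S_car: "?S \<subseteq> carrier M"
  proof clarify
    fix Xs :: "'k mat list" assume "set Xs \<subseteq> borel_alg n"
    then show "foldr (act M) Xs u \<in> carrier M" by (induction Xs) (auto simp: u R)
  qed
  let ?U = "U_orbit n M u" and ?O = "fs.orbit (rho L n ` borel_alg n) (f u)"
  have U: "submodule class_ring ?U M" unfolding U_orbit_def by (rule m.span_is_submodule[OF S_car])
  have SU: "?S \<subseteq> ?U" unfolding U_orbit_def by (rule m.in_own_span[OF S_car])
  have min: "?U \<subseteq> N" if "?S \<subseteq> N" "submodule class_ring N M" for N
    unfolding U_orbit_def by (rule m.span_is_subset[OF that])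
  show Uc: "?U \<subseteq> carrier M" using U by (simp add: submodule_def)
  have "?U \<subseteq> {x \<in> carrier M. f x \<in> ?O}"
  proof (rule min)
    show "submodule class_ring {x \<in> carrier M. f x \<in> ?O} M"
      unfolding submodule_def using mod fs.subspace_0[OF fs.subspace_orbit] fs.subspace_add[OF fs.subspace_orbit]
        fs.subspace_scale[OF fs.subspace_orbit] by (auto simp: R)
    have "f (foldr (act M) Xs u) \<in> ?O" if "set Xs \<subseteq> borel_alg n" for Xs
      using that
    proof (induction Xs)
      case Nil then show ?case using fs.orbit_base by simp
    next
      case (Cons X Xs)
      have c: "foldr (act M) Xs u \<in> carrier M" using S_car Cons.prems by auto
      have X: "X \<in> borel_alg n" and IH: "f (foldr (act M) Xs u) \<in> ?O" using Cons by auto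
      have "f (act M X (foldr (act M) Xs u)) \<in> ?O"
        unfolding lifts_act(2)[OF realizes_lifts[OF f] X c] by (rule fs.orbit_closed[OF imageI[OF X] IH])
      then show ?case by simp
    qed
    then show "?S \<subseteq> {x \<in> carrier M. f x \<in> ?O}" using S_car by blast
  qed
  then have 1: "f ` ?U \<subseteq> ?O" by blast
  have act: "act M X x \<in> ?U" if X: "X \<in> borel_alg n" and "x \<in> ?U" for X x
  proof -
    have lin: "act M X (x \<oplus>\<^bsub>M\<^esub> y) = act M X x \<oplus>\<^bsub>M\<^esub> act M X y" "act M X (c \<odot>\<^bsub>M\<^esub> x) = c \<odot>\<^bsub>M\<^esub> act M X x"
      if "x \<in> carrier M" "y \<in> carrier M" for x y c
      using that X by (auto intro!: realizes_eqI[OF f] simp: R fs.lin_add[OF lin_rho] fs.lin_scale[OF lin_rho])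
    have zero: "act M X \<zero>\<^bsub>M\<^esub> = \<zero>\<^bsub>M\<^esub>"
      using X by (auto intro!: realizes_eqI[OF f] simp: R fs.lin_0[OF lin_rho])
    have "?U \<subseteq> {x \<in> carrier M. act M X x \<in> ?U}"
    proof (rule min)
      show "submodule class_ring {x \<in> carrier M. act M X x \<in> ?U} M"
        using U unfolding submodule_def by (auto simp: R lin zero)
      have "act M X (foldr (act M) Xs u) \<in> ?U" if "set Xs \<subseteq> borel_alg n" for Xs
      proof -
        have "act M X (foldr (act M) Xs u) = foldr (act M) (X # Xs) u" by simp
        also have "\<dots> \<in> ?S" using that X by (intro CollectI exI[of _ "X # Xs"]) auto
        finally show ?thesis using SU by blast
      qed
      then show "?S \<subseteq> {x \<in> carrier M. act M X x \<in> ?U}" using S_car by blast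
    qed
    then show ?thesis using that by blast
  qed
  have "fs.subspace (f ` ?U)"
  proof -
    have "lifts n L (M\<lparr>carrier := carrier M\<rparr>) f" using realizes_lifts[OF f] by simp
    have z: "f \<zero>\<^bsub>M\<^esub> \<in> f ` ?U" using U by (simp add: submodule_def)
    show ?thesis
    proof (rule fs.subspaceI)
      show "0 \<in> f ` ?U" using z by (simp add: R)
      fix x assume "x \<in> f ` ?U"
      then obtain a where a: "a \<in> ?U" "x = f a" by blast
      have "c \<odot>\<^bsub>M\<^esub> a \<in> ?U" for c using U a(1) by (simp add: submodule_def)
      then show "fscale c x \<in> f ` ?U" for c using a Uc by (intro image_eqI[of _ _ "c \<odot>\<^bsub>M\<^esub> a"]) (auto simp: R)
      fix y assume "y \<in> f ` ?U"
      then obtain b where b: "b \<in> ?U" "y = f b" by blast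
      have "a \<oplus>\<^bsub>M\<^esub> b \<in> ?U" using U a(1) b(1) by (simp add: submodule_def)
      then show "x + y \<in> f ` ?U" using a(2) b(2) subsetD[OF Uc a(1)] subsetD[OF Uc b(1)]
        by (intro image_eqI[of _ _ "a \<oplus>\<^bsub>M\<^esub> b"]) (auto simp: R)
    qed
  qed
  moreover have "u \<in> ?U" using SU by (auto intro!: exI[of _ "[]"])
  ultimately have "?O \<subseteq> f ` ?U"
  proof (intro fs.orbit_subset)
    fix e :: "'k fock \<Rightarrow> 'k fock" and y assume "e \<in> rho L n ` borel_alg n" "y \<in> f ` ?U"
    then obtain X x where "e = rho L n X" "X \<in> borel_alg n" "x \<in> ?U" "y = f x" by blast
    then show "e y \<in> f ` ?U" using act[of X x] Uc by (intro image_eqI[of _ _ "act M X x"]) (auto simp: R)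
  qed auto
  then show "f ` ?U = ?O" using 1 by blast
qed

text \<open>Each exterior factor gets a column of its own, which makes the blocks of
  \<open>tensor_realizes\<close> disjoint. The relabelling \<gamma> allows both the natural
  placement and a collapse of a single column to column 0.\<close>

lemma KP_ambient_realizes:
  assumes w: "w permutes {1..N}" and rows: "\<And>j i. i \<in> inv_set w j \<Longrightarrow> i \<le> n"
    and \<gamma>: "inj_on \<gamma> (inv_support w)" "\<And>j. j \<in> inv_support w \<Longrightarrow> \<gamma> j < L"
  shows "\<exists>F. realizes n L (KP_ambient n w :: ('k::field_char_0, 'k kp) brep) F \<and>
    F ` carrier (KP_ambient n w) \<subseteq> (supported (\<lambda>S. S \<subseteq> \<gamma> ` inv_support w \<times> {1..n}) :: 'k fock set) \<and>
    KP_gen n w \<in> carrier (KP_ambient n w :: ('k, 'k kp) brep) \<and>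
    (\<exists>c. c \<noteq> 0 \<and> F (KP_gen n w) = fscale c (delta ((\<lambda>(j, i). (\<gamma> j, i)) ` cells w)))"
proof -
  let ?J = "inv_support w"
  let ?V = "vector_rep n :: ('k, 'k vec) brep"
  have J_sub: "?J \<subseteq> {1..N}"
    using cells_subset[OF w] by (force simp: inv_support_def cells_def)
  have finJ: "finite ?J" using J_sub by (rule finite_subset) simp
  have inv: "finite (inv_set w j)" "inv_set w j \<subseteq> {1..n}" for j
  proof -
    show "inv_set w j \<subseteq> {1..n}" using rows[of _ j] by (auto simp: inv_set_def)
    then show "finite (inv_set w j)" by (rule finite_subset) simp
  qed
  have "\<exists>F. realizes n L (KP_factor n w j) F \<and>
    F ` carrier (KP_factor n w j) \<subseteq> (supported (\<lambda>S. S \<subseteq> {\<gamma> j} \<times> {1..n}) :: 'k fock set) \<and>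
    (\<forall>x. (\<forall>k<card (inv_set w j). x k \<in> carrier_vec n) \<longrightarrow> wedge (card (inv_set w j)) ?V x \<in> carrier (KP_factor n w j) \<and>
       F (wedge (card (inv_set w j)) ?V x) = wprod (\<gamma> j) [0..<card (inv_set w j)] x)" if "j \<in> ?J" for j
    unfolding KP_factor_def by (rule exterior_realizes[OF \<gamma>(2)[OF that]])
  then obtain f where f: "\<And>j. j \<in> ?J \<Longrightarrow> realizes n L (KP_factor n w j) (f j)"
    "\<And>j. j \<in> ?J \<Longrightarrow> f j ` carrier (KP_factor n w j) \<subseteq> (supported (\<lambda>S. S \<subseteq> {\<gamma> j} \<times> {1..n}) :: 'k fock set)"
    "\<And>j x. j \<in> ?J \<Longrightarrow> (\<And>k. k < card (inv_set w j) \<Longrightarrow> x k \<in> carrier_vec n) \<Longrightarrow>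
       wedge (card (inv_set w j)) ?V x \<in> carrier (KP_factor n w j) \<and>
       f j (wedge (card (inv_set w j)) ?V x) = wprod (\<gamma> j) [0..<card (inv_set w j)] x"
    by metis
  let ?K = "\<lambda>j. {\<gamma> j}"
  let ?G = "\<lambda>x. bprod ?J ?K (\<lambda>j. f j (x j))"
  let ?P = "\<Pi>\<^sub>E j\<in>?J. carrier (KP_factor n w j :: ('k, 'k ext) brep)"
  have disj: "?K i \<inter> ?K j = {}" if "i \<in> ?J" "j \<in> ?J" "i \<noteq> j" for i j
    using that \<gamma>(1) by (auto dest: inj_onD)
  have "\<exists>F. realizes n L (KP_ambient n w) F \<and> F ` carrier (KP_ambient n w) = fs.span (?G ` ?P) \<and>
      (\<forall>x\<in>?P. pure_tensor ?J (KP_factor n w) x \<in> carrier (KP_ambient n w) \<and> F (pure_tensor ?J (KP_factor n w) x) = ?G x)"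
    unfolding KP_ambient_def
  proof (rule tensor_realizes[OF finJ, of ?K n L "KP_factor n w" f])
    show "?K i \<inter> ?K j = {}" if "i \<in> ?J" "j \<in> ?J" "i \<noteq> j" for i j by (rule disj[OF that])
    show "realizes n L (KP_factor n w j) (f j)" if "j \<in> ?J" for j by (rule f(1)[OF that])
    show "f j ` carrier (KP_factor n w j) \<subseteq> in_block (?K j)" if "j \<in> ?J" for j
    proof -
      have "supported (\<lambda>S. S \<subseteq> {\<gamma> j} \<times> {1..n}) \<subseteq> (in_block (?K j) :: 'k fock set)"
        unfolding supported_def by blast
      then show ?thesis using f(2)[OF that] by (rule order_trans[rotated])
    qed
    show "\<exists>C. finite C \<and> f j ` carrier (KP_factor n w j) \<subseteq> fs.span C" if "j \<in> ?J" for j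
    proof -
      have "finite ({\<gamma> j} \<times> {1..n})" by simp
      then have "f j ` carrier (KP_factor n w j) \<subseteq> fs.span (delta ` Pow ({\<gamma> j} \<times> {1..n}))"
        by (rule order_trans[OF f(2)[OF that] supported_subset_span])
      moreover have "finite (delta ` Pow ({\<gamma> j} \<times> {1..n}) :: 'k fock set)" by simp
      ultimately show ?thesis by blast
    qed
  qed
  then obtain F where F: "realizes n L (KP_ambient n w) F" "F ` carrier (KP_ambient n w) = fs.span (?G ` ?P)"
    "\<And>x. x \<in> ?P \<Longrightarrow> pure_tensor ?J (KP_factor n w) x \<in> carrier (KP_ambient n w) \<and> F (pure_tensor ?J (KP_factor n w) x) = ?G x"
    by (elim exE conjE) (rule that, assumption+, erule (1) bspec)
  have "?G x \<in> supported (\<lambda>S. S \<subseteq> \<gamma> ` ?J \<times> {1..n})" if x: "x \<in> ?P" for x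
    unfolding supported_def mem_Collect_eq
  proof (intro allI impI)
    fix S assume S: "?G x S \<noteq> 0"
    then have sub: "S \<subseteq> (\<Union>j\<in>?J. ?K j) \<times> UNIV" by (auto simp: bprod_def split: if_splits)
    have "S \<inter> (?K j \<times> UNIV) \<subseteq> {\<gamma> j} \<times> {1..n}" if j: "j \<in> ?J" for j
    proof -
      have "f j (x j) (S \<inter> (?K j \<times> UNIV)) \<noteq> 0"
        using S sub finJ j by (auto simp: bprod_def)
      moreover have "f j (x j) \<in> supported (\<lambda>S. S \<subseteq> {\<gamma> j} \<times> {1..n})"
        using f(2)[OF j] x j by (auto simp: PiE_def Pi_def)
      ultimately show ?thesis unfolding supported_def by blast
    qed
    then show "S \<subseteq> \<gamma> ` ?J \<times> {1..n}" using sub by fastforce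
  qed
  then have supp: "F ` carrier (KP_ambient n w) \<subseteq> supported (\<lambda>S. S \<subseteq> \<gamma> ` ?J \<times> {1..n})"
    unfolding F(2) by (intro fs.span_minimal subspace_supported) blast
  have "\<exists>c. KP_factor_gen n w j \<in> carrier (KP_factor n w j :: ('k, 'k ext) brep) \<and> c \<noteq> 0 \<and>
     f j (KP_factor_gen n w j) = fscale c (delta ({\<gamma> j} \<times> inv_set w j))" if j: "j \<in> ?J" for j
  proof -
    let ?l = "card (inv_set w j)" and ?E = "\<lambda>k. sorted_list_of_set (inv_set w j) ! k"
    let ?x = "\<lambda>k. basis_vec n (?E k) :: 'k vec"
    note b = sorted_list_nth[OF inv(1)[of j] refl]
    have E: "?E k \<in> inv_set w j" "1 \<le> ?E k" "?E k \<le> n" if "k < ?l" for k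
    proof -
      show "?E k \<in> inv_set w j" using bij_betwE[OF b] that by auto
      then show "1 \<le> ?E k" "?E k \<le> n" using inv(2)[of j] by auto
    qed
    have u: "?x k = unit_vec n (?E k - 1) \<and> ?E k - 1 < n" if "k \<in> set [0..<?l]" for k
    proof -
      have "k < ?l" using that by simp
      from E(2,3)[OF this] show ?thesis by (simp add: basis_vec_def)
    qed
    have "inj_on (\<lambda>k. ?E k - 1) {..<?l}"
    proof (rule inj_onI)
      fix a b' assume ab: "a \<in> {..<?l}" "b' \<in> {..<?l}" "?E a - 1 = ?E b' - 1"
      then have "?E a = ?E b'" using E(2)[of a] E(2)[of b'] by simp
      then show "a = b'" using b ab by (auto simp: bij_betw_def dest: inj_onD)
    qed
    then have d: "distinct (map (\<lambda>k. ?E k - 1) [0..<?l])" by (simp add: distinct_map atLeast0LessThan)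
    obtain c where c: "c \<noteq> 0" "wprod (\<gamma> j) [0..<?l] ?x = fscale c (delta ((\<lambda>k. (\<gamma> j, Suc (?E k - 1))) ` set [0..<?l]))"
      using wprod_unit[OF u d, of "\<gamma> j"] by blast
    \<comment> \<open>\<open>basis_vec\<close> lowers the index by one and \<open>cvec\<close>
      raises it again; rows are at least 1, so the truncated subtraction loses nothing.\<close>
    have "(\<lambda>k. (\<gamma> j, Suc (?E k - 1))) ` set [0..<?l] = (\<lambda>k. (\<gamma> j, ?E k)) ` {..<?l}"
    proof (rule image_cong)
      fix k assume "k \<in> {..<?l}"
      then show "(\<gamma> j, Suc (?E k - 1)) = (\<gamma> j, ?E k)" using E(2)[of k] by simp
    qed (simp add: atLeast0LessThan)
    also have "\<dots> = Pair (\<gamma> j) ` (?E ` {..<?l})" by (simp only: image_image)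
    also have "\<dots> = {\<gamma> j} \<times> inv_set w j" using b by (auto simp: bij_betw_def)
    finally have set: "(\<lambda>k. (\<gamma> j, Suc (?E k - 1))) ` set [0..<?l] = {\<gamma> j} \<times> inv_set w j" .
    have "?x k \<in> carrier_vec n" for k by (simp add: basis_vec_def)
    then show ?thesis using f(3)[OF j, of ?x] c unfolding KP_factor_gen_def set by auto
  qed
  then obtain c where c: "\<And>j. j \<in> ?J \<Longrightarrow> KP_factor_gen n w j \<in> carrier (KP_factor n w j :: ('k, 'k ext) brep)"
    "\<And>j. j \<in> ?J \<Longrightarrow> c j \<noteq> 0" "\<And>j. j \<in> ?J \<Longrightarrow> f j (KP_factor_gen n w j) = fscale (c j) (delta ({\<gamma> j} \<times> inv_set w j))"
    by metis
  have g: "(\<lambda>j\<in>?J. KP_factor_gen n w j) \<in> ?P" using c(1) by auto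
  have "?G (\<lambda>j\<in>?J. KP_factor_gen n w j) = bprod ?J ?K (\<lambda>j. fscale (c j) (delta ({\<gamma> j} \<times> inv_set w j)))"
    by (rule bprod_cong) (simp add: c(3))
  also have "\<dots> = fscale (\<Prod>j\<in>?J. c j) (delta (\<Union>j\<in>?J. {\<gamma> j} \<times> inv_set w j))"
    by (rule bprod_delta[OF finJ disj]) auto
  also have "(\<Union>j\<in>?J. {\<gamma> j} \<times> inv_set w j) = (\<lambda>(j, i). (\<gamma> j, i)) ` cells w"
    by (auto simp: inv_support_def cells_def image_iff)
  finally have "F (KP_gen n w) = fscale (\<Prod>j\<in>?J. c j) (delta ((\<lambda>(j, i). (\<gamma> j, i)) ` cells w))"
    using F(3)[OF g] by (simp add: KP_gen_def)
  moreover have "(\<Prod>j\<in>?J. c j) \<noteq> 0" using finJ c(2) by simp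
  moreover have "KP_gen n w \<in> carrier (KP_ambient n w :: ('k, 'k kp) brep)"
    using F(3)[OF g] by (simp add: KP_gen_def)
  ultimately show ?thesis using F(1) supp by (intro exI conjI) assumption+
qed

lemma KP_module_realizes:
  assumes w: "w permutes {1..N}" and rows: "\<And>j i. i \<in> inv_set w j \<Longrightarrow> i \<le> n" and n: "n < L"
    and \<gamma>: "inj_on \<gamma> (inv_support w)" "\<And>j. j \<in> inv_support w \<Longrightarrow> \<gamma> j < L"
  shows "\<exists>f. realizes n L (KP_module n w :: ('k::field_char_0, 'k kp) brep) f \<and>
    f ` carrier (KP_module n w :: ('k, 'k kp) brep) = fs.orbit (row_ops L) (delta ((\<lambda>(j, i). (\<gamma> j, i)) ` cells w)) \<and>
    f ` carrier (KP_module n w :: ('k, 'k kp) brep) \<subseteq> supported (\<lambda>S. S \<subseteq> \<gamma> ` inv_support w \<times> {1..n})"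
proof -
  let ?A = "KP_ambient n w :: ('k, 'k kp) brep"
  let ?d = "delta ((\<lambda>(j, i). (\<gamma> j, i)) ` cells w) :: 'k fock"
  obtain F c where F: "realizes n L ?A F" "F ` carrier ?A \<subseteq> supported (\<lambda>S. S \<subseteq> \<gamma> ` inv_support w \<times> {1..n})"
    "KP_gen n w \<in> carrier ?A" "c \<noteq> 0" "F (KP_gen n w) = fscale c ?d"
  proof -
    have "\<exists>F. realizes n L ?A F \<and> F ` carrier ?A \<subseteq> supported (\<lambda>S. S \<subseteq> \<gamma> ` inv_support w \<times> {1..n}) \<and>
      KP_gen n w \<in> carrier ?A \<and> (\<exists>c. c \<noteq> 0 \<and> F (KP_gen n w) = fscale c ?d)"
      by (rule KP_ambient_realizes[OF w]) (erule rows \<gamma>(2) | rule \<gamma>(1))+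
    then show thesis using that by blast
  qed
  note U = U_orbit_image[OF F(1,3)]
  have "?d \<in> supported (\<lambda>S. \<forall>(j, i)\<in>S. i \<le> n)"
    using rows by (intro delta_supported) (auto simp: cells_def)
  then have im: "F ` U_orbit n ?A (KP_gen n w) = fs.orbit (row_ops L) ?d"
    unfolding U(2) F(5) fs.orbit_scale[OF F(4)] using n by (rule rho_orbit)
  have "realizes n L (?A\<lparr>carrier := U_orbit n ?A (KP_gen n w)\<rparr>) F"
  proof (rule realizes_restrict(1)[OF F(1) U(1)])
    show "fs.subspace (F ` U_orbit n ?A (KP_gen n w))" unfolding im by (rule fs.subspace_orbit)
    show "rho L n X y \<in> F ` U_orbit n ?A (KP_gen n w)" if "X \<in> borel_alg n" "y \<in> F ` U_orbit n ?A (KP_gen n w)" for X y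
      using that(2) unfolding U(2) by (rule fs.orbit_closed[OF imageI[OF that(1)]])
  qed
  then show ?thesis using im F(2) U(1) unfolding KP_module_def by (intro exI[of _ F]) auto
qed

section \<open>The tensor product with the module of a simple transposition\<close>

lemma S_infty_n_permutes:
  assumes "w \<in> S_infty_n n"
  obtains N where "n \<le> N" "w permutes {1..N}"
proof -
  have w: "w permutes {1..}" and fin: "finite {i. w i \<noteq> i}"
    using assms by (auto simp: S_infty_n_def S_infty_def)
  obtain N0 where N0: "\<And>i. w i \<noteq> i \<Longrightarrow> i \<le> N0"
    using fin finite_nat_set_iff_bounded_le[of "{i. w i \<noteq> i}"] by auto
  have "w permutes {1..max n N0}"
  proof (rule permutes_superset[OF w])
    show "w i = i" if "i \<in> {1..} - {1..max n N0}" for i using that N0[of i] by (cases "w i = i") auto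
  qed
  then show thesis by (intro that[of "max n N0"]) simp
qed

lemma S_infty_n_rows:
  assumes "w \<in> S_infty_n n" "i \<in> inv_set w j" shows "i \<le> n"
proof (rule ccontr)
  assume "\<not> i \<le> n"
  moreover have "i < j" "w j < w i" using assms(2) by (auto simp: inv_set_def)
  moreover have "strict_mono_on {n + 1..} w" using assms(1) by (simp add: S_infty_n_def)
  ultimately have "w i < w j" by (intro strict_mono_onD[of "{n + 1..}" w]) auto
  with \<open>w j < w i\<close> show False by simp
qed

text \<open>Beyond \<open>n\<close> only position \<open>q\<close> can change. It receives the
  smaller value \<open>w p\<close>, which is harmless to its right. An entry between
  \<open>n\<close> and \<open>q\<close> has value below \<open>w q\<close>, hence below
  \<open>w p\<close> by the cover condition.\<close>

lemma S_infty_n_cover: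
  assumes w: "w \<in> S_infty_n n" and pq: "(p, q) \<in> covers \<nu> w" and \<nu>: "\<nu> \<le> n"
  shows "w \<circ> Transposition.transpose p q \<in> S_infty_n n"
proof -
  let ?t = "Transposition.transpose p q"
  have perm: "w permutes {1..}" and fin: "finite {i. w i \<noteq> i}" and mono: "strict_mono_on {n + 1..} w"
    using w by (auto simp: S_infty_n_def S_infty_def)
  have p: "1 \<le> p" "p \<le> n" "p < q" "w p < w q"
    and c: "\<And>i. p < i \<Longrightarrow> i < q \<Longrightarrow> \<not> (w p < w i \<and> w i < w q)"
    using pq \<nu> by (auto simp: covers_def cover_def)
  have less: "w i < w j" if "n < i" "i < j" for i j using that by (intro strict_mono_onD[OF mono]) auto
  have "w \<circ> ?t permutes {1..}" using p by (intro permutes_compose[OF permutes_swap_id perm]) auto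
  moreover have "finite {i. (w \<circ> ?t) i \<noteq> i}"
    by (rule finite_subset[of _ "{i. w i \<noteq> i} \<union> {p, q}"]) (auto simp: fin Transposition.transpose_def)
  moreover have "strict_mono_on {n + 1..} (w \<circ> ?t)"
  proof (rule strict_mono_onI)
    fix r s assume "r \<in> {n + 1..}" "s \<in> {n + 1..}" and rs: "r < s"
    then have r: "n < r" and "r \<noteq> p" "s \<noteq> p" using p by auto
    consider "r = q" | "s = q" | "r \<noteq> q" "s \<noteq> q" by blast
    then show "(w \<circ> ?t) r < (w \<circ> ?t) s"
    proof cases
      case 1
      then have "w p < w s" using p(4) less[OF r rs] by simp
      then show ?thesis using 1 rs \<open>s \<noteq> p\<close> by (simp add: Transposition.transpose_def)
    next
      case 2
      have "w r < w q" using less[OF r rs] 2 by simp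
      moreover have "\<not> (w p < w r \<and> w r < w q)" using r rs p 2 by (intro c) auto
      moreover have "w r \<noteq> w p" using permutes_inj[OF perm] \<open>r \<noteq> p\<close> by (auto dest: injD)
      ultimately have "w r < w p" by simp
      then show ?thesis using 2 rs \<open>r \<noteq> p\<close> by (simp add: Transposition.transpose_def)
    next
      case 3
      then show ?thesis using less[OF r rs] \<open>r \<noteq> p\<close> \<open>s \<noteq> p\<close> by (simp add: Transposition.transpose_def)
    qed
  qed
  ultimately show ?thesis by (simp add: S_infty_n_def S_infty_def)
qed

lemma inv_set_simple:
  assumes "1 \<le> \<nu>"
  shows "inv_set (Transposition.transpose \<nu> (Suc \<nu>)) j = (if j = Suc \<nu> then {\<nu>} else {})"
proof -
  have "Transposition.transpose \<nu> (Suc \<nu>) i > Transposition.transpose \<nu> (Suc \<nu>) j \<longleftrightarrow> i = \<nu> \<and> j = Suc \<nu>"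
    if "i < j" for i
    using that by (auto simp: Transposition.transpose_def)
  then show ?thesis using assms by (auto simp: inv_set_def)
qed

lemma orbit_single_cell:
  assumes \<nu>: "1 \<le> \<nu>" "\<nu> < L" and L: "k < L"
  shows "fs.orbit (row_ops L) (cre (k, \<nu>) (delta {})) = (fs.span ((\<lambda>i. cre (k, i) (delta {})) ` {1..\<nu>}) :: 'k::field fock set)"
    (is "?O = fs.span ?D")
proof
  have zero: "eop L a b (delta {}) = 0" for a b by (simp add: eop_def ann_delta)
  have act: "eop L a b (cre (k, i) (delta {})) = (if b = i then cre (k, a) (delta {}) else 0)" for a b i
    using eop_cre[OF L, of a b i "delta {}"] by (simp add: zero)
  show "?O \<subseteq> fs.span ?D"
  proof (rule fs.orbit_subset[OF fs.subspace_span])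
    show "cre (k, \<nu>) (delta {}) \<in> fs.span ?D" using \<nu> by (intro fs.span_base) auto
    fix e :: "'k fock \<Rightarrow> 'k fock" and x assume e: "e \<in> row_ops L" and x: "x \<in> fs.span ?D"
    obtain a b where ab: "e = eop L a b" "1 \<le> a" "a \<le> b" using e by (auto simp: row_ops_def)
    have "e y \<in> fs.span ?D" if hy: "y \<in> ?D" for y
    proof -
      obtain i where i: "i \<in> {1..\<nu>}" "y = cre (k, i) (delta {})" using hy by blast
      show ?thesis
      proof (cases "b = i")
        case True
        then have "e y = cre (k, a) (delta {})" unfolding i(2) ab(1) act by simp
        also have "\<dots> \<in> ?D" using True i(1) ab by auto
        finally show ?thesis by (rule fs.span_base)
      next
        case False
        then have "e y = 0" unfolding i(2) ab(1) act by simp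
        then show ?thesis using fs.span_zero by simp
      qed
    qed
    then show "e x \<in> fs.span ?D" by (rule fs.span_Union_closed[OF _ lin_row_ops[OF e] x])
  qed
  have "cre (k, i) (delta {}) \<in> ?O" if i: "i \<in> {1..\<nu>}" for i
  proof -
    have e: "eop L i \<nu> \<in> row_ops L" using i \<nu> unfolding row_ops_def by auto
    have "eop L i \<nu> (cre (k, \<nu>) (delta {})) \<in> ?O" by (rule fs.orbit_closed[OF e fs.orbit_base])
    then show ?thesis by (simp add: act)
  qed
  then show "fs.span ?D \<subseteq> ?O" by (intro fs.span_minimal fs.subspace_orbit image_subsetI)
qed

text \<open>The module of \<open>w\<close> occupies the columns from 1 on, that of the simple transposition column 0.\<close>

definition column_product :: "'k::field fock \<Rightarrow> 'k fock \<Rightarrow> 'k fock" where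
  "column_product g h = (\<lambda>S. g (S \<inter> ({1..} \<times> UNIV)) * h (S \<inter> ({0} \<times> UNIV)))"

lemma lin_column_product: "fs.lin (column_product g)"
  by (auto simp: fs.lin_def column_product_def fscale_def fun_eq_iff algebra_simps)

lemma bprod_column_product:
  "bprod {0, 1} (\<lambda>j. if j = 0 then {1..} else {0}) h = column_product (h 0) (h 1)"
proof -
  have "S \<subseteq> (\<Union>j\<in>{0, 1}. if j = (0::nat) then {1..} else {0::nat}) \<times> (UNIV :: nat set)" for S
    by (auto simp: Suc_le_eq)
  then show ?thesis by (simp add: bprod_def column_product_def fun_eq_iff)
qed

text \<open>\<open>g\<close> has no cells in column 0, so the created cell is alone there and its
  sign is 1.\<close>

lemma column_product_cre:
  assumes g: "g \<in> in_block {1..}"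
  shows "column_product g (cre (0, i) (delta {})) = cre (0, i) g"
proof
  fix S :: "(nat \<times> nat) set"
  have col: "x \<in> {1..} \<times> UNIV \<or> x \<in> {0} \<times> UNIV" for x :: "nat \<times> nat" by (cases x) auto
  show "column_product g (cre (0, i) (delta {})) S = cre (0, i) g S"
  proof (cases "S \<inter> ({0} \<times> UNIV) = {(0, i)}")
    case True
    have "{i'. i' < i \<and> (0, i') \<in> S} = {}"
    proof -
      have "i' = i" if "(0, i') \<in> S" for i'
      proof -
        have "(0, i') \<in> S \<inter> ({0} \<times> UNIV)" using that by simp
        then show ?thesis unfolding True by simp
      qed
      then show ?thesis by auto
    qed
    then have "(csign (0, i) S :: 'a) = 1" by (simp only: csign_def fst_conv snd_conv) simp
    moreover have "(csign (0, i) {} :: 'a) = 1" by (simp add: csign_def)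
    moreover have "(0, i) \<in> S" using True by auto
    moreover have "S \<inter> ({1..} \<times> UNIV) = S - {(0, i)}"
    proof -
      have "x \<in> {1..} \<times> UNIV \<longleftrightarrow> x \<noteq> (0, i)" if "x \<in> S" for x
      proof -
        have "x \<in> {0} \<times> UNIV \<longleftrightarrow> x = (0, i)" using that True by blast
        moreover have "x \<in> {1..} \<times> UNIV \<longleftrightarrow> x \<notin> {0} \<times> UNIV" by (cases x) auto
        ultimately show ?thesis by simp
      qed
      then show ?thesis by blast
    qed
    moreover have "cre (0, i) (delta {}) {(0, i)} = (1 :: 'a)" by (simp add: cre_delta_empty csign_def)
    ultimately show ?thesis by (simp only: column_product_def True) (simp add: cre_def[of _ g])
  next
    case False
    have "cre (0, i) g S = 0"
    proof (cases "(0, i) \<in> S")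
      case True
      then obtain x where x: "x \<in> S" "x \<in> {0} \<times> UNIV" "x \<noteq> (0, i)" using False by blast
      have "\<not> S - {(0, i)} \<subseteq> {1..} \<times> UNIV"
      proof
        assume "S - {(0, i)} \<subseteq> {1..} \<times> UNIV"
        then have "x \<in> {1..} \<times> UNIV" using x by blast
        with x(2) show False by auto
      qed
      then have "g (S - {(0, i)}) = 0" using g unfolding supported_def by blast
      then show ?thesis by (simp add: cre_def)
    qed (simp add: cre_def)
    then show ?thesis using False by (simp add: column_product_def cre_delta_empty)
  qed
qed

text \<open>The columns of \<open>w\<close> are kept, and the simple transposition has inversions in
  one column only, so the constant relabelling by 0 is injective on it. The blocks are disjoint, and
  multiplying by a vector of column 0 is a creation operator.\<close>

lemma tensor_KP_realizes:
  assumes w: "w permutes {1..N}" and rows: "\<And>j i. i \<in> inv_set w j \<Longrightarrow> i \<le> n"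
    and L: "N < L" "n < L" and \<nu>: "1 \<le> \<nu>" "\<nu> \<le> n"
  shows "\<exists>F. realizes n L (tensor (KP_module n w :: ('k::field_char_0, 'k kp) brep)
      (KP_module n (Transposition.transpose \<nu> (Suc \<nu>)))) F \<and>
    F ` carrier (tensor (KP_module n w :: ('k, 'k kp) brep) (KP_module n (Transposition.transpose \<nu> (Suc \<nu>)))) =
      tensor_space L \<nu> w"
proof -
  let ?s = "Transposition.transpose \<nu> (Suc \<nu>)"
  let ?A = "KP_module n w :: ('k, 'k kp) brep" and ?B = "KP_module n ?s :: ('k, 'k kp) brep"
  note s = inv_set_simple[OF \<nu>(1)]
  have J: "j \<in> {1..N}" if j: "j \<in> inv_support w" for j
  proof -
    obtain i where "(j, i) \<in> cells w" using j by (auto simp: inv_support_def cells_def)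
    then show ?thesis using cells_subset[OF w] by blast
  qed
  have "\<exists>f. realizes n L ?A f \<and> f ` carrier ?A = fs.orbit (row_ops L) (delta ((\<lambda>(j, i). (id j, i)) ` cells w)) \<and>
    f ` carrier ?A \<subseteq> supported (\<lambda>S. S \<subseteq> id ` inv_support w \<times> {1..n})"
  proof (rule KP_module_realizes[OF w _ L(2)])
    show "i \<le> n" if "i \<in> inv_set w j" for i j by (rule rows[OF that])
    show "id j < L" if "j \<in> inv_support w" for j using J[OF that] L by simp
  qed simp
  then obtain f0 where f0: "realizes n L ?A f0" "f0 ` carrier ?A = gen_orbit L w"
    "f0 ` carrier ?A \<subseteq> supported (\<lambda>S. S \<subseteq> inv_support w \<times> {1..n})"
    by (auto simp: gen_orbit_def)
  have f0_block: "f0 ` carrier ?A \<subseteq> in_block {1..}"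
  proof -
    have "inv_support w \<times> {1..n} \<subseteq> {1..} \<times> UNIV" using J by fastforce
    then have "supported (\<lambda>S. S \<subseteq> inv_support w \<times> {1..n}) \<subseteq> (in_block {1..} :: 'k fock set)"
      unfolding supported_def by blast
    with f0(3) show ?thesis by (rule order_trans)
  qed
  have "\<exists>f. realizes n L ?B f \<and> f ` carrier ?B = fs.orbit (row_ops L) (delta ((\<lambda>(j, i). ((\<lambda>_. 0) j, i)) ` cells ?s)) \<and>
    f ` carrier ?B \<subseteq> supported (\<lambda>S. S \<subseteq> (\<lambda>_. 0) ` inv_support ?s \<times> {1..n})"
  proof (rule KP_module_realizes[of ?s "Suc \<nu>", OF _ _ L(2)])
    show "?s permutes {1..Suc \<nu>}" using \<nu> by (intro permutes_swap_id) auto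
    show "i \<le> n" if "i \<in> inv_set ?s j" for i j using that \<nu> by (simp add: s split: if_splits)
    show "inj_on (\<lambda>_. 0::nat) (inv_support ?s)" by (auto simp: inv_support_def s inj_on_def split: if_splits)
  qed (use L in auto)
  then obtain f1 where f1: "realizes n L ?B f1"
    "f1 ` carrier ?B = fs.orbit (row_ops L) (delta ((\<lambda>(j, i). (0, i)) ` cells ?s))"
    "f1 ` carrier ?B \<subseteq> supported (\<lambda>S. S \<subseteq> (\<lambda>_. 0) ` inv_support ?s \<times> {1..n})"
    by blast
  let ?c = "\<lambda>i. cre (0, i) (delta {}) :: 'k fock"
  have "cells ?s = {(Suc \<nu>, \<nu>)}" by (auto simp: cells_def s split: if_splits)
  then have "delta ((\<lambda>(j, i). (0, i)) ` cells ?s) = ?c \<nu>"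
    by (simp add: cre_delta csign_def)
  then have f1_im: "f1 ` carrier ?B = fs.span (?c ` {1..\<nu>})"
    using orbit_single_cell[of \<nu> L 0, where 'k = 'k] \<nu> L by (simp add: f1(2))
  have f1_block: "f1 ` carrier ?B \<subseteq> in_block {0}"
  proof -
    have "supported (\<lambda>S. S \<subseteq> (\<lambda>_. 0) ` inv_support ?s \<times> {1..n}) \<subseteq> (in_block {0} :: 'k fock set)"
      unfolding supported_def by blast
    with f1(3) show ?thesis by (rule order_trans)
  qed
  let ?M = "\<lambda>j::nat. if j = 0 then ?A else ?B" and ?f = "\<lambda>j::nat. if j = 0 then f0 else f1"
    and ?K = "\<lambda>j::nat. if j = 0 then {1..} else {0::nat}"
  let ?P = "\<Pi>\<^sub>E j\<in>{0, 1}. carrier (?M j)" and ?G = "\<lambda>x. bprod {0, 1} ?K (\<lambda>j. ?f j (x j))"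
  have "\<exists>F. realizes n L (Tensor {0, 1} ?M) F \<and> F ` carrier (Tensor {0, 1} ?M) = fs.span (?G ` ?P) \<and>
    (\<forall>x\<in>?P. pure_tensor {0, 1} ?M x \<in> carrier (Tensor {0, 1} ?M) \<and> F (pure_tensor {0, 1} ?M x) = ?G x)"
  proof (rule tensor_realizes)
    show "?K i \<inter> ?K j = {}" if "i \<in> {0, 1}" "j \<in> {0, 1}" "i \<noteq> j" for i j using that by auto
    show "realizes n L (?M j) (?f j)" for j using f0(1) f1(1) by simp
    show "?f j ` carrier (?M j) \<subseteq> in_block (?K j)" for j using f0_block f1_block by simp
    have "\<exists>C. finite C \<and> f0 ` carrier ?A \<subseteq> fs.span C"
      unfolding f0(2) by (rule gen_orbit_finite_span[OF cells_subset_box[OF w L(1)]])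
    moreover have "\<exists>C. finite C \<and> f1 ` carrier ?B \<subseteq> fs.span C"
      unfolding f1_im by (rule exI[of _ "?c ` {1..\<nu>}"]) simp
    ultimately show "\<exists>C. finite C \<and> ?f j ` carrier (?M j) \<subseteq> fs.span C" for j by simp
  qed simp
  moreover have "fs.span (?G ` ?P) = tensor_space L \<nu> w"
  proof
    have "?G x \<in> tensor_space L \<nu> w" if x: "x \<in> ?P" for x
    proof -
      have x0: "x 0 \<in> carrier ?A" and x1: "x 1 \<in> carrier ?B" using x by (auto simp: PiE_def Pi_def)
      let ?g = "f0 (x 0)"
      have g: "?g \<in> gen_orbit L w" "?g \<in> in_block {1..}" using x0 f0(2) f0_block by blast+
      have "fs.span (?c ` {1..\<nu>}) \<subseteq> {h. column_product ?g h \<in> tensor_space L \<nu> w}"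
      proof (rule fs.span_minimal)
        show "?c ` {1..\<nu>} \<subseteq> {h. column_product ?g h \<in> tensor_space L \<nu> w}"
          unfolding tensor_space_def using g by (auto simp: column_product_cre intro!: fs.span_base)
        show "fs.subspace {h. column_product ?g h \<in> tensor_space L \<nu> w}"
          unfolding tensor_space_def by (rule fs.lin_subspace_vimage[OF lin_column_product fs.subspace_span])
      qed
      then have "column_product ?g (f1 (x 1)) \<in> tensor_space L \<nu> w" using x1 f1_im by blast
      then show ?thesis unfolding bprod_column_product by simp
    qed
    then show "fs.span (?G ` ?P) \<subseteq> tensor_space L \<nu> w"
      by (intro fs.span_minimal image_subsetI) (auto simp: tensor_space_def)
    show "tensor_space L \<nu> w \<subseteq> fs.span (?G ` ?P)"
      unfolding tensor_space_def
    proof (intro fs.span_mono UN_least subsetI)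
      fix i and y :: "'k fock" assume i: "i \<in> {1..\<nu>}" and y: "y \<in> cre (0, i) ` gen_orbit L w"
      obtain g :: "'k fock" where g: "g \<in> gen_orbit L w" "y = cre (0, i) g" using y by (rule imageE) (rule that)
      have gA: "g \<in> f0 ` carrier ?A" unfolding f0(2) by (rule g(1))
      then obtain a where a: "a \<in> carrier ?A" "f0 a = g" by (rule imageE) (rule that, assumption, rule sym, assumption)
      have "?c i \<in> f1 ` carrier ?B" unfolding f1_im using i by (intro fs.span_base) auto
      then obtain b where b: "b \<in> carrier ?B" "f1 b = ?c i" by (rule imageE) (rule that, assumption, rule sym, assumption)
      have gb: "g \<in> in_block {1..}" by (rule subsetD[OF f0_block gA])
      let ?x = "\<lambda>j\<in>{0, 1}. if j = 0 then a else b"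
      have "y = ?G ?x" unfolding bprod_column_product
        by (simp add: a(2) b(2) column_product_cre[OF gb] g(2))
      moreover have "?x \<in> ?P" using a(1) b(1) by auto
      ultimately show "y \<in> ?G ` ?P" by (rule image_eqI[of y ?G ?x])
    qed
  qed
  ultimately show ?thesis unfolding tensor_def by auto
qed

section \<open>The filtration\<close>

lemma lifts_compose:
  assumes l: "lifts n L M F" and lin: "fs.lin \<phi>"
    and com: "\<And>X y. X \<in> borel_alg n \<Longrightarrow> \<phi> (rho L n X y) = rho L n X (\<phi> y)"
  shows "lifts n L M (\<lambda>x. \<phi> (F x))"
  using l unfolding lifts_def by (simp add: fs.lin_add[OF lin] fs.lin_scale[OF lin] fs.lin_0[OF lin] com)

lemma rho_commute:
  assumes lin: "fs.lin \<phi>" and com: "\<And>e y. e \<in> row_ops L \<Longrightarrow> \<phi> (e y) = e (\<phi> y)" and n: "n < L"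
    and X: "X \<in> borel_alg n"
  shows "\<phi> (rho L n X y) = rho L n X (\<phi> y)"
proof -
  have "\<phi> (fscale (X $$ (a, b)) (eop L (Suc a) (Suc b) y)) = fscale (X $$ (a, b)) (eop L (Suc a) (Suc b) (\<phi> y))"
    if ab: "a < n" "b < n" for a b
  proof (cases "a \<le> b")
    case True
    then have "eop L (Suc a) (Suc b) \<in> row_ops L" using ab n unfolding row_ops_def by fastforce
    from com[OF this, of y] show ?thesis by (simp add: fs.lin_scale[OF lin])
  next
    case False
    then have "X $$ (a, b) = 0" using X ab by (auto simp: borel_alg_def upper_triangular_def)
    then show ?thesis by (simp add: fs.lin_0[OF lin])
  qed
  then show ?thesis by (simp add: rho_def fs.lin_map_sum[OF lin])
qed

text \<open>The chain \<open>W\<close> is pulled back along \<open>F\<close>. On its terms the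
  composite of \<open>F\<close> with \<phi> i has the preceding term as kernel and thus realizes the
  quotient; modules realized with the same image are isomorphic.\<close>

lemma has_KP_filtrationI:
  fixes M :: "('k::field_char_0, 'v) brep"
  assumes F: "realizes n L M F" and L: "n < L"
    and W: "W 0 = {0}" "W r = F ` carrier M" "\<And>i. fs.subspace (W i)"
      "\<And>i e y. e \<in> row_ops L \<Longrightarrow> y \<in> W i \<Longrightarrow> e y \<in> W i" "mono W"
    and \<phi>: "\<And>i. i < r \<Longrightarrow> fs.lin (\<phi> i)"
      "\<And>i e y. i < r \<Longrightarrow> e \<in> row_ops L \<Longrightarrow> \<phi> i (e y) = e (\<phi> i y)"
      "\<And>i. i < r \<Longrightarrow> {y \<in> W (Suc i). \<phi> i y = 0} = W i"
    and x: "\<And>i. i < r \<Longrightarrow> x i \<in> S_infty_n n"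
      "\<And>i. i < r \<Longrightarrow> \<exists>g. realizes n L (KP_module n (x i) :: ('k, 'k kp) brep) g \<and>
         g ` carrier (KP_module n (x i) :: ('k, 'k kp) brep) = \<phi> i ` W (Suc i)"
  shows "has_KP_filtration n M"
proof -
  define Fil where "Fil = (\<lambda>i. {x \<in> carrier M. F x \<in> W i})"
  have img: "F ` Fil i = W i" if "i \<le> r" for i
  proof -
    have "W i \<subseteq> F ` carrier M" using monoD[OF W(5) that] W(2) by simp
    then show ?thesis unfolding Fil_def by blast
  qed
  have Fil_car: "Fil i \<subseteq> carrier M" for i by (auto simp: Fil_def)
  have sub: "realizes n L (M\<lparr>carrier := Fil i\<rparr>) F" "b_submodule n (Fil i) M" if i: "i \<le> r" for i
  proof -
    have s: "fs.subspace (F ` Fil i)" unfolding img[OF i] by (rule W(3))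
    have c: "rho L n X y \<in> F ` Fil i" if "X \<in> borel_alg n" "y \<in> F ` Fil i" for X y
      using that(2) unfolding img[OF i] by (intro rho_closed[OF W(3) _ L that(1)]) (rule W(4))
    show "realizes n L (M\<lparr>carrier := Fil i\<rparr>) F" by (rule realizes_restrict(1)[OF F Fil_car s c])
    show "b_submodule n (Fil i) M" by (rule realizes_restrict(2)[OF F Fil_car s c])
  qed
  have "Fil 0 = {\<zero>\<^bsub>M\<^esub>}" unfolding Fil_def W(1) using realizes_eqI[OF F] by (auto simp: realizes_simps[OF F])
  moreover have "Fil r = carrier M" unfolding Fil_def W(2) by blast
  moreover have "\<exists>y\<in>S_infty_n n. b_isomorphic n (quot_rep (M\<lparr>carrier := Fil (Suc i)\<rparr>) (Fil i)) (KP_module n y :: ('k, 'k kp) brep)"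
    if i: "i < r" for i
  proof -
    let ?M = "M\<lparr>carrier := Fil (Suc i)\<rparr>"
    obtain g where g: "realizes n L (KP_module n (x i) :: ('k, 'k kp) brep) g"
      "g ` carrier (KP_module n (x i) :: ('k, 'k kp) brep) = \<phi> i ` W (Suc i)"
      using x(2)[OF i] by blast
    have si: "Suc i \<le> r" using i by simp
    have "\<phi> i (rho L n X y) = rho L n X (\<phi> i y)" if "X \<in> borel_alg n" for X y
      by (rule rho_commute[OF \<phi>(1)[OF i] _ L that]) (rule \<phi>(2)[OF i])
    then have l: "lifts n L ?M (\<lambda>x. \<phi> i (F x))"
      by (rule lifts_compose[OF realizes_lifts[OF sub(1)[OF si]] \<phi>(1)[OF i]])
    have "W i \<subseteq> W (Suc i)" using \<phi>(3)[OF i] by blast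
    then have "{x \<in> carrier ?M. \<phi> i (F x) = 0} = Fil i" using \<phi>(3)[OF i] by (auto simp: Fil_def)
    note Q = quotient_realizes[OF l, unfolded this]
    have "(\<lambda>x. \<phi> i (F x)) ` carrier ?M = g ` carrier (KP_module n (x i) :: ('k, 'k kp) brep)"
      using img[OF si] g(2) by (simp add: image_image[symmetric, of "\<phi> i" F])
    then have "b_isomorphic n (quot_rep ?M (Fil i)) (KP_module n (x i) :: ('k, 'k kp) brep)"
      using Q(2) by (intro realizes_isomorphic[OF Q(1) g(1)]) simp
    then show ?thesis using x(1)[OF i] by blast
  qed
  moreover have "Fil i \<subseteq> Fil (Suc i)" for i using monoD[OF W(5), of i "Suc i"] by (auto simp: Fil_def)
  ultimately show ?thesis unfolding has_KP_filtration_def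
    using realizes_b_module[OF F] sub(2) by (intro conjI exI[of _ r] exI[of _ Fil] allI impI) auto
qed

theorem proposition3p1:
  fixes n \<nu> :: nat and w :: "nat \<Rightarrow> nat"
  assumes "n \<ge> 1"
    and "w \<in> S_infty_n n"
    and "1 \<le> \<nu>" and "\<nu> \<le> n - 1"
  shows "has_KP_filtration n
    (tensor (KP_module n w :: ('k::field_char_0, 'k kp) brep)
            (KP_module n (Transposition.transpose \<nu> (Suc \<nu>))))"
proof -
  let ?T = "tensor (KP_module n w :: ('k, 'k kp) brep) (KP_module n (Transposition.transpose \<nu> (Suc \<nu>)))"
  obtain N where N: "n \<le> N" "w permutes {1..N}" using S_infty_n_permutes[OF assms(2)] .
  \<comment> \<open>Position N + 1, which covers of \<open>w\<close> may involve, has to lie below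
    the cut-off.\<close>
  define L where "L = N + 2"
  have LN: "N < L" "Suc N < L" "n < L" and \<nu>: "\<nu> \<le> n" "\<nu> \<le> N" using N(1) assms(4) by (auto simp: L_def)
  note ctx = N(2) LN(2) \<nu>(2)
  note rows = S_infty_n_rows[OF assms(2)]
  obtain F where F: "realizes n L ?T F" "F ` carrier ?T = tensor_space L \<nu> w"
    using tensor_KP_realizes[OF N(2) _ LN(1,3) assms(3) \<nu>(1), where 'k = 'k] rows by blast
  obtain xs where xs: "distinct xs" "set xs = covers \<nu> w"
    "\<And>i j. i < length xs \<Longrightarrow> j < i \<Longrightarrow> tmap L w (xs ! i) (tvec L w (xs ! j)) = (0 :: 'k fock)"
    using covers_enumeration[OF ctx, where 'k = 'k] by blast
  obtain B where B: "finite B" "(tensor_space L \<nu> w :: 'k fock set) \<subseteq> fs.span B"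
    using tensor_space_finite_span[OF ctx] by blast
  have mem: "xs ! i \<in> covers \<nu> w" if "i < length xs" for i using nth_mem[OF that] xs by simp
  define x where "x = (\<lambda>i. w \<circ> (case xs ! i of (p, q) \<Rightarrow> Transposition.transpose p q))"
  let ?v = "\<lambda>i. tvec L w (xs ! i) :: 'k fock" and ?f = "\<lambda>i. tmap L w (xs ! i) :: 'k fock \<Rightarrow> 'k fock"
  have orb: "fs.orbit (row_ops L) (?f i (?v i)) = gen_orbit L (x i)" if "i < length xs" for i
  proof -
    obtain p q where pq: "xs ! i = (p, q)" by fastforce
    then show ?thesis using orbit_tmap_tvec[OF ctx, of p q] mem[OF that] by (simp add: x_def)
  qed
  have com: "?f i (e y) = e (?f i y)" if "i < length xs" "e \<in> row_ops L" for i e y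
  proof -
    obtain p q where pq: "xs ! i = (p, q)" by fastforce
    then show ?thesis using tmap_commute[OF ctx _ that(2), of p q y] mem[OF that(1)] by simp
  qed
  define W where "W = (\<lambda>i. fs.span (\<Union>j<i. fs.orbit (row_ops L) (?v j)))"
  have chain: "W (length xs) = tensor_space L \<nu> w \<and> (\<forall>i<length xs. {y \<in> W (Suc i). ?f i y = 0} = W i \<and>
      ?f i ` W (Suc i) = fs.orbit (row_ops L) (?f i (?v i)))"
    unfolding W_def
  proof (rule fs.orbit_chain(2)[where B = B])
    show "tensor_space L \<nu> w \<subseteq> fs.span B" "finite B" "fs.subspace (tensor_space L \<nu> w :: 'k fock set)"
      by (rule B subspace_tensor_space[OF ctx])+
    show "fs.lin e" if "e \<in> row_ops L" for e :: "'k fock \<Rightarrow> 'k fock" by (rule lin_row_ops[OF that])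
    show "e y \<in> tensor_space L \<nu> w" if "e \<in> row_ops L" "y \<in> tensor_space L \<nu> w" for e and y :: "'k fock"
      by (rule tensor_space_closed[OF ctx that])
    show "?v i \<in> tensor_space L \<nu> w" if "i < length xs" for i
      using mem[OF that] tvec_tensor_space[OF ctx] by (cases "xs ! i") simp
    show "fs.lin (?f i)" for i by (rule lin_tmap)
    show "\<exists>c. ?f i (e y) = e (?f i y) + fscale c (?f i y)" if "i < length xs" "e \<in> row_ops L" for i e y
      using com[OF that] by (intro exI[of _ 0]) simp
    show "?f i (?v j) = 0" if "j < i" "i < length xs" for i j by (rule xs(3)[OF that(2,1)])
    \<comment> \<open>This inequality puts \<open>orbit_chain\<close> into its equality
      case.\<close>
    have "fs.dim (tensor_space L \<nu> w :: 'k fock set) \<le>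
        (\<Sum>(p, q)\<in>covers \<nu> w. fs.dim (gen_orbit L (w \<circ> Transposition.transpose p q) :: 'k fock set))"
      by (rule dim_tensor_space_le[OF ctx])
    also have "\<dots> = (\<Sum>i<length xs. fs.dim (gen_orbit L (x i) :: 'k fock set))"
      unfolding xs(2)[symmetric] using xs(1)
      by (simp add: sum.distinct_set_conv_list sum_list_sum_nth atLeast0LessThan x_def case_prod_unfold)
    also have "\<dots> = (\<Sum>i<length xs. fs.dim (fs.orbit (row_ops L) (?f i (?v i))))"
      by (intro sum.cong refl) (simp add: orb)
    finally show "fs.dim (tensor_space L \<nu> w :: 'k fock set) \<le> (\<Sum>i<length xs. fs.dim (fs.orbit (row_ops L) (?f i (?v i))))" .
  qed
  show ?thesis
  proof (rule has_KP_filtrationI[OF F(1) LN(3), where W = W and r = "length xs" and \<phi> = ?f and x = x])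
    show "W 0 = {0}" by (simp add: W_def)
    show "W (length xs) = F ` carrier ?T" using chain F(2) by simp
    show "fs.subspace (W i)" for i unfolding W_def by (rule fs.subspace_span)
    show "mono W" unfolding W_def by (intro monoI fs.span_mono UN_mono) auto
    show "e y \<in> W i" if e: "e \<in> row_ops L" and y: "y \<in> W i" for i e y
      unfolding W_def
    proof (rule fs.span_Union_closed[OF _ lin_row_ops[OF e] y[unfolded W_def]])
      fix z assume "z \<in> (\<Union>j<i. fs.orbit (row_ops L) (?v j))"
      then obtain j where j: "j < i" "z \<in> fs.orbit (row_ops L) (?v j)" by blast
      show "e z \<in> fs.span (\<Union>j<i. fs.orbit (row_ops L) (?v j))"
        using j(1) fs.orbit_closed[OF e j(2)] by (intro fs.span_base UN_I[of j]) simp_all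
    qed
    show "fs.lin (?f i)" for i by (rule lin_tmap)
    show "?f i (e y) = e (?f i y)" if "i < length xs" "e \<in> row_ops L" for i e y by (rule com[OF that])
    show "{y \<in> W (Suc i). ?f i y = 0} = W i" if "i < length xs" for i using chain that by blast
    fix i assume i: "i < length xs"
    obtain p q where pq: "xs ! i = (p, q)" by fastforce
    then have c: "(p, q) \<in> covers \<nu> w" and x_eq: "x i = w \<circ> Transposition.transpose p q"
      using mem[OF i] by (simp_all add: x_def)
    show x_in: "x i \<in> S_infty_n n" unfolding x_eq by (rule S_infty_n_cover[OF assms(2) c \<nu>(1)])
    have "q \<le> Suc N" using covers_bound[OF N(2) c] \<nu>(2) by simp
    then have perm: "x i permutes {1..Suc N}"
      using c unfolding x_eq by (intro permutes_transpose_right[OF N(2)]) (auto simp: covers_def cover_def)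
    have J: "j < L" if hj: "j \<in> inv_support (x i)" for j
    proof -
      obtain k where "(j, k) \<in> cells (x i)" using hj by (auto simp: inv_support_def cells_def)
      then have "j \<in> {1..Suc N}" using cells_subset[OF perm] by blast
      then show ?thesis by (simp add: L_def)
    qed
    \<comment> \<open>With every column kept in place, the image is literally the orbit onto which
      \<open>tmap\<close> maps the next term of the chain.\<close>
    have "\<exists>g. realizes n L (KP_module n (x i) :: ('k, 'k kp) brep) g \<and>
      g ` carrier (KP_module n (x i) :: ('k, 'k kp) brep) = fs.orbit (row_ops L) (delta ((\<lambda>(j, k). (id j, k)) ` cells (x i))) \<and>
      g ` carrier (KP_module n (x i) :: ('k, 'k kp) brep) \<subseteq> supported (\<lambda>S. S \<subseteq> id ` inv_support (x i) \<times> {1..n})"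
    proof (rule KP_module_realizes[OF perm _ LN(3)])
      show "k \<le> n" if "k \<in> inv_set (x i) j" for j k by (rule S_infty_n_rows[OF x_in that])
      show "id j < L" if "j \<in> inv_support (x i)" for j using J[OF that] by simp
    qed simp
    then obtain g where "realizes n L (KP_module n (x i) :: ('k, 'k kp) brep) g"
      "g ` carrier (KP_module n (x i) :: ('k, 'k kp) brep) = gen_orbit L (x i)"
      by (auto simp: gen_orbit_def)
    then show "\<exists>g. realizes n L (KP_module n (x i) :: ('k, 'k kp) brep) g \<and>
      g ` carrier (KP_module n (x i) :: ('k, 'k kp) brep) = ?f i ` W (Suc i)"
      using chain orb[OF i] i by auto
  qed
qed

end
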